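(* Let $\mathcal{O}$ be a commutative ring and $n\geq 1$ an integer. For each $i\in\{1,\dots,n\}$ let $G_i$ be a finite group, $N_i$ a normal subgroup of $G_i$, $\bar{G}_i:=G_i/N_i$, let $\mathcal{C}_i$ be a $\bar{G}_i$-graded $\bar{G}_i$-acted algebra, and let $A_i$ and $A'_i$ be $\bar{G}_i$-graded crossed products over $\mathcal{C}_i$. Put $\mathbf{\bar{G}}:=\prod_{i=1}^n\bar{G}_i$. Suppose that, for all $i$, $A_i$ and $A'_i$ are $\bar{G}_i$-graded Morita equivalent over $\mathcal{C}_i$, and that $\tilde{M}_i$ is a $\bar{G}_i$-graded $(A_i,A'_i)$-bimodule over $\mathcal{C}_i$ which induces this equivalence. Put $\mathbf{A}:=A_1\otimes\cdots\otimes A_n$, $\mathbf{A'}:=A'_1\otimes\cdots\otimes A'_n$ and $\mathbf{C}:=\mathcal{C}_1\otimes\cdots\otimes\mathcal{C}_n$. Then: (1) $\mathbf{\tilde{M}}:=\tilde{M}_1\otimes\cdots\otimes\tilde{M}_n$ is a $\mathbf{\bar{G}}$-graded $(\mathbf{A},\mathbf{A'})$-bimodule over $\mathbf{C}$; (2) $\mathbf{\tilde{M}}$ induces a $\mathbf{\bar{G}}$-graded Morita equivalence over $\mathbf{C}$ between $\mathbf{A}$ and $\mathbf{A'}$.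
   Context: Conventions. All given rings are associative with identity $1\neq 0$; all modules (left unless specified) are unital and finitely generated; algebras are $\mathcal{O}$-algebras and unadorned $\otimes$ means $\otimes_{\mathcal{O}}$. General definitions (for a finite group $\Gamma$, to be used for $\Gamma=\bar{G}_i$ and $\Gamma=\mathbf{\bar{G}}$). - A $\Gamma$-graded algebra $A=\bigoplus_{g\in\Gamma}A_g$ (with $A_gA_h\subseteq A_{gh}$) is a crossed product if every $A_g$ contains an invertible element of $A$. - A $\Gamma$-graded $\Gamma$-acted algebra is a $\Gamma$-graded algebra $\mathcal{D}=\bigoplus_{g\in \Gamma}\mathcal{D}_g$ with a left action of $\Gamma$ by algebra automorphisms, $(g,c)\mapsto {}^{g}c$, such that ${}^{g}c\in\mathcal{D}_{{}^{g}h}$ for all $g,h\in\Gamma$, $c\in \mathcal{D}_h$, where ${}^{g}h=ghg^{-1}$. - For a $\Gamma$-graded crossed product $A$ with identity component $B=A_1$, the centralizer $C_A(B)$ is a $\Gamma$-graded $\Gamma$-acted algebra with $C_A(B)_g=C_A(B)\cap A_g$ and ${}^{g}a=u_gau_g^{-1}$, where $u_g\in A_g$ is any invertible homogeneous element (the result does not depend on the choice). $A$ is a $\Gamma$-graded crossed product over $\mathcal{D}$ if it comes with an algebra homomorphism (structure map) $\zeta:\mathcal{D}\to C_A(B)$ satisfying $\zeta(\mathcal{D}_h)\subseteq C_A(B)_h$ and $\zeta({}^{g}c)={}^{g}\zeta(c)$ for all $g,h\in\Gamma$, $c\in\mathcal{D}$. - Let $A,A'$ be $\Gamma$-graded crossed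 products over $\mathcal{D}$ with structure maps $\zeta,\zeta'$. A $\Gamma$-graded $(A,A')$-bimodule over $\mathcal{D}$ is an $(A,A')$-bimodule $\tilde{M}$ with a decomposition $\tilde{M}=\bigoplus_{g\in\Gamma}\tilde{M}_g$ such that $A_g\tilde{M}_xA'_h\subseteq\tilde{M}_{gxh}$ for all $g,x,h\in\Gamma$, and $\tilde{m}_gc={}^{g}c\,\tilde{m}_g$ for all $c\in\mathcal{D}$, $\tilde m_g\in\tilde{M}_g$, $g\in\Gamma$, where $c\tilde{m}:=\zeta(c)\tilde{m}$ and $\tilde{m}c:=\tilde{m}\zeta'(c)$. Morphisms of such objects are the homomorphisms of $\Gamma$-graded (grade-preserving) $(A,A')$-bimodules. - The dual $\tilde{M}^*=\mathrm{Hom}_A(\tilde{M},A)$ is a $\Gamma$-graded $(A',A)$-bimodule over $\mathcal{D}$, via $(a'fa)(m)=f(ma')a$ and $(\tilde{M}^* )_g=\{f: f(\tilde{M}_x)\subseteq A_{xg}\ \forall x\in\Gamma\}$. Tensor products of graded bimodules are graded by total degree. $\tilde{M}$ induces a $\Gamma$-graded Morita equivalence over $\mathcal{D}$ between $A$ and $A'$ if $\tilde{M}\otimes_{A'}\tilde{M}^*\simeq A$ as $\Gamma$-graded $(A,A)$-bimodules over $\mathcal{D}$ and $\tilde{M}^*\otimes_A\tilde{M}\simeq A'$ as $\Gamma$-graded $(A',A')$-bimodules over $\mathcal{D}$. $A$ and $A'$ are $\Gamma$-graded Morita equivalent over $\mathcal{D}$ if some such $\tilde{M}$ exists. Structures on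 tensor products. - $\mathbf{A}$ is $\mathbf{\bar{G}}$-graded by $\mathbf{A}_{(g_1,\dots,g_n)}=A_{1,g_1}\otimes\cdots\otimes A_{n,g_n}$, where $A_{i,g_i}$ is the $g_i$-component of $A_i$; similarly for $\mathbf{A'}$, $\mathbf{C}$ and $\mathbf{\tilde{M}}$, with $\mathbf{\tilde{M}}_{(g_1,\dots,g_n)}=\tilde{M}_{1,g_1}\otimes\cdots\otimes\tilde{M}_{n,g_n}$. The bimodule operations on $\mathbf{\tilde{M}}$ are componentwise. - $\mathbf{\bar{G}}$ acts on $\mathbf{C}$ by ${}^{(g_1,\dots,g_n)}(c_1\otimes\cdots\otimes c_n)={}^{g_1}c_1\otimes\cdots\otimes{}^{g_n}c_n$. - If $\zeta_i:\mathcal{C}_i\to C_{A_i}((A_i)_1)$ are the structure maps of the $A_i$, then $\mathbf{A}$ is a $\mathbf{\bar{G}}$-graded crossed product over $\mathbf{C}$ with structure map $c_1\otimes\cdots\otimes c_n\mapsto\zeta_1(c_1)\otimes\cdots\otimes\zeta_n(c_n)$; likewise for $\mathbf{A'}$. *)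

theory Defs
  imports "HOL-Algebra.Module" "HOL-Algebra.QuotRing" "HOL-Algebra.Product_Groups"
begin

section \<open>Graded structures\<close>

text \<open>
  Throughout, \<open>R\<close> is the commutative base ring (written \<open>\<O>\<close> on paper) and \<open>\<Gamma>\<close> a finite group.
  The record \<open>module\<close> of the library also carries multiplicative fields \<open>mult\<close> and \<open>one\<close>; they are
  used for algebras and ignored for modules and bimodules.
\<close>

record ('o, 'g, 'x) graded = "('o, 'x) module" +
  homog :: "'g \<Rightarrow> 'x set"

record ('o, 'g, 'c) acted = "('o, 'g, 'c) graded" +
  act :: "'g \<Rightarrow> 'c \<Rightarrow> 'c"

record ('o, 'g, 'c, 'a) crossed = "('o, 'g, 'a) graded" +
  str :: "'c \<Rightarrow> 'a"

record ('o, 'g, 'a, 'b, 'm) bimod = "('o, 'g, 'm) graded" +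
  lact :: "'a \<Rightarrow> 'm \<Rightarrow> 'm"
  ract :: "'m \<Rightarrow> 'b \<Rightarrow> 'm"

text \<open>
  The library locale \<open>algebra\<close> is restricted to commutative algebras. Nontriviality \<open>1 \<noteq> 0\<close> is not
  built in, because a tensor product of nonzero algebras can be the zero algebra.
\<close>

locale assoc_algebra = module + ring M +
  assumes smult_mult_left:
      "\<lbrakk>a \<in> carrier R; x \<in> carrier M; y \<in> carrier M\<rbrakk> \<Longrightarrow>
        (a \<odot>\<^bsub>M\<^esub> x) \<otimes>\<^bsub>M\<^esub> y = a \<odot>\<^bsub>M\<^esub> (x \<otimes>\<^bsub>M\<^esub> y)"
    and smult_mult_right:
      "\<lbrakk>a \<in> carrier R; x \<in> carrier M; y \<in> carrier M\<rbrakk> \<Longrightarrow>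
        x \<otimes>\<^bsub>M\<^esub> (a \<odot>\<^bsub>M\<^esub> y) = a \<odot>\<^bsub>M\<^esub> (x \<otimes>\<^bsub>M\<^esub> y)"

locale graded_module = module R M + \<Gamma>: group \<Gamma>
  for R (structure) and \<Gamma> (structure) and M :: "('o, 'g, 'x, 'z) graded_scheme" (structure) +
  assumes finite_\<Gamma>: "finite (carrier \<Gamma>)"
    and homog_submodule: "g \<in> carrier \<Gamma> \<Longrightarrow> submodule (homog M g) R M"
    and direct_sum:
      "x \<in> carrier M \<Longrightarrow>
        \<exists>!f. f \<in> (\<Pi>\<^sub>E g\<in>carrier \<Gamma>. homog M g) \<and> x = finsum M f (carrier \<Gamma>)"

locale graded_algebra = graded_module R \<Gamma> A + assoc_algebra R A
  for R (structure) and \<Gamma> (structure) and A (structure) +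
  assumes homog_mult:
      "\<lbrakk>g \<in> carrier \<Gamma>; h \<in> carrier \<Gamma>; a \<in> homog A g; b \<in> homog A h\<rbrakk> \<Longrightarrow>
        a \<otimes>\<^bsub>A\<^esub> b \<in> homog A (g \<otimes>\<^bsub>\<Gamma>\<^esub> h)"

definition algebra_hom ::
    "('o, 'p) ring_scheme \<Rightarrow> ('o, 'a, 'y) module_scheme \<Rightarrow> ('o, 'b, 'z) module_scheme \<Rightarrow> ('a \<Rightarrow> 'b) set"
  where "algebra_hom R A B =
    {h \<in> ring_hom A B. \<forall>r\<in>carrier R. \<forall>x\<in>carrier A. h (r \<odot>\<^bsub>A\<^esub> x) = r \<odot>\<^bsub>B\<^esub> h x}"

text \<open>The group laws below make every \<open>act D g\<close> bijective, hence an automorphism.\<close>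

locale graded_acted_algebra = graded_algebra R \<Gamma> D
  for R (structure) and \<Gamma> (structure) and D :: "('o, 'g, 'c, 'z) acted_scheme" (structure) +
  assumes act_hom: "g \<in> carrier \<Gamma> \<Longrightarrow> act D g \<in> algebra_hom R D D"
    and act_one: "c \<in> carrier D \<Longrightarrow> act D \<one>\<^bsub>\<Gamma>\<^esub> c = c"
    and act_mult:
      "\<lbrakk>g \<in> carrier \<Gamma>; h \<in> carrier \<Gamma>; c \<in> carrier D\<rbrakk> \<Longrightarrow>
        act D (g \<otimes>\<^bsub>\<Gamma>\<^esub> h) c = act D g (act D h c)"
    and act_homog:
      "\<lbrakk>g \<in> carrier \<Gamma>; h \<in> carrier \<Gamma>; c \<in> homog D h\<rbrakk> \<Longrightarrow>
        act D g c \<in> homog D (g \<otimes>\<^bsub>\<Gamma>\<^esub> h \<otimes>\<^bsub>\<Gamma>\<^esub> inv\<^bsub>\<Gamma>\<^esub> g)"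


section \<open>Crossed products\<close>

locale crossed_product = graded_algebra R \<Gamma> A
  for R (structure) and \<Gamma> (structure) and A (structure) +
  assumes homog_unit: "g \<in> carrier \<Gamma> \<Longrightarrow> homog A g \<inter> Units A \<noteq> {}"

text \<open>
  The centralizer of the identity component, as a \<open>\<Gamma>\<close>-graded \<open>\<Gamma>\<close>-acted algebra. On the centralizer
  the action does not depend on the invertible homogeneous element that is chosen.
\<close>

definition centralizer ::
    "('g, 'y) monoid_scheme \<Rightarrow> ('o, 'g, 'a, 'z) graded_scheme \<Rightarrow> ('o, 'g, 'a) acted"
  where "centralizer \<Gamma> A =
    (let C = {a \<in> carrier A. \<forall>b\<in>homog A \<one>\<^bsub>\<Gamma>\<^esub>. a \<otimes>\<^bsub>A\<^esub> b = b \<otimes>\<^bsub>A\<^esub> a} in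
     \<lparr>carrier = C, mult = mult A, one = one A, zero = zero A, add = add A, smult = smult A,
      homog = (\<lambda>g. C \<inter> homog A g),
      act = (\<lambda>g a. let u = (SOME u. u \<in> homog A g \<inter> Units A) in u \<otimes>\<^bsub>A\<^esub> a \<otimes>\<^bsub>A\<^esub> inv\<^bsub>A\<^esub> u)\<rparr>)"

definition graded_acted_hom ::
    "('o, 'p) ring_scheme \<Rightarrow> ('g, 'q) monoid_scheme \<Rightarrow> ('o, 'g, 'c, 'y) acted_scheme \<Rightarrow>
      ('o, 'g, 'd, 'z) acted_scheme \<Rightarrow> ('c \<Rightarrow> 'd) set"
  where "graded_acted_hom R \<Gamma> D E =
    {h \<in> algebra_hom R D E.
      (\<forall>g\<in>carrier \<Gamma>. h ` homog D g \<subseteq> homog E g) \<and>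
      (\<forall>g\<in>carrier \<Gamma>. \<forall>c\<in>carrier D. h (act D g c) = act E g (h c))}"

locale crossed_product_over =
  crossed_product R \<Gamma> A + D: graded_acted_algebra R \<Gamma> D
  for R (structure) and \<Gamma> (structure)
    and D :: "('o, 'g, 'c, 'y) acted_scheme" (structure)
    and A :: "('o, 'g, 'c, 'a, 'z) crossed_scheme" (structure) +
  assumes str_hom: "str A \<in> graded_acted_hom R \<Gamma> D (centralizer \<Gamma> A)"


section \<open>Graded bimodules\<close>

text \<open>
  Bimodules over \<open>R\<close>-algebras are \<open>R\<close>-central: \<open>R\<close> acts in the same way through \<open>A\<close> and through \<open>B\<close>.
  Modules are finitely generated by convention; for a bimodule this is required on both sides.
\<close>

locale bimodule = module R M + A: assoc_algebra R A + B: assoc_algebra R B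
  for R (structure) and A (structure) and B (structure)
    and M :: "('o, 'g, 'a, 'b, 'm, 'z) bimod_scheme" (structure) +
  assumes lact_closed: "\<lbrakk>a \<in> carrier A; m \<in> carrier M\<rbrakk> \<Longrightarrow> lact M a m \<in> carrier M"
    and ract_closed: "\<lbrakk>m \<in> carrier M; b \<in> carrier B\<rbrakk> \<Longrightarrow> ract M m b \<in> carrier M"
    and lact_add_left:
      "\<lbrakk>a \<in> carrier A; a' \<in> carrier A; m \<in> carrier M\<rbrakk> \<Longrightarrow>
        lact M (a \<oplus>\<^bsub>A\<^esub> a') m = lact M a m \<oplus>\<^bsub>M\<^esub> lact M a' m"
    and lact_add_right:
      "\<lbrakk>a \<in> carrier A; m \<in> carrier M; m' \<in> carrier M\<rbrakk> \<Longrightarrow>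
        lact M a (m \<oplus>\<^bsub>M\<^esub> m') = lact M a m \<oplus>\<^bsub>M\<^esub> lact M a m'"
    and ract_add_left:
      "\<lbrakk>m \<in> carrier M; m' \<in> carrier M; b \<in> carrier B\<rbrakk> \<Longrightarrow>
        ract M (m \<oplus>\<^bsub>M\<^esub> m') b = ract M m b \<oplus>\<^bsub>M\<^esub> ract M m' b"
    and ract_add_right:
      "\<lbrakk>m \<in> carrier M; b \<in> carrier B; b' \<in> carrier B\<rbrakk> \<Longrightarrow>
        ract M m (b \<oplus>\<^bsub>B\<^esub> b') = ract M m b \<oplus>\<^bsub>M\<^esub> ract M m b'"
    and lact_mult:
      "\<lbrakk>a \<in> carrier A; a' \<in> carrier A; m \<in> carrier M\<rbrakk> \<Longrightarrow>
        lact M (a \<otimes>\<^bsub>A\<^esub> a') m = lact M a (lact M a' m)"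
    and ract_mult:
      "\<lbrakk>m \<in> carrier M; b \<in> carrier B; b' \<in> carrier B\<rbrakk> \<Longrightarrow>
        ract M m (b \<otimes>\<^bsub>B\<^esub> b') = ract M (ract M m b) b'"
    and lact_one: "m \<in> carrier M \<Longrightarrow> lact M \<one>\<^bsub>A\<^esub> m = m"
    and ract_one: "m \<in> carrier M \<Longrightarrow> ract M m \<one>\<^bsub>B\<^esub> = m"
    and lact_ract:
      "\<lbrakk>a \<in> carrier A; m \<in> carrier M; b \<in> carrier B\<rbrakk> \<Longrightarrow>
        ract M (lact M a m) b = lact M a (ract M m b)"
    and lact_smult:
      "\<lbrakk>r \<in> carrier R; a \<in> carrier A; m \<in> carrier M\<rbrakk> \<Longrightarrow>
        lact M (r \<odot>\<^bsub>A\<^esub> a) m = r \<odot>\<^bsub>M\<^esub> lact M a m"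
    and ract_smult:
      "\<lbrakk>r \<in> carrier R; m \<in> carrier M; b \<in> carrier B\<rbrakk> \<Longrightarrow>
        ract M m (r \<odot>\<^bsub>B\<^esub> b) = r \<odot>\<^bsub>M\<^esub> ract M m b"
    and left_fin_gen:
      "\<exists>S\<subseteq>carrier M. finite S \<and>
        (\<forall>m\<in>carrier M. \<exists>f\<in>S \<rightarrow> carrier A. m = finsum M (\<lambda>s. lact M (f s) s) S)"
    and right_fin_gen:
      "\<exists>S\<subseteq>carrier M. finite S \<and>
        (\<forall>m\<in>carrier M. \<exists>f\<in>S \<rightarrow> carrier B. m = finsum M (\<lambda>s. ract M s (f s)) S)"

locale graded_bimodule_over =
  graded_module R \<Gamma> M + bimodule R A B M +
  A: crossed_product_over R \<Gamma> D A + B: crossed_product_over R \<Gamma> D B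
  for R (structure) and \<Gamma> (structure)
    and D :: "('o, 'g, 'c, 'w) acted_scheme" (structure)
    and A :: "('o, 'g, 'c, 'a, 'x) crossed_scheme" (structure)
    and B :: "('o, 'g, 'c, 'b, 'y) crossed_scheme" (structure)
    and M :: "('o, 'g, 'a, 'b, 'm, 'z) bimod_scheme" (structure) +
  assumes homog_act:
      "\<lbrakk>g \<in> carrier \<Gamma>; x \<in> carrier \<Gamma>; h \<in> carrier \<Gamma>;
        a \<in> homog A g; m \<in> homog M x; b \<in> homog B h\<rbrakk> \<Longrightarrow>
        ract M (lact M a m) b \<in> homog M (g \<otimes>\<^bsub>\<Gamma>\<^esub> x \<otimes>\<^bsub>\<Gamma>\<^esub> h)"
    and over:
      "\<lbrakk>g \<in> carrier \<Gamma>; m \<in> homog M g; c \<in> carrier D\<rbrakk> \<Longrightarrow>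
        ract M m (str B c) = lact M (str A (act D g c)) m"

definition graded_bimodule_hom ::
    "('o, 'p) ring_scheme \<Rightarrow> ('g, 'q) monoid_scheme \<Rightarrow> ('o, 'a, 'r) module_scheme \<Rightarrow>
      ('o, 'b, 's) module_scheme \<Rightarrow> ('o, 'g, 'a, 'b, 'm, 'y) bimod_scheme \<Rightarrow>
      ('o, 'g, 'a, 'b, 'n, 'z) bimod_scheme \<Rightarrow> ('m \<Rightarrow> 'n) set"
  where "graded_bimodule_hom R \<Gamma> A B M N =
    {h \<in> carrier M \<rightarrow> carrier N.
      (\<forall>x\<in>carrier M. \<forall>y\<in>carrier M. h (x \<oplus>\<^bsub>M\<^esub> y) = h x \<oplus>\<^bsub>N\<^esub> h y) \<and>
      (\<forall>r\<in>carrier R. \<forall>x\<in>carrier M. h (r \<odot>\<^bsub>M\<^esub> x) = r \<odot>\<^bsub>N\<^esub> h x) \<and>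
      (\<forall>a\<in>carrier A. \<forall>x\<in>carrier M. h (lact M a x) = lact N a (h x)) \<and>
      (\<forall>b\<in>carrier B. \<forall>x\<in>carrier M. h (ract M x b) = ract N (h x) b) \<and>
      (\<forall>g\<in>carrier \<Gamma>. h ` homog M g \<subseteq> homog N g)}"

definition graded_bimodule_iso ::
    "('o, 'p) ring_scheme \<Rightarrow> ('g, 'q) monoid_scheme \<Rightarrow> ('o, 'a, 'r) module_scheme \<Rightarrow>
      ('o, 'b, 's) module_scheme \<Rightarrow> ('o, 'g, 'a, 'b, 'm, 'y) bimod_scheme \<Rightarrow>
      ('o, 'g, 'a, 'b, 'n, 'z) bimod_scheme \<Rightarrow> bool"
  where "graded_bimodule_iso R \<Gamma> A B M N \<longleftrightarrow>
    (\<exists>h\<in>graded_bimodule_hom R \<Gamma> A B M N.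
      bij_betw h (carrier M) (carrier N) \<and>
      inv_into (carrier M) h \<in> graded_bimodule_hom R \<Gamma> A B N M)"

definition regular_bimodule ::
    "('o, 'g, 'a, 'z) graded_scheme \<Rightarrow> ('o, 'g, 'a, 'a, 'a) bimod"
  where "regular_bimodule A =
    \<lparr>carrier = carrier A, mult = mult A, one = one A, zero = zero A, add = add A, smult = smult A,
     homog = homog A, lact = mult A, ract = mult A\<rparr>"

text \<open>The dual \<open>Hom\<^sub>A(M, A)\<close>; its elements are functions that are \<open>undefined\<close> outside \<open>carrier M\<close>.\<close>

definition dual_bimodule ::
    "('g, 'q) monoid_scheme \<Rightarrow> ('o, 'g, 'a, 'y) graded_scheme \<Rightarrow>
      ('o, 'g, 'a, 'b, 'm, 'z) bimod_scheme \<Rightarrow> ('o, 'g, 'b, 'a, 'm \<Rightarrow> 'a) bimod"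
  where "dual_bimodule \<Gamma> A M =
    (let H = {f \<in> carrier M \<rightarrow>\<^sub>E carrier A.
               (\<forall>x\<in>carrier M. \<forall>y\<in>carrier M. f (x \<oplus>\<^bsub>M\<^esub> y) = f x \<oplus>\<^bsub>A\<^esub> f y) \<and>
               (\<forall>a\<in>carrier A. \<forall>x\<in>carrier M. f (lact M a x) = a \<otimes>\<^bsub>A\<^esub> f x)} in
     \<lparr>carrier = H, mult = undefined, one = undefined,
      zero = (\<lambda>x\<in>carrier M. \<zero>\<^bsub>A\<^esub>),
      add = (\<lambda>f f'. \<lambda>x\<in>carrier M. f x \<oplus>\<^bsub>A\<^esub> f' x),
      smult = (\<lambda>r f. \<lambda>x\<in>carrier M. r \<odot>\<^bsub>A\<^esub> f x),
      homog = (\<lambda>g. {f \<in> H. \<forall>x\<in>carrier \<Gamma>. f ` homog M x \<subseteq> homog A (x \<otimes>\<^bsub>\<Gamma>\<^esub> g)}),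
      lact = (\<lambda>b f. \<lambda>x\<in>carrier M. f (ract M x b)),
      ract = (\<lambda>f a. \<lambda>x\<in>carrier M. f x \<otimes>\<^bsub>A\<^esub> a)\<rparr>)"


section \<open>Modules given by generators and relations\<close>

definition free_module :: "('o, 'p) ring_scheme \<Rightarrow> 'x set \<Rightarrow> ('o, 'x \<Rightarrow> 'o) module"
  where "free_module R X =
    \<lparr>carrier = {f \<in> UNIV \<rightarrow> carrier R. finite {x. f x \<noteq> \<zero>\<^bsub>R\<^esub>} \<and> {x. f x \<noteq> \<zero>\<^bsub>R\<^esub>} \<subseteq> X},
     mult = undefined, one = undefined,
     zero = (\<lambda>x. \<zero>\<^bsub>R\<^esub>), add = (\<lambda>f f' x. f x \<oplus>\<^bsub>R\<^esub> f' x), smult = (\<lambda>r f x. r \<otimes>\<^bsub>R\<^esub> f x)\<rparr>"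

definition free_gen :: "('o, 'p) ring_scheme \<Rightarrow> 'x \<Rightarrow> 'x \<Rightarrow> 'o"
  where "free_gen R x = (\<lambda>y. if y = x then \<one>\<^bsub>R\<^esub> else \<zero>\<^bsub>R\<^esub>)"

definition submodule_span ::
    "('o, 'p) ring_scheme \<Rightarrow> ('o, 'x, 'z) module_scheme \<Rightarrow> 'x set \<Rightarrow> 'x set"
  where "submodule_span R M S = \<Inter>{K. submodule K R M \<and> S \<subseteq> K}"

definition quotient_module ::
    "('o, 'x, 'z) module_scheme \<Rightarrow> 'x set \<Rightarrow> ('o, 'x set) module"
  where "quotient_module F K =
    \<lparr>carrier = a_rcosets\<^bsub>F\<^esub> K, mult = undefined, one = undefined,
     zero = K, add = set_add F, smult = (\<lambda>r U. \<Union>u\<in>U. K +>\<^bsub>F\<^esub> (r \<odot>\<^bsub>F\<^esub> u))\<rparr>"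

definition presented_module ::
    "('o, 'p) ring_scheme \<Rightarrow> 'x set \<Rightarrow> ('x \<Rightarrow> 'o) set \<Rightarrow> ('o, ('x \<Rightarrow> 'o) set) module"
  where "presented_module R X S =
    quotient_module (free_module R X) (submodule_span R (free_module R X) S)"

definition presented_gen ::
    "('o, 'p) ring_scheme \<Rightarrow> 'x set \<Rightarrow> ('x \<Rightarrow> 'o) set \<Rightarrow> 'x \<Rightarrow> ('x \<Rightarrow> 'o) set"
  where "presented_gen R X S x =
    submodule_span R (free_module R X) S +>\<^bsub>free_module R X\<^esub> free_gen R x"

text \<open>
  The \<open>R\<close>-linear map from a presented module to \<open>P\<close> with prescribed values \<open>\<phi>\<close> on the generators,
  evaluated at the class \<open>T\<close>. It does not depend on the representative of \<open>T\<close> if \<open>\<phi>\<close> respects the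
  relations. All maps on tensor products below are specified on pure tensors in this way.
\<close>

definition presented_lift ::
    "('o, 'p) ring_scheme \<Rightarrow> ('o, 'y, 'z) module_scheme \<Rightarrow> ('x \<Rightarrow> 'y) \<Rightarrow> ('x \<Rightarrow> 'o) set \<Rightarrow> 'y"
  where "presented_lift R P \<phi> T =
    (let f = (SOME f. f \<in> T) in finsum P (\<lambda>x. f x \<odot>\<^bsub>P\<^esub> \<phi> x) {x. f x \<noteq> \<zero>\<^bsub>R\<^esub>})"


section \<open>The tensor product of two bimodules over an algebra\<close>

definition balanced_relations ::
    "('o, 'p) ring_scheme \<Rightarrow> ('o, 'b, 'q) module_scheme \<Rightarrow> ('o, 'g, 'a, 'b, 'm, 'y) bimod_scheme \<Rightarrow>
      ('o, 'g, 'b, 'd, 'n, 'z) bimod_scheme \<Rightarrow> ('m \<times> 'n \<Rightarrow> 'o) set"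
  where "balanced_relations R B M N =
    (let F = free_module R (carrier M \<times> carrier N); \<delta> = free_gen R in
      {\<delta> (m \<oplus>\<^bsub>M\<^esub> m', n) \<ominus>\<^bsub>F\<^esub> (\<delta> (m, n) \<oplus>\<^bsub>F\<^esub> \<delta> (m', n)) | m m' n.
        m \<in> carrier M \<and> m' \<in> carrier M \<and> n \<in> carrier N} \<union>
      {\<delta> (m, n \<oplus>\<^bsub>N\<^esub> n') \<ominus>\<^bsub>F\<^esub> (\<delta> (m, n) \<oplus>\<^bsub>F\<^esub> \<delta> (m, n')) | m n n'.
        m \<in> carrier M \<and> n \<in> carrier N \<and> n' \<in> carrier N} \<union>
      {\<delta> (r \<odot>\<^bsub>M\<^esub> m, n) \<ominus>\<^bsub>F\<^esub> (r \<odot>\<^bsub>F\<^esub> \<delta> (m, n)) | r m n.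
        r \<in> carrier R \<and> m \<in> carrier M \<and> n \<in> carrier N} \<union>
      {\<delta> (m, r \<odot>\<^bsub>N\<^esub> n) \<ominus>\<^bsub>F\<^esub> (r \<odot>\<^bsub>F\<^esub> \<delta> (m, n)) | r m n.
        r \<in> carrier R \<and> m \<in> carrier M \<and> n \<in> carrier N} \<union>
      {\<delta> (ract M m b, n) \<ominus>\<^bsub>F\<^esub> \<delta> (m, lact N b n) | m b n.
        m \<in> carrier M \<and> b \<in> carrier B \<and> n \<in> carrier N})"

text \<open>\<open>M \<otimes>\<^sub>B N\<close>, graded by total degree.\<close>

definition bimodule_tensor ::
    "('o, 'p) ring_scheme \<Rightarrow> ('g, 'q) monoid_scheme \<Rightarrow> ('o, 'b, 'w) module_scheme \<Rightarrow>
      ('o, 'g, 'a, 'b, 'm, 'y) bimod_scheme \<Rightarrow> ('o, 'g, 'b, 'd, 'n, 'z) bimod_scheme \<Rightarrow>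
      ('o, 'g, 'a, 'd, ('m \<times> 'n \<Rightarrow> 'o) set) bimod"
  where "bimodule_tensor R \<Gamma> B M N =
    (let X = carrier M \<times> carrier N; S = balanced_relations R B M N;
         P = presented_module R X S; \<tau> = presented_gen R X S in
     \<lparr>carrier = carrier P, mult = undefined, one = undefined, zero = zero P, add = add P,
      smult = smult P,
      homog = (\<lambda>x. submodule_span R P
        {\<tau> (m, n) | g h m n. g \<in> carrier \<Gamma> \<and> h \<in> carrier \<Gamma> \<and> g \<otimes>\<^bsub>\<Gamma>\<^esub> h = x \<and>
          m \<in> homog M g \<and> n \<in> homog N h}),
      lact = (\<lambda>a. presented_lift R P (\<lambda>(m, n). \<tau> (lact M a m, n))),
      ract = (\<lambda>T d. presented_lift R P (\<lambda>(m, n). \<tau> (m, ract N n d)) T)\<rparr>)"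


section \<open>Graded Morita equivalences\<close>

definition induces_graded_Morita_equivalence ::
    "('o, 'p) ring_scheme \<Rightarrow> ('g, 'q) monoid_scheme \<Rightarrow> ('o, 'g, 'c, 'w) acted_scheme \<Rightarrow>
      ('o, 'g, 'c, 'a, 'x) crossed_scheme \<Rightarrow> ('o, 'g, 'c, 'b, 'y) crossed_scheme \<Rightarrow>
      ('o, 'g, 'a, 'b, 'm, 'z) bimod_scheme \<Rightarrow> bool"
  where "induces_graded_Morita_equivalence R \<Gamma> D A B M \<longleftrightarrow>
    graded_bimodule_over R \<Gamma> D A B M \<and>
    graded_bimodule_iso R \<Gamma> A A
      (bimodule_tensor R \<Gamma> B M (dual_bimodule \<Gamma> A M)) (regular_bimodule A) \<and>
    graded_bimodule_iso R \<Gamma> B B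
      (bimodule_tensor R \<Gamma> A (dual_bimodule \<Gamma> A M) M) (regular_bimodule B)"


section \<open>Tensor products of finite families over the base ring\<close>

definition multilinear_relations ::
    "('o, 'p) ring_scheme \<Rightarrow> 'i set \<Rightarrow> ('i \<Rightarrow> ('o, 'x, 'z) module_scheme) \<Rightarrow> (('i \<Rightarrow> 'x) \<Rightarrow> 'o) set"
  where "multilinear_relations R I M =
    (let X = (\<Pi>\<^sub>E i\<in>I. carrier (M i)); F = free_module R X; \<delta> = free_gen R in
      {\<delta> (x(i := a \<oplus>\<^bsub>M i\<^esub> b)) \<ominus>\<^bsub>F\<^esub> (\<delta> (x(i := a)) \<oplus>\<^bsub>F\<^esub> \<delta> (x(i := b))) | x i a b.
        x \<in> X \<and> i \<in> I \<and> a \<in> carrier (M i) \<and> b \<in> carrier (M i)} \<union>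
      {\<delta> (x(i := r \<odot>\<^bsub>M i\<^esub> a)) \<ominus>\<^bsub>F\<^esub> (r \<odot>\<^bsub>F\<^esub> \<delta> (x(i := a))) | x i r a.
        x \<in> X \<and> i \<in> I \<and> r \<in> carrier R \<and> a \<in> carrier (M i)})"

definition tensor_module ::
    "('o, 'p) ring_scheme \<Rightarrow> 'i set \<Rightarrow> ('i \<Rightarrow> ('o, 'x, 'z) module_scheme) \<Rightarrow>
      ('o, (('i \<Rightarrow> 'x) \<Rightarrow> 'o) set) module"
  where "tensor_module R I M =
    presented_module R (\<Pi>\<^sub>E i\<in>I. carrier (M i)) (multilinear_relations R I M)"

definition pure_tensor ::
    "('o, 'p) ring_scheme \<Rightarrow> 'i set \<Rightarrow> ('i \<Rightarrow> ('o, 'x, 'z) module_scheme) \<Rightarrow> ('i \<Rightarrow> 'x) \<Rightarrow>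
      (('i \<Rightarrow> 'x) \<Rightarrow> 'o) set"
  where "pure_tensor R I M x =
    presented_gen R (\<Pi>\<^sub>E i\<in>I. carrier (M i)) (multilinear_relations R I M) (restrict x I)"

text \<open>
  The tensor product of the components of degrees \<open>g i\<close>, as a submodule of the full tensor product;
  it embeds there because homogeneous components are direct summands.
\<close>

definition tensor_homog ::
    "('o, 'p) ring_scheme \<Rightarrow> 'i set \<Rightarrow> ('i \<Rightarrow> ('o, 'g, 'x, 'z) graded_scheme) \<Rightarrow> ('i \<Rightarrow> 'g) \<Rightarrow>
      (('i \<Rightarrow> 'x) \<Rightarrow> 'o) set set"
  where "tensor_homog R I M g =
    submodule_span R (tensor_module R I M)
      (pure_tensor R I M ` (\<Pi>\<^sub>E i\<in>I. homog (M i) (g i)))"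

definition tensor_mult ::
    "('o, 'p) ring_scheme \<Rightarrow> 'i set \<Rightarrow> ('i \<Rightarrow> ('o, 'x, 'z) module_scheme) \<Rightarrow>
      (('i \<Rightarrow> 'x) \<Rightarrow> 'o) set \<Rightarrow> (('i \<Rightarrow> 'x) \<Rightarrow> 'o) set \<Rightarrow> (('i \<Rightarrow> 'x) \<Rightarrow> 'o) set"
  where "tensor_mult R I A S T =
    presented_lift R (tensor_module R I A) (\<lambda>x.
      presented_lift R (tensor_module R I A) (\<lambda>y.
        pure_tensor R I A (\<lambda>i. x i \<otimes>\<^bsub>A i\<^esub> y i)) T) S"

definition tensor_acted ::
    "('o, 'p) ring_scheme \<Rightarrow> 'i set \<Rightarrow> ('i \<Rightarrow> ('o, 'g, 'c, 'z) acted_scheme) \<Rightarrow>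
      ('o, 'i \<Rightarrow> 'g, (('i \<Rightarrow> 'c) \<Rightarrow> 'o) set) acted"
  where "tensor_acted R I C =
    (let P = tensor_module R I C in
     \<lparr>carrier = carrier P, mult = tensor_mult R I C, one = pure_tensor R I C (\<lambda>i. \<one>\<^bsub>C i\<^esub>),
      zero = zero P, add = add P, smult = smult P, homog = tensor_homog R I C,
      act = (\<lambda>g. presented_lift R P (\<lambda>c. pure_tensor R I C (\<lambda>i. act (C i) (g i) (c i))))\<rparr>)"

definition tensor_crossed ::
    "('o, 'p) ring_scheme \<Rightarrow> 'i set \<Rightarrow> ('i \<Rightarrow> ('o, 'g, 'c, 'a, 'z) crossed_scheme) \<Rightarrow>
      ('o, 'i \<Rightarrow> 'g, (('i \<Rightarrow> 'c) \<Rightarrow> 'o) set, (('i \<Rightarrow> 'a) \<Rightarrow> 'o) set) crossed"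
  where "tensor_crossed R I A =
    (let P = tensor_module R I A in
     \<lparr>carrier = carrier P, mult = tensor_mult R I A, one = pure_tensor R I A (\<lambda>i. \<one>\<^bsub>A i\<^esub>),
      zero = zero P, add = add P, smult = smult P, homog = tensor_homog R I A,
      str = presented_lift R P (\<lambda>c. pure_tensor R I A (\<lambda>i. str (A i) (c i)))\<rparr>)"

definition tensor_bimod ::
    "('o, 'p) ring_scheme \<Rightarrow> 'i set \<Rightarrow> ('i \<Rightarrow> ('o, 'g, 'a, 'b, 'm, 'z) bimod_scheme) \<Rightarrow>
      ('o, 'i \<Rightarrow> 'g, (('i \<Rightarrow> 'a) \<Rightarrow> 'o) set, (('i \<Rightarrow> 'b) \<Rightarrow> 'o) set, (('i \<Rightarrow> 'm) \<Rightarrow> 'o) set) bimod"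
  where "tensor_bimod R I M =
    (let P = tensor_module R I M in
     \<lparr>carrier = carrier P, mult = undefined, one = undefined,
      zero = zero P, add = add P, smult = smult P, homog = tensor_homog R I M,
      lact = (\<lambda>S T. presented_lift R P (\<lambda>a. presented_lift R P (\<lambda>m.
        pure_tensor R I M (\<lambda>i. lact (M i) (a i) (m i))) T) S),
      ract = (\<lambda>T S. presented_lift R P (\<lambda>m. presented_lift R P (\<lambda>b.
        pure_tensor R I M (\<lambda>i. ract (M i) (m i) (b i))) S) T)\<rparr>)"

end

(*
  A graded bimodule M induces a graded Morita equivalence if and only if there are finitely many
  homogeneous m_j, n_k in M, left A-linear functionals f_j, q_k : M -> A and right B-linear functionals
  p_j : M -> B, of matching degrees, with
    f_j(x) y = x p_j(y),   sum_j p_j(m_j) = 1_B,   sum_k q_k(n_k) = 1_A.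
  If the data exist, evaluation M (x)_B M^* -> A is invertible with inverse a |-> sum_k a n_k (x) q_k, and
  f (x) y |-> sum_j p_j(f(m_j) y) is invertible with inverse b |-> sum_j b f_j (x) m_j. Conversely, two
  isomorphisms M (x)_B M^* = A and M^* (x)_A M = B, which need not be compatible, yield such data after
  correction by a bimodule automorphism of M. Tensor products of data for the factors are data for the
  tensor product, so no description of the dual of the tensor product is needed.
*)

theory Submission
  imports Defs
begin

text \<open>The identity f_j(x) y = x p_j(y) stands in for the ring isomorphism B = End_A(M)^op. It
  says that the endomorphism x |-> f_j(x) y of M is right multiplication by an element of B.
  Together with sum_j p_j(m_j) = 1 it turns the f_j and m_j into a dual basis of M and makes the
  right action of B faithful, so identities in B may be verified by acting on M. A dual basis alone
  would leave the endomorphism ring of a tensor product to be identified with a tensor product of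
  endomorphism rings. The data instead consist of R-multilinear identities, which can be checked on
  pure tensors, and a tensor of sums over the J_i becomes one sum over families of indices.
  Centrality of R makes A-linear and B-linear maps R-linear, hence gives them tensor products over
  R. Since f_j and p_j have degree d_j and m_j has degree inverse to d_j, the two unit sums live in
  degree one and the inverse isomorphisms preserve degrees.\<close>

section \<open>R-linear maps, and transport between records with the same module fields\<close>

text \<open>Membership constrains values on \<open>carrier M\<close> only, so record fields such as
  \<open>str A\<close>, chosen lifts and lambda terms qualify without being restricted to the
  carrier.\<close>

definition linmap ::
    "('o, 'p) ring_scheme \<Rightarrow> ('o, 'x, 'y) module_scheme \<Rightarrow> ('o, 'w, 'z) module_scheme \<Rightarrow> ('x \<Rightarrow> 'w) set"
  where "linmap R M N =
    {h \<in> carrier M \<rightarrow> carrier N.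
      (\<forall>x\<in>carrier M. \<forall>y\<in>carrier M. h (x \<oplus>\<^bsub>M\<^esub> y) = h x \<oplus>\<^bsub>N\<^esub> h y) \<and>
      (\<forall>r\<in>carrier R. \<forall>x\<in>carrier M. h (r \<odot>\<^bsub>M\<^esub> x) = r \<odot>\<^bsub>N\<^esub> h x)}"

lemma linmapI:
  assumes "\<And>x. x \<in> carrier M \<Longrightarrow> h x \<in> carrier N"
    and "\<And>x y. \<lbrakk>x \<in> carrier M; y \<in> carrier M\<rbrakk> \<Longrightarrow> h (x \<oplus>\<^bsub>M\<^esub> y) = h x \<oplus>\<^bsub>N\<^esub> h y"
    and "\<And>r x. \<lbrakk>r \<in> carrier R; x \<in> carrier M\<rbrakk> \<Longrightarrow> h (r \<odot>\<^bsub>M\<^esub> x) = r \<odot>\<^bsub>N\<^esub> h x"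
  shows "h \<in> linmap R M N"
  using assms by (auto simp: linmap_def)

lemma linmap_closed: "\<lbrakk>h \<in> linmap R M N; x \<in> carrier M\<rbrakk> \<Longrightarrow> h x \<in> carrier N"
  and linmap_add: "\<lbrakk>h \<in> linmap R M N; x \<in> carrier M; y \<in> carrier M\<rbrakk> \<Longrightarrow>
    h (x \<oplus>\<^bsub>M\<^esub> y) = h x \<oplus>\<^bsub>N\<^esub> h y"
  and linmap_smult: "\<lbrakk>h \<in> linmap R M N; r \<in> carrier R; x \<in> carrier M\<rbrakk> \<Longrightarrow>
    h (r \<odot>\<^bsub>M\<^esub> x) = r \<odot>\<^bsub>N\<^esub> h x"
  by (auto simp: linmap_def)

lemma linmap_cong:
  assumes "module R M" "h \<in> linmap R M N" "\<And>x. x \<in> carrier M \<Longrightarrow> k x = h x"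
  shows "k \<in> linmap R M N"
proof -
  interpret module R M by fact
  show ?thesis
    by (rule linmapI)
      (simp_all add: assms(3) linmap_closed[OF assms(2)] linmap_add[OF assms(2)] linmap_smult[OF assms(2)])
qed

lemma linmap_compose:
  assumes "h \<in> linmap R M N" "k \<in> linmap R N P"
  shows "(\<lambda>x. k (h x)) \<in> linmap R M P"
  using assms by (auto simp: linmap_def Pi_iff)

lemma linmap_zero:
  assumes "module R M" "module R N" "h \<in> linmap R M N"
  shows "h \<zero>\<^bsub>M\<^esub> = \<zero>\<^bsub>N\<^esub>"
proof -
  interpret M: module R M by fact
  interpret N: module R N by fact
  have "h (\<zero>\<^bsub>R\<^esub> \<odot>\<^bsub>M\<^esub> \<zero>\<^bsub>M\<^esub>) = \<zero>\<^bsub>R\<^esub> \<odot>\<^bsub>N\<^esub> h \<zero>\<^bsub>M\<^esub>"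
    by (rule linmap_smult[OF assms(3)]) simp_all
  then show ?thesis using linmap_closed[OF assms(3)] by simp
qed

lemma linmap_finsum:
  assumes "module R M" "module R N" "h \<in> linmap R M N" "finite K" "f \<in> K \<rightarrow> carrier M"
  shows "h (finsum M f K) = finsum N (\<lambda>k. h (f k)) K"
proof -
  interpret M: module R M by fact
  interpret N: module R N by fact
  show ?thesis using assms(4,5)
  proof (induction K rule: finite_induct)
    case empty
    then show ?case using linmap_zero[OF assms(1-3)] by simp
  next
    case (insert x F)
    have f: "f \<in> F \<rightarrow> carrier M" "f x \<in> carrier M" using insert.prems by auto
    have hf: "(\<lambda>k. h (f k)) \<in> F \<rightarrow> carrier N" "h (f x) \<in> carrier N"
      using f linmap_closed[OF assms(3)] by auto
    show ?case
      using insert.hyps insert.IH f hf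
      by (simp add: M.finsum_insert N.finsum_insert linmap_add[OF assms(3)])
  qed
qed

text \<open>Records such as \<open>tensor_crossed\<close>, \<open>tensor_bimod\<close> and
  \<open>bimodule_tensor\<close> copy the module fields of a presented module and change the others,
  often with a different record type. Module theory is done once for the presented module; this
  lemma and the next three carry it over.\<close>

lemma finsum_fields_cong:
  assumes "carrier M = carrier N" "add M = add N" "zero M = zero N"
  shows "finsum M f K = finsum N f K"
  using assms by (simp add: finsum_def finprod_def)

lemma module_fields_cong:
  assumes "module R M"
    and "carrier N = carrier M" "add N = add M" "zero N = zero M" "smult N = smult M"
  shows "module R N"
proof -
  interpret module R M by fact
  show ?thesis
  proof (rule moduleI)
    show "abelian_group N"
    proof (rule abelian_groupI)
      fix x assume "x \<in> carrier N"
      then have "\<ominus>\<^bsub>M\<^esub> x \<in> carrier N \<and> \<ominus>\<^bsub>M\<^esub> x \<oplus>\<^bsub>N\<^esub> x = \<zero>\<^bsub>N\<^esub>" by (simp add: assms M.l_neg)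
      then show "\<exists>y\<in>carrier N. y \<oplus>\<^bsub>N\<^esub> x = \<zero>\<^bsub>N\<^esub>" by blast
    qed (simp_all add: assms M.a_ac)
  qed (simp_all add: assms R.is_cring smult_l_distr smult_r_distr smult_assoc1)
qed

lemma submodule_fields_cong:
  assumes "carrier N = carrier M" "add N = add M" "zero N = zero M" "smult N = smult M"
  shows "submodule K R N \<longleftrightarrow> submodule K R M"
proof -
  \<comment> \<open>Submodules are subgroups of the additive monoid, and that notion mentions
    inverses. They are determined by carrier, addition and zero.\<close>
  have "m_inv (add_monoid N) = m_inv (add_monoid M)" using assms by (simp add: m_inv_def fun_eq_iff)
  then show ?thesis using assms by (simp add: submodule_def submodule_axioms_def subgroup_def)
qed

lemma submodule_span_fields_cong:
  assumes "carrier N = carrier M" "add N = add M" "zero N = zero M" "smult N = smult M"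
  shows "submodule_span R N S = submodule_span R M S"
  by (simp add: submodule_span_def submodule_fields_cong[OF assms])

section \<open>Submodules and spans\<close>

context module begin

text \<open>Closure under negatives comes for free, because -a = (-1) a.\<close>

lemma submoduleI_linear:
  assumes "H \<subseteq> carrier M" "\<zero>\<^bsub>M\<^esub> \<in> H"
    and "\<And>a b. \<lbrakk>a \<in> H; b \<in> H\<rbrakk> \<Longrightarrow> a \<oplus>\<^bsub>M\<^esub> b \<in> H"
    and "\<And>r x. \<lbrakk>r \<in> carrier R; x \<in> H\<rbrakk> \<Longrightarrow> r \<odot>\<^bsub>M\<^esub> x \<in> H"
  shows "submodule H R M"
proof (rule submoduleI)
  fix a assume a: "a \<in> H"
  have "(\<ominus> \<one>) \<odot>\<^bsub>M\<^esub> a = \<ominus>\<^bsub>M\<^esub> a" using a assms(1) by (simp add: smult_l_minus subset_iff)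
  then show "\<ominus>\<^bsub>M\<^esub> a \<in> H" using assms(4)[OF _ a, of "\<ominus> \<one>"] by simp
qed (use assms in auto)

lemma submodule_zero: "submodule H R M \<Longrightarrow> \<zero>\<^bsub>M\<^esub> \<in> H"
  using subgroup.one_closed[OF submodule.axioms(1)] by fastforce

lemma submodule_finsum:
  assumes "submodule H R M" "finite K" "\<And>k. k \<in> K \<Longrightarrow> f k \<in> H"
  shows "finsum M f K \<in> H"
  using assms(2,3)
proof (induction K rule: finite_induct)
  case empty then show ?case using submodule_zero[OF assms(1)] by simp
next
  case (insert x F)
  then have "f \<in> F \<rightarrow> carrier M" "f x \<in> carrier M" using submoduleE(1)[OF assms(1)] by auto
  then show ?case using insert submoduleE(5)[OF assms(1)] by simp
qed

lemma submodule_span_submodule: "S \<subseteq> carrier M \<Longrightarrow> submodule (submodule_span R M S) R M"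
proof (rule submoduleI_linear)
  assume S: "S \<subseteq> carrier M"
  show "submodule_span R M S \<subseteq> carrier M"
    using carrier_is_submodule S by (auto simp: submodule_span_def)
qed (auto simp: submodule_span_def intro: submodule_zero submoduleE(5) submodule.smult_closed)

lemma submodule_span_incl: "x \<in> S \<Longrightarrow> x \<in> submodule_span R M S"
  by (auto simp: submodule_span_def)

lemma submodule_span_least: "\<lbrakk>submodule K R M; S \<subseteq> K\<rbrakk> \<Longrightarrow> submodule_span R M S \<subseteq> K"
  by (auto simp: submodule_span_def)

text \<open>The elements of \<open>carrier M\<close> that satisfy \<open>Q\<close> form a submodule.
  Hence the step cases assume membership in the carrier only, which is what the linearity rules used
  in them ask for.\<close>

lemma submodule_span_induct [consumes 2, case_names gen zero add smult]:
  assumes "x \<in> submodule_span R M S" "S \<subseteq> carrier M"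
    and "\<And>x. x \<in> S \<Longrightarrow> Q x"
    and "Q \<zero>\<^bsub>M\<^esub>"
    and "\<And>x y. \<lbrakk>x \<in> carrier M; y \<in> carrier M; Q x; Q y\<rbrakk> \<Longrightarrow> Q (x \<oplus>\<^bsub>M\<^esub> y)"
    and "\<And>r x. \<lbrakk>r \<in> carrier R; x \<in> carrier M; Q x\<rbrakk> \<Longrightarrow> Q (r \<odot>\<^bsub>M\<^esub> x)"
  shows "Q x"
proof -
  have "submodule {x \<in> carrier M. Q x} R M"
    by (rule submoduleI_linear) (use assms in auto)
  then have "submodule_span R M S \<subseteq> {x \<in> carrier M. Q x}"
    by (rule submodule_span_least) (use assms in auto)
  then show ?thesis using assms(1) by auto
qed

text \<open>Since \<open>S\<close> is closed under scalars, coefficients are absorbed into the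
  generators and plain sums suffice. It serves to write the preimage of 1 under a graded isomorphism
  as a sum of homogeneous pure tensors. Indexing by an initial segment of the naturals permits
  repeated summands.\<close>

lemma submodule_span_finsum:
  assumes "x \<in> submodule_span R M S" "S \<subseteq> carrier M" "\<And>r s. r \<in> carrier R \<Longrightarrow> s \<in> S \<Longrightarrow> r \<odot>\<^bsub>M\<^esub> s \<in> S"
  obtains k and s :: "nat \<Rightarrow> _" where "\<And>i. i < k \<Longrightarrow> s i \<in> S" "x = finsum M s {..<k}"
proof -
  have "\<exists>k s. (\<forall>i<k. s i \<in> S) \<and> x = finsum M s {..<k::nat}"
    using assms(1,2)
  proof (induction rule: submodule_span_induct)
    case (gen x)
    then show ?case
      using assms(2) by (intro exI[of _ "Suc 0"] exI[of _ "\<lambda>_. x"]) (auto simp: lessThan_Suc)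
  next
    case zero
    show ?case by (rule exI[of _ 0]) simp
  next
    case (add x y)
    then obtain k s l t where s: "\<forall>i<k. s i \<in> S" "x = finsum M s {..<k::nat}"
      and t: "\<forall>i<l. t i \<in> S" "y = finsum M t {..<l::nat}" by blast
    \<comment> \<open>The two families are concatenated; the second one is shifted by
      \<open>k\<close>.\<close>
    define u where "u i = (if i < k then s i else t (i - k))" for i
    have u: "\<forall>i<k+l. u i \<in> S" using s t by (auto simp: u_def)
    have "finsum M u {..<k+l} = finsum M u {..<k} \<oplus>\<^bsub>M\<^esub> finsum M u {k..<k+l}"
      using u assms(2)
      by (subst M.finsum_Un_disjoint[symmetric]) (auto simp: Pi_def ivl_disj_un)
    also have "finsum M u {..<k} = finsum M s {..<k}"
      by (rule M.finsum_cong') (use s assms(2) in \<open>auto simp: u_def\<close>)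
    also have "finsum M u {k..<k+l} = finsum M u ((\<lambda>i. i + k) ` {..<l})"
      by (simp add: lessThan_atLeast0 add.commute)
    also have "\<dots> = finsum M (\<lambda>i. u (i + k)) {..<l}"
      by (rule M.finsum_reindex) (use u assms(2) in \<open>auto simp: add.commute\<close>)
    also have "\<dots> = finsum M t {..<l}"
      by (rule M.finsum_cong') (use t assms(2) in \<open>auto simp: u_def\<close>)
    finally have "x \<oplus>\<^bsub>M\<^esub> y = finsum M u {..<k+l}" using s t by simp
    then show ?case using u by (intro exI[of _ "k + l"] exI[of _ u]) simp
  next
    case (smult r x)
    then obtain k s where s: "\<forall>i<k. s i \<in> S" "x = finsum M s {..<k::nat}" by blast
    then have "r \<odot>\<^bsub>M\<^esub> x = finsum M (\<lambda>i. r \<odot>\<^bsub>M\<^esub> s i) {..<k}"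
      using smult.hyps assms(2) by (simp add: finsum_smult_ldistr Pi_def subset_iff)
    then show ?case using s assms(3) smult.hyps by (intro exI[of _ k] exI[of _ "\<lambda>i. r \<odot>\<^bsub>M\<^esub> s i"]) auto
  qed
  then show ?thesis using that by blast
qed

end

lemma linmap_preimage_submodule:
  assumes "module R M" "module R N" "h \<in> linmap R M N" "submodule K R N"
  shows "submodule {x \<in> carrier M. h x \<in> K} R M"
proof -
  interpret M: module R M by fact
  interpret N: module R N by fact
  show ?thesis
    by (rule M.submoduleI_linear)
      (auto simp: linmap_zero[OF assms(1-3)] linmap_add[OF assms(3)] linmap_smult[OF assms(3)]
        N.submodule_zero[OF assms(4)] N.submoduleE(4,5)[OF assms(4)])
qed

text \<open>In the graded arguments \<open>K\<close> is a homogeneous component: preimages of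
  submodules are submodules, so the generators decide where the whole span goes.\<close>

lemma linmap_span:
  assumes "module R M" "module R N" "h \<in> linmap R M N" "submodule K R N"
    and "S \<subseteq> carrier M" "\<And>s. s \<in> S \<Longrightarrow> h s \<in> K" "x \<in> submodule_span R M S"
  shows "h x \<in> K"
proof -
  have "submodule_span R M S \<subseteq> {x \<in> carrier M. h x \<in> K}"
    using assms by (intro module.submodule_span_least linmap_preimage_submodule[where N = N]) auto
  then show ?thesis using assms(7) by auto
qed

lemma linmap_span_eq:
  assumes "module R M" "module R N" "h \<in> linmap R M N" "k \<in> linmap R M N"
    and "S \<subseteq> carrier M" "\<And>s. s \<in> S \<Longrightarrow> h s = k s" "x \<in> submodule_span R M S"
  shows "h x = k x"
proof -
  interpret M: module R M by fact
  show ?thesis using assms(7,5)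
    by (induction rule: M.submodule_span_induct)
      (simp_all add: assms(6) linmap_zero[OF assms(1,2,3)] linmap_zero[OF assms(1,2,4)]
        linmap_add[OF assms(3)] linmap_add[OF assms(4)] linmap_smult[OF assms(3)] linmap_smult[OF assms(4)])
qed

section \<open>Presented modules\<close>

context module begin

lemma submodule_abelian_subgroup: "submodule K R M \<Longrightarrow> abelian_subgroup K M"
  by (intro abelian_subgroupI3 additive_subgroup.intro submodule.axioms(1) M.abelian_group_axioms)

lemma quotient_carrier: "carrier (quotient_module M K) = (\<lambda>f. K +>\<^bsub>M\<^esub> f) ` carrier M"
  by (auto simp: quotient_module_def A_RCOSETS_def')

lemma quotient_add:
  assumes "submodule K R M" "f \<in> carrier M" "g \<in> carrier M"
  shows "(K +>\<^bsub>M\<^esub> f) \<oplus>\<^bsub>quotient_module M K\<^esub> (K +>\<^bsub>M\<^esub> g) = K +>\<^bsub>M\<^esub> (f \<oplus>\<^bsub>M\<^esub> g)"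
  using abelian_subgroup.a_rcos_sum[OF submodule_abelian_subgroup[OF assms(1)] assms(2,3)]
  by (simp add: quotient_module_def)

lemma coset_mem_iff:
  assumes "submodule K R M" "f \<in> carrier M" "u \<in> carrier M"
  shows "u \<in> K +>\<^bsub>M\<^esub> f \<longleftrightarrow> u \<ominus>\<^bsub>M\<^esub> f \<in> K"
  using abelian_subgroup.a_rcos_module[OF submodule_abelian_subgroup[OF assms(1)] assms(2,3)] by (simp add: a_minus_def)

lemma quotient_eq_iff:
  assumes "submodule K R M" "f \<in> carrier M" "g \<in> carrier M"
  shows "K +>\<^bsub>M\<^esub> f = K +>\<^bsub>M\<^esub> g \<longleftrightarrow> f \<ominus>\<^bsub>M\<^esub> g \<in> K"
proof -
  interpret K: abelian_subgroup K M using submodule_abelian_subgroup[OF assms(1)] .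
  show ?thesis
    using coset_mem_iff[OF assms(1,3,2)] K.a_repr_independence'[OF _ assms(3), of f]
      K.a_rcos_self[OF assms(2)] by metis
qed

text \<open>In \<open>quotient_module\<close> a scalar multiple is a union of cosets over all
  representatives. These cosets coincide because \<open>K\<close> is closed under scalars, and the
  union is not empty because \<open>f\<close> lies in its own coset.\<close>

lemma quotient_smult:
  assumes "submodule K R M" "r \<in> carrier R" "f \<in> carrier M"
  shows "r \<odot>\<^bsub>quotient_module M K\<^esub> (K +>\<^bsub>M\<^esub> f) = K +>\<^bsub>M\<^esub> (r \<odot>\<^bsub>M\<^esub> f)"
proof -
  interpret K: abelian_subgroup K M using submodule_abelian_subgroup[OF assms(1)] .
  have "K +>\<^bsub>M\<^esub> (r \<odot>\<^bsub>M\<^esub> u) = K +>\<^bsub>M\<^esub> (r \<odot>\<^bsub>M\<^esub> f)" if "u \<in> K +>\<^bsub>M\<^esub> f" for u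
  proof -
    have u: "u \<in> carrier M" using K.a_elemrcos_carrier[OF assms(3) that] .
    have "u \<ominus>\<^bsub>M\<^esub> f \<in> K"
      using coset_mem_iff[OF assms(1,3) u] that by simp
    then have "r \<odot>\<^bsub>M\<^esub> (u \<ominus>\<^bsub>M\<^esub> f) \<in> K" using submoduleE(4)[OF assms(1)] assms(2) by blast
    then show ?thesis using u assms quotient_eq_iff[OF assms(1)]
      by (simp add: smult_r_distr smult_r_minus a_minus_def)
  qed
  moreover have "f \<in> K +>\<^bsub>M\<^esub> f" by (rule K.a_rcos_self[OF assms(3)])
  ultimately have "(\<Union>u\<in>K +>\<^bsub>M\<^esub> f. K +>\<^bsub>M\<^esub> (r \<odot>\<^bsub>M\<^esub> u)) = K +>\<^bsub>M\<^esub> (r \<odot>\<^bsub>M\<^esub> f)" by blast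
  then show ?thesis by (simp add: quotient_module_def)
qed

lemma quotient_zero:
  assumes "submodule K R M" shows "\<zero>\<^bsub>quotient_module M K\<^esub> = K +>\<^bsub>M\<^esub> \<zero>\<^bsub>M\<^esub>"
  using submoduleE(1)[OF assms] by (simp add: quotient_module_def)

lemma module_quotient:
  assumes "submodule K R M" shows "module R (quotient_module M K)"
proof (rule moduleI)
  show "abelian_group (quotient_module M K)"
  proof (rule abelian_groupI)
    fix T assume "T \<in> carrier (quotient_module M K)"
    then obtain f where f: "f \<in> carrier M" "T = K +>\<^bsub>M\<^esub> f" by (auto simp: quotient_carrier)
    then have "(K +>\<^bsub>M\<^esub> (\<ominus>\<^bsub>M\<^esub> f)) \<oplus>\<^bsub>quotient_module M K\<^esub> T = \<zero>\<^bsub>quotient_module M K\<^esub>"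
      by (simp add: quotient_add[OF assms] quotient_zero[OF assms] M.l_neg)
    then show "\<exists>U\<in>carrier (quotient_module M K). U \<oplus>\<^bsub>quotient_module M K\<^esub> T = \<zero>\<^bsub>quotient_module M K\<^esub>"
      using f by (auto simp: quotient_carrier)
  qed (auto simp: quotient_carrier quotient_zero[OF assms] quotient_add[OF assms] M.a_ac)
qed (auto simp: quotient_carrier quotient_smult[OF assms] quotient_add[OF assms] R.is_cring
    smult_l_distr smult_r_distr smult_assoc1)

end

text \<open>The R-linear extension of \<phi> from the free generators, before relations are divided
  out. \<open>presented_lift\<close> evaluates it at a chosen representative. Summation over the
  support makes sense because elements of the free module have finite support.\<close>

definition free_ext ::
    "('o, 'p) ring_scheme \<Rightarrow> ('o, 'y, 'z) module_scheme \<Rightarrow> ('x \<Rightarrow> 'y) \<Rightarrow> ('x \<Rightarrow> 'o) \<Rightarrow> 'y"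
  where "free_ext R Q \<phi> f = finsum Q (\<lambda>x. f x \<odot>\<^bsub>Q\<^esub> \<phi> x) {x. f x \<noteq> \<zero>\<^bsub>R\<^esub>}"

lemma presented_lift_free_ext: "presented_lift R Q \<phi> T = free_ext R Q \<phi> (SOME f. f \<in> T)"
  by (simp add: presented_lift_def free_ext_def Let_def)

context cring begin

lemma free_carrierD:
  assumes "f \<in> carrier (free_module R X)"
  shows "f x \<in> carrier R" "finite {x. f x \<noteq> \<zero>}" "f x \<noteq> \<zero> \<Longrightarrow> x \<in> X"
  using assms by (auto simp: free_module_def)

lemma free_carrierI:
  assumes "\<And>x. f x \<in> carrier R" "finite {x. f x \<noteq> \<zero>}" "\<And>x. f x \<noteq> \<zero> \<Longrightarrow> x \<in> X"
  shows "f \<in> carrier (free_module R X)"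
  using assms by (auto simp: free_module_def)

lemma free_fields:
  "f \<oplus>\<^bsub>free_module R X\<^esub> g = (\<lambda>x. f x \<oplus> g x)" "r \<odot>\<^bsub>free_module R X\<^esub> f = (\<lambda>x. r \<otimes> f x)"
  "\<zero>\<^bsub>free_module R X\<^esub> = (\<lambda>x. \<zero>)"
  by (simp_all add: free_module_def)

lemma free_add_closed:
  assumes "f \<in> carrier (free_module R X)" "g \<in> carrier (free_module R X)"
  shows "(\<lambda>x. f x \<oplus> g x) \<in> carrier (free_module R X)"
proof (rule free_carrierI)
  have "{x. f x \<oplus> g x \<noteq> \<zero>} \<subseteq> {x. f x \<noteq> \<zero>} \<union> {x. g x \<noteq> \<zero>}" by auto
  then show "finite {x. f x \<oplus> g x \<noteq> \<zero>}"
    using free_carrierD(2)[OF assms(1)] free_carrierD(2)[OF assms(2)] by (metis finite_Un finite_subset)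
  fix x assume "f x \<oplus> g x \<noteq> \<zero>"
  then have "f x \<noteq> \<zero> \<or> g x \<noteq> \<zero>" by auto
  then show "x \<in> X" using free_carrierD(3)[OF assms(1)] free_carrierD(3)[OF assms(2)] by blast
qed (simp add: free_carrierD(1)[OF assms(1)] free_carrierD(1)[OF assms(2)])

lemma free_smult_closed:
  assumes "f \<in> carrier (free_module R X)" "r \<in> carrier R"
  shows "(\<lambda>x. r \<otimes> f x) \<in> carrier (free_module R X)"
proof (rule free_carrierI)
  have "{x. r \<otimes> f x \<noteq> \<zero>} \<subseteq> {x. f x \<noteq> \<zero>}" using assms by auto
  then show "finite {x. r \<otimes> f x \<noteq> \<zero>}"
    using free_carrierD(2)[OF assms(1)] by (metis finite_subset)
  fix x assume "r \<otimes> f x \<noteq> \<zero>"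
  then have "f x \<noteq> \<zero>" using assms(2) by auto
  then show "x \<in> X" using free_carrierD(3)[OF assms(1)] by blast
qed (simp add: assms(2) free_carrierD(1)[OF assms(1)])

lemma module_free: "module R (free_module R X)"
proof (rule moduleI)
  show "abelian_group (free_module R X)"
  proof (rule abelian_groupI)
    fix f assume f: "f \<in> carrier (free_module R X)"
    show "\<exists>g\<in>carrier (free_module R X). g \<oplus>\<^bsub>free_module R X\<^esub> f = \<zero>\<^bsub>free_module R X\<^esub>"
    proof (rule bexI)
      show "(\<lambda>x. (\<ominus> \<one>) \<otimes> f x) \<in> carrier (free_module R X)" by (rule free_smult_closed[OF f]) simp
      show "(\<lambda>x. (\<ominus> \<one>) \<otimes> f x) \<oplus>\<^bsub>free_module R X\<^esub> f = \<zero>\<^bsub>free_module R X\<^esub>"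
        using free_carrierD(1)[OF f] by (simp add: free_fields l_minus l_neg)
    qed
  qed (auto simp: free_fields free_add_closed free_carrierD(1) a_ac intro: free_carrierI)
qed (auto simp: free_fields is_cring free_smult_closed free_carrierD(1) l_distr r_distr m_assoc)

lemma free_gen_closed: "x \<in> X \<Longrightarrow> free_gen R x \<in> carrier (free_module R X)"
  by (rule free_carrierI) (auto simp: free_gen_def split: if_splits intro: finite_subset[of _ "{x}"])

text \<open>Two elements and their sum have different supports. Additivity needs one finite index
  set for all three sums; enlarging a support adds only zero terms.\<close>

lemma free_ext_superset:
  assumes "module R Q" "f \<in> carrier (free_module R X)" "\<phi> \<in> X \<rightarrow> carrier Q"
    and "finite Y" "Y \<subseteq> X" "{x. f x \<noteq> \<zero>} \<subseteq> Y"
  shows "free_ext R Q \<phi> f = finsum Q (\<lambda>x. f x \<odot>\<^bsub>Q\<^esub> \<phi> x) Y"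
proof -
  interpret Q: module R Q by fact
  show ?thesis unfolding free_ext_def
    using assms(3,5,6) free_carrierD(1)[OF assms(2)]
    by (intro Q.M.add.finprod_mono_neutral_cong_left)
      (auto simp: assms(4) Pi_iff subset_iff intro!: Q.smult_l_null)
qed

lemma free_ext_linmap:
  assumes "module R Q" "\<phi> \<in> X \<rightarrow> carrier Q"
  shows "free_ext R Q \<phi> \<in> linmap R (free_module R X) Q"
proof -
  interpret Q: module R Q by fact
  note sup = free_ext_superset[OF assms(1) _ assms(2)]
  have term_closed: "f x \<odot>\<^bsub>Q\<^esub> \<phi> x \<in> carrier Q" if "f \<in> carrier (free_module R X)" "x \<in> X" for f x
    using that(2) assms(2) free_carrierD(1)[OF that(1)] by auto
  show ?thesis
  proof (rule linmapI)
    fix f g assume f: "f \<in> carrier (free_module R X)" and g: "g \<in> carrier (free_module R X)"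
    let ?Y = "{x. f x \<noteq> \<zero>} \<union> {x. g x \<noteq> \<zero>}"
    have Y: "finite ?Y" "?Y \<subseteq> X" using f g free_carrierD(2,3) by auto
    have fg: "(\<lambda>x. f x \<oplus> g x) \<in> carrier (free_module R X)" by (rule free_add_closed[OF f g])
    have "free_ext R Q \<phi> (\<lambda>x. f x \<oplus> g x) = finsum Q (\<lambda>x. (f x \<oplus> g x) \<odot>\<^bsub>Q\<^esub> \<phi> x) ?Y"
      by (rule sup[OF fg Y]) auto
    also have "\<dots> = finsum Q (\<lambda>x. f x \<odot>\<^bsub>Q\<^esub> \<phi> x \<oplus>\<^bsub>Q\<^esub> g x \<odot>\<^bsub>Q\<^esub> \<phi> x) ?Y"
      using f g Y(2) assms(2) free_carrierD(1) term_closed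
      by (intro Q.M.finsum_cong') (auto simp: Q.smult_l_distr Pi_iff intro!: Q.smult_l_distr)
    also have "\<dots> = free_ext R Q \<phi> f \<oplus>\<^bsub>Q\<^esub> free_ext R Q \<phi> g"
      using term_closed[OF f] term_closed[OF g] Y
      by (subst Q.M.finsum_addf) (auto simp: sup[OF f Y] sup[OF g Y])
    finally show "free_ext R Q \<phi> (f \<oplus>\<^bsub>free_module R X\<^esub> g) = free_ext R Q \<phi> f \<oplus>\<^bsub>Q\<^esub> free_ext R Q \<phi> g"
      by (simp add: free_fields)
  next
    fix r f assume r: "r \<in> carrier R" and f: "f \<in> carrier (free_module R X)"
    let ?Y = "{x. f x \<noteq> \<zero>}"
    have Y: "finite ?Y" "?Y \<subseteq> X" using f free_carrierD(2,3) by auto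
    have "free_ext R Q \<phi> (\<lambda>x. r \<otimes> f x) = finsum Q (\<lambda>x. (r \<otimes> f x) \<odot>\<^bsub>Q\<^esub> \<phi> x) ?Y"
      by (rule sup[OF free_smult_closed[OF f r] Y]) (use r in auto)
    also have "\<dots> = finsum Q (\<lambda>x. r \<odot>\<^bsub>Q\<^esub> (f x \<odot>\<^bsub>Q\<^esub> \<phi> x)) ?Y"
      using f r Y(2) assms(2) free_carrierD(1)[OF f] term_closed
      by (intro Q.M.finsum_cong') (auto simp: Pi_iff intro!: Q.smult_assoc1)
    also have "\<dots> = r \<odot>\<^bsub>Q\<^esub> free_ext R Q \<phi> f"
      using Y r term_closed[OF f] by (subst Q.finsum_smult_ldistr[symmetric]) (auto simp: free_ext_def)
    finally show "free_ext R Q \<phi> (r \<odot>\<^bsub>free_module R X\<^esub> f) = r \<odot>\<^bsub>Q\<^esub> free_ext R Q \<phi> f"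
      by (simp add: free_fields)
  next
    fix f assume f: "f \<in> carrier (free_module R X)"
    show "free_ext R Q \<phi> f \<in> carrier Q" unfolding free_ext_def
      using term_closed[OF f] free_carrierD(3)[OF f] by (intro Q.M.finsum_closed) auto
  qed
qed

lemma free_ext_gen:
  assumes "module R Q" "\<phi> \<in> X \<rightarrow> carrier Q" "x \<in> X"
  shows "free_ext R Q \<phi> (free_gen R x) = \<phi> x"
proof -
  interpret Q: module R Q by fact
  have "free_ext R Q \<phi> (free_gen R x) = finsum Q (\<lambda>y. free_gen R x y \<odot>\<^bsub>Q\<^esub> \<phi> y) {x}"
    by (rule free_ext_superset[OF assms(1) free_gen_closed[OF assms(3)] assms(2)])
      (use assms in \<open>auto simp: free_gen_def split: if_splits\<close>)
  also have "\<dots> = \<phi> x" using assms(2,3) by (auto simp: free_gen_def Pi_iff)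
  finally show ?thesis .
qed

text \<open>Induction on the support: setting the coefficient at one point \<open>y\<close> to zero
  yields an element \<open>g\<close> of smaller support, and the difference is a multiple of the
  generator at \<open>y\<close>.\<close>

lemma free_span:
  assumes "f \<in> carrier (free_module R X)"
  shows "f \<in> submodule_span R (free_module R X) (free_gen R ` X)"
proof -
  let ?F = "free_module R X"
  interpret F: module R ?F by (rule module_free)
  have sub: "submodule (submodule_span R ?F (free_gen R ` X)) R ?F"
    by (rule F.submodule_span_submodule) (auto intro: free_gen_closed)
  have fin: "finite {x. f x \<noteq> \<zero>}" by (rule free_carrierD(2)[OF assms])
  have "f \<in> submodule_span R ?F (free_gen R ` X)"
    if "finite Y" "f \<in> carrier ?F" "{x. f x \<noteq> \<zero>} = Y" for Y f
    using that
  proof (induction Y arbitrary: f rule: finite_induct)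
    case empty
    then have "f = \<zero>\<^bsub>?F\<^esub>" by (auto simp: free_fields)
    then show ?case using F.submodule_zero[OF sub] by simp
  next
    case (insert y Y)
    define g where "g = f(y := \<zero>)"
    have "f y \<noteq> \<zero>" using insert.prems(2) by blast
    then have y: "y \<in> X" using free_carrierD(3)[OF insert.prems(1)] by blast
    have gY: "{x. g x \<noteq> \<zero>} = Y" using insert.hyps(2) insert.prems(2) by (auto simp: g_def)
    have g: "g \<in> carrier ?F"
      using free_carrierD[OF insert.prems(1)] insert.hyps(1) gY
      by (intro free_carrierI) (auto simp: g_def split: if_splits)
    have "f = g \<oplus>\<^bsub>?F\<^esub> (f y \<odot>\<^bsub>?F\<^esub> free_gen R y)"
    proof
      fix x
      show "f x = (g \<oplus>\<^bsub>?F\<^esub> (f y \<odot>\<^bsub>?F\<^esub> free_gen R y)) x"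
        using free_carrierD(1)[OF insert.prems(1), of x] free_carrierD(1)[OF insert.prems(1), of y]
        by (cases "x = y") (simp_all add: free_fields free_gen_def g_def)
    qed
    moreover have "f y \<odot>\<^bsub>?F\<^esub> free_gen R y \<in> submodule_span R ?F (free_gen R ` X)"
      using F.submoduleE(4)[OF sub] F.submodule_span_incl y free_carrierD(1)[OF insert.prems(1)] by auto
    ultimately show ?case using F.submoduleE(5)[OF sub] insert.IH[OF g gY] by metis
  qed
  then show ?thesis using fin assms by blast
qed

end

text \<open>Generators and relations are kept arbitrary because there are two uses: the multilinear
  relations of a finite family over R, and the balanced relations of two bimodules over an
  algebra.\<close>

locale presentation = cring R for R (structure) +
  fixes X :: "'x set" and S :: "('x \<Rightarrow> 'a) set"
  assumes relations_closed: "S \<subseteq> carrier (free_module R X)"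
begin

abbreviation "F \<equiv> free_module R X"
abbreviation "K \<equiv> submodule_span R F S"
abbreviation "P \<equiv> presented_module R X S"
abbreviation "gen \<equiv> presented_gen R X S"

sublocale F: module R F by (rule module_free)

lemma submodule_K: "submodule K R F" by (rule F.submodule_span_submodule[OF relations_closed])

lemma module_P: "module R P" unfolding presented_module_def by (rule F.module_quotient[OF submodule_K])

sublocale P: module R P by (rule module_P)

lemma class_linmap: "(\<lambda>f. K +>\<^bsub>F\<^esub> f) \<in> linmap R F P"
  unfolding presented_module_def
  by (rule linmapI) (simp_all add: F.quotient_carrier F.quotient_add[OF submodule_K] F.quotient_smult[OF submodule_K])

lemma gen_closed: "x \<in> X \<Longrightarrow> gen x \<in> carrier P"
  unfolding presented_gen_def using linmap_closed[OF class_linmap free_gen_closed] .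

lemma span_gen:
  assumes "T \<in> carrier P" shows "T \<in> submodule_span R P (gen ` X)"
proof -
  obtain f where f: "f \<in> carrier F" "T = K +>\<^bsub>F\<^esub> f"
    using assms by (auto simp: presented_module_def F.quotient_carrier)
  have "K +>\<^bsub>F\<^esub> f \<in> submodule_span R P (gen ` X)"
    by (rule linmap_span[OF F.module_axioms P.module_axioms class_linmap _ _ _ free_span[OF f(1)]])
      (auto intro!: P.submodule_span_submodule gen_closed free_gen_closed P.submodule_span_incl
        simp: presented_gen_def[symmetric])
  then show ?thesis using f by simp
qed

text \<open>Takes the place of writing an element as a sum of generators. Used repeatedly, it
  reduces an identity that is linear in each of several arguments to generators, one argument at a
  time.\<close>

lemma carrier_induct [consumes 1, case_names gen zero add smult]:
  assumes "T \<in> carrier P"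
    and "\<And>x. x \<in> X \<Longrightarrow> Q (gen x)"
    and "Q \<zero>\<^bsub>P\<^esub>"
    and "\<And>T U. \<lbrakk>T \<in> carrier P; U \<in> carrier P; Q T; Q U\<rbrakk> \<Longrightarrow> Q (T \<oplus>\<^bsub>P\<^esub> U)"
    and "\<And>r T. \<lbrakk>r \<in> carrier R; T \<in> carrier P; Q T\<rbrakk> \<Longrightarrow> Q (r \<odot>\<^bsub>P\<^esub> T)"
  shows "Q T"
proof -
  have "gen ` X \<subseteq> carrier P" by (auto intro: gen_closed)
  with span_gen[OF assms(1)] show ?thesis
    by (induction rule: P.submodule_span_induct) (use assms in auto)
qed

lemma linmap_eqI:
  assumes "module R Q" "h \<in> linmap R P Q" "k \<in> linmap R P Q" "\<And>x. x \<in> X \<Longrightarrow> h (gen x) = k (gen x)"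
    and "T \<in> carrier P"
  shows "h T = k T"
  by (rule linmap_span_eq[OF P.module_axioms assms(1-3) _ _ span_gen[OF assms(5)]])
    (use assms(4) gen_closed in auto)

context
  fixes Q :: "('a, 'y, 'z) module_scheme" and \<phi>
  assumes Q: "module R Q" and \<phi>: "\<phi> \<in> X \<rightarrow> carrier Q"
    and rel: "\<And>s. s \<in> S \<Longrightarrow> free_ext R Q \<phi> s = \<zero>\<^bsub>Q\<^esub>"
begin

interpretation Q: module R Q by (rule Q)

lemma free_ext_K:
  assumes "s \<in> K" shows "free_ext R Q \<phi> s = \<zero>\<^bsub>Q\<^esub>"
proof -
  have "submodule {\<zero>\<^bsub>Q\<^esub>} R Q" by (rule Q.submoduleI_linear) auto
  from linmap_span[OF F.module_axioms Q free_ext_linmap[OF Q \<phi>] this relations_closed _ assms] rel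
  show ?thesis by simp
qed

text \<open>The representative picked by \<open>SOME\<close> differs from \<open>f\<close> by an
  element of \<open>K\<close>. The extension vanishes on the relations, hence on their span
  \<open>K\<close>, so the choice has no effect.\<close>

lemma presented_lift_class:
  assumes "f \<in> carrier F" shows "presented_lift R Q \<phi> (K +>\<^bsub>F\<^esub> f) = free_ext R Q \<phi> f"
proof -
  interpret K: abelian_subgroup K F by (rule F.submodule_abelian_subgroup[OF submodule_K])
  have "f \<in> K +>\<^bsub>F\<^esub> f" by (rule K.a_rcos_self[OF assms])
  then have g: "(SOME g. g \<in> K +>\<^bsub>F\<^esub> f) \<in> K +>\<^bsub>F\<^esub> f" (is "?g \<in> _") by (rule someI[of "\<lambda>g. g \<in> K +>\<^bsub>F\<^esub> f"])
  have gc: "?g \<in> carrier F" using K.a_elemrcos_carrier[OF assms g] .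
  have gf: "?g \<ominus>\<^bsub>F\<^esub> f \<in> K"
    using F.coset_mem_iff[OF submodule_K assms gc] g by simp
  note lin = free_ext_linmap[OF Q \<phi>]
  have "?g = (?g \<ominus>\<^bsub>F\<^esub> f) \<oplus>\<^bsub>F\<^esub> f" using gc assms by (simp add: a_minus_def F.M.a_assoc F.M.l_neg)
  then have "free_ext R Q \<phi> ?g = free_ext R Q \<phi> (?g \<ominus>\<^bsub>F\<^esub> f) \<oplus>\<^bsub>Q\<^esub> free_ext R Q \<phi> f"
    using linmap_add[OF lin, of "?g \<ominus>\<^bsub>F\<^esub> f" f] gc assms by simp
  then have "free_ext R Q \<phi> ?g = free_ext R Q \<phi> f"
    using free_ext_K[OF gf] linmap_closed[OF lin assms] by simp
  then show ?thesis by (simp add: presented_lift_free_ext)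
qed

lemma presented_lift_linmap: "presented_lift R Q \<phi> \<in> linmap R P Q"
proof -
  note lin = free_ext_linmap[OF Q \<phi>]
  have cl: "\<exists>f\<in>carrier F. T = K +>\<^bsub>F\<^esub> f" if "T \<in> carrier P" for T
    using that by (auto simp: presented_module_def F.quotient_carrier)
  show ?thesis
    by (rule linmapI)
      (auto dest!: cl simp: presented_lift_class linmap_closed[OF lin] linmap_add[OF lin]
        linmap_smult[OF lin] linmap_add[OF class_linmap, symmetric] linmap_smult[OF class_linmap, symmetric])
qed

lemma presented_lift_gen: "x \<in> X \<Longrightarrow> presented_lift R Q \<phi> (gen x) = \<phi> x"
  unfolding presented_gen_def by (simp add: presented_lift_class free_gen_closed free_ext_gen[OF Q \<phi>])

end

end

section \<open>Operations on linear maps; bilinear and multilinear maps\<close>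

lemma linmap_minus:
  assumes "module R M" "module R N" "h \<in> linmap R M N" "x \<in> carrier M" "y \<in> carrier M"
  shows "h (x \<ominus>\<^bsub>M\<^esub> y) = h x \<ominus>\<^bsub>N\<^esub> h y"
proof -
  interpret M: module R M by fact
  interpret N: module R N by fact
  have neg: "h (\<ominus>\<^bsub>M\<^esub> y) = \<ominus>\<^bsub>N\<^esub> h y"
    using linmap_add[OF assms(3), of "\<ominus>\<^bsub>M\<^esub> y" y] linmap_zero[OF assms(1-3)] assms(5)
      linmap_closed[OF assms(3)] N.M.minus_equality[of "h (\<ominus>\<^bsub>M\<^esub> y)" "h y"]
    by (simp add: M.M.l_neg)
  show ?thesis
    using assms(4,5) by (simp add: a_minus_def linmap_add[OF assms(3)] neg)
qed

lemma linmap_plus_maps: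
  assumes "module R M" "module R N" "h \<in> linmap R M N" "k \<in> linmap R M N"
  shows "(\<lambda>x. h x \<oplus>\<^bsub>N\<^esub> k x) \<in> linmap R M N"
proof -
  interpret M: module R M by fact
  interpret N: module R N by fact
  show ?thesis
    by (rule linmapI)
      (auto simp: linmap_closed[OF assms(3)] linmap_closed[OF assms(4)] linmap_add[OF assms(3)]
        linmap_add[OF assms(4)] linmap_smult[OF assms(3)] linmap_smult[OF assms(4)] N.smult_r_distr N.M.a_ac)
qed

lemma linmap_smult_map:
  assumes "module R M" "module R N" "h \<in> linmap R M N" "r \<in> carrier R"
  shows "(\<lambda>x. r \<odot>\<^bsub>N\<^esub> h x) \<in> linmap R M N"
proof -
  interpret M: module R M by fact
  interpret N: module R N by fact
  show ?thesis
    by (rule linmapI)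
      (auto simp: linmap_closed[OF assms(3)] linmap_add[OF assms(3)]
        linmap_smult[OF assms(3)] N.smult_r_distr N.smult_assoc1[symmetric] M.R.m_comm assms(4))
qed

text \<open>Phrased through \<open>linmap\<close> in each variable with the other one fixed, so that
  all facts on linear maps, finite sums included, apply to one variable at a time.\<close>

definition bilin ::
    "('o, 'p) ring_scheme \<Rightarrow> ('o, 'x, 'w) module_scheme \<Rightarrow> ('o, 'y, 'u) module_scheme \<Rightarrow>
      ('o, 'z, 'v) module_scheme \<Rightarrow> ('x \<Rightarrow> 'y \<Rightarrow> 'z) \<Rightarrow> bool"
  where "bilin R M N P \<beta> \<longleftrightarrow>
    (\<forall>m\<in>carrier M. \<beta> m \<in> linmap R N P) \<and> (\<forall>n\<in>carrier N. (\<lambda>m. \<beta> m n) \<in> linmap R M P)"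

lemma bilin_left: "\<lbrakk>bilin R M N P \<beta>; n \<in> carrier N\<rbrakk> \<Longrightarrow> (\<lambda>m. \<beta> m n) \<in> linmap R M P"
  and bilin_right: "\<lbrakk>bilin R M N P \<beta>; m \<in> carrier M\<rbrakk> \<Longrightarrow> \<beta> m \<in> linmap R N P"
  and bilin_closed: "\<lbrakk>bilin R M N P \<beta>; m \<in> carrier M; n \<in> carrier N\<rbrakk> \<Longrightarrow> \<beta> m n \<in> carrier P"
  by (auto simp: bilin_def dest: linmap_closed)

text \<open>A variable is varied by a function update at a point of the extensional product; this is
  the form in which \<open>multilinear_relations\<close> states the relations.\<close>

definition multilin ::
    "('o, 'p) ring_scheme \<Rightarrow> 'i set \<Rightarrow> ('i \<Rightarrow> ('o, 'x, 'z) module_scheme) \<Rightarrow>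
      ('o, 'y, 'w) module_scheme \<Rightarrow> (('i \<Rightarrow> 'x) \<Rightarrow> 'y) \<Rightarrow> bool"
  where "multilin R I M Q \<phi> \<longleftrightarrow>
    (\<forall>x\<in>(\<Pi>\<^sub>E i\<in>I. carrier (M i)). \<forall>i\<in>I. (\<lambda>a. \<phi> (x(i := a))) \<in> linmap R (M i) Q)"

section \<open>Tensor products of finite families\<close>

locale tensor_family = cring R for R (structure) +
  fixes I :: "'i set" and M :: "'i \<Rightarrow> ('a, 'x, 'z) module_scheme"
  assumes finite_I: "finite I" and modules: "i \<in> I \<Longrightarrow> module R (M i)"
begin

abbreviation "XT \<equiv> (\<Pi>\<^sub>E i\<in>I. carrier (M i))"
abbreviation "TM \<equiv> tensor_module R I M"
abbreviation "pure \<equiv> pure_tensor R I M"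

lemma relations_cases:
  assumes "s \<in> multilinear_relations R I M"
  obtains (add) x i a b where "x \<in> XT" "i \<in> I" "a \<in> carrier (M i)" "b \<in> carrier (M i)"
    "s = free_gen R (x(i := a \<oplus>\<^bsub>M i\<^esub> b)) \<ominus>\<^bsub>free_module R XT\<^esub>
      (free_gen R (x(i := a)) \<oplus>\<^bsub>free_module R XT\<^esub> free_gen R (x(i := b)))"
  | (smult) x i r a where "x \<in> XT" "i \<in> I" "r \<in> carrier R" "a \<in> carrier (M i)"
    "s = free_gen R (x(i := r \<odot>\<^bsub>M i\<^esub> a)) \<ominus>\<^bsub>free_module R XT\<^esub>
      (r \<odot>\<^bsub>free_module R XT\<^esub> free_gen R (x(i := a)))"
  using assms unfolding multilinear_relations_def Let_def by blast

lemma upd_closed: "\<lbrakk>x \<in> XT; i \<in> I; a \<in> carrier (M i)\<rbrakk> \<Longrightarrow> x(i := a) \<in> XT"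
  by (metis PiE_fun_upd insert_absorb)

sublocale pres: presentation R XT "multilinear_relations R I M"
proof
  interpret F: module R "free_module R XT" by (rule module_free)
  have g: "free_gen R (x(i := a)) \<in> carrier (free_module R XT)"
    if "x \<in> XT" "i \<in> I" "a \<in> carrier (M i)" for x i a
    using that upd_closed by (intro free_gen_closed) blast
  show "multilinear_relations R I M \<subseteq> carrier (free_module R XT)"
  proof
    fix s assume "s \<in> multilinear_relations R I M"
    then show "s \<in> carrier (free_module R XT)"
    proof (cases rule: relations_cases)
      case (add x i a b)
      then interpret Mi: module R "M i" using modules by blast
      show ?thesis unfolding add(5) using add by (intro F.M.minus_closed F.M.a_closed g) auto
    next
      case (smult x i r a)
      then interpret Mi: module R "M i" using modules by blast
      show ?thesis unfolding smult(5) using smult by (intro F.M.minus_closed F.smult_closed g) auto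
    qed
  qed
qed

lemma TM_pres: "TM = pres.P" by (simp add: tensor_module_def)

lemma pure_pres: "pure x = pres.gen (restrict x I)" by (simp add: pure_tensor_def)

lemma module_tensor: "module R TM" unfolding TM_pres by (rule pres.module_P)

sublocale TM: module R TM by (rule module_tensor)

lemma pure_closed:
  assumes "\<And>i. i \<in> I \<Longrightarrow> x i \<in> carrier (M i)" shows "pure x \<in> carrier TM"
  unfolding pure_pres TM_pres using assms by (intro pres.gen_closed) auto

lemma pure_cong: "(\<And>i. i \<in> I \<Longrightarrow> x i = y i) \<Longrightarrow> pure x = pure y"
  by (simp add: pure_pres restrict_def fun_eq_iff cong: if_cong)

text \<open>The two kinds of multilinear relations are differences of exactly the free elements
  whose classes have to agree.\<close>

lemma gen_linmap:
  assumes "x \<in> XT" "i \<in> I"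
  shows "(\<lambda>a. pres.gen (x(i := a))) \<in> linmap R (M i) pres.P"
proof -
  interpret Mi: module R "M i" using modules assms by blast
  let ?cl = "\<lambda>f. pres.K +>\<^bsub>pres.F\<^esub> f"
  have gen: "pres.gen y = ?cl (free_gen R y)" for y by (simp add: presented_gen_def)
  have g: "free_gen R (x(i := a)) \<in> carrier pres.F" if "a \<in> carrier (M i)" for a
    using that assms upd_closed by (intro free_gen_closed) blast
  have eqI: "?cl u = ?cl v" if "u \<in> carrier pres.F" "v \<in> carrier pres.F"
    "u \<ominus>\<^bsub>pres.F\<^esub> v \<in> multilinear_relations R I M" for u v
    using that pres.F.quotient_eq_iff[OF pres.submodule_K] pres.F.submodule_span_incl by blast
  show ?thesis
  proof (rule linmapI)
    fix a assume "a \<in> carrier (M i)"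
    then show "pres.gen (x(i := a)) \<in> carrier pres.P" using assms upd_closed by (intro pres.gen_closed) blast
  next
    fix a b assume ab: "a \<in> carrier (M i)" "b \<in> carrier (M i)"
    have "?cl (free_gen R (x(i := a \<oplus>\<^bsub>M i\<^esub> b))) =
        ?cl (free_gen R (x(i := a)) \<oplus>\<^bsub>pres.F\<^esub> free_gen R (x(i := b)))"
      using ab assms
      by (intro eqI pres.F.M.a_closed g Mi.M.a_closed UnI1) (unfold multilinear_relations_def Let_def, blast+)
    then show "pres.gen (x(i := a \<oplus>\<^bsub>M i\<^esub> b)) = pres.gen (x(i := a)) \<oplus>\<^bsub>pres.P\<^esub> pres.gen (x(i := b))"
      using linmap_add[OF pres.class_linmap g[OF ab(1)] g[OF ab(2)]] by (simp add: gen)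
  next
    fix r a assume ra: "r \<in> carrier R" "a \<in> carrier (M i)"
    have "?cl (free_gen R (x(i := r \<odot>\<^bsub>M i\<^esub> a))) = ?cl (r \<odot>\<^bsub>pres.F\<^esub> free_gen R (x(i := a)))"
      using ra assms
      by (intro eqI pres.F.smult_closed g Mi.smult_closed) (unfold multilinear_relations_def Let_def, blast+)
    then show "pres.gen (x(i := r \<odot>\<^bsub>M i\<^esub> a)) = r \<odot>\<^bsub>pres.P\<^esub> pres.gen (x(i := a))"
      using linmap_smult[OF pres.class_linmap ra(1) g[OF ra(2)]] by (simp add: gen)
  qed
qed

lemma pure_linmap:
  assumes "\<And>j. j \<in> I \<Longrightarrow> j \<noteq> i \<Longrightarrow> x j \<in> carrier (M j)" "i \<in> I"
  shows "(\<lambda>a. pure (x(i := a))) \<in> linmap R (M i) TM"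
proof -
  interpret Mi: module R "M i" using modules assms by blast
  \<comment> \<open>The family \<open>x\<close> may be arbitrary at \<open>i\<close> and outside
    \<open>I\<close>. Putting zero at \<open>i\<close> and restricting to \<open>I\<close> produces
    a point of the product that has the same updates at \<open>i\<close> within
    \<open>I\<close>.\<close>
  define y where "y = restrict (x(i := \<zero>\<^bsub>M i\<^esub>)) I"
  have "y \<in> XT" using assms by (auto simp: y_def)
  note lin = gen_linmap[OF this assms(2)]
  have "restrict (x(i := a)) I = y(i := a)" for a using assms(2) by (auto simp: fun_eq_iff y_def)
  then have "(\<lambda>a. pure (x(i := a))) = (\<lambda>a. pres.gen (y(i := a)))" by (simp only: pure_pres)
  then show ?thesis using lin by (simp only: TM_pres)
qed

lemma carrier_induct [consumes 1, case_names pure zero add smult]: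
  assumes "T \<in> carrier TM"
    and "\<And>x. x \<in> XT \<Longrightarrow> Q (pure x)"
    and "Q \<zero>\<^bsub>TM\<^esub>"
    and "\<And>T U. \<lbrakk>T \<in> carrier TM; U \<in> carrier TM; Q T; Q U\<rbrakk> \<Longrightarrow> Q (T \<oplus>\<^bsub>TM\<^esub> U)"
    and "\<And>r T. \<lbrakk>r \<in> carrier R; T \<in> carrier TM; Q T\<rbrakk> \<Longrightarrow> Q (r \<odot>\<^bsub>TM\<^esub> T)"
  shows "Q T"
  using assms(1) unfolding TM_pres
proof (induction rule: pres.carrier_induct)
  case (gen x)
  then show ?case using assms(2)[OF gen] by (simp add: pure_pres PiE_restrict)
qed (use assms in \<open>simp_all add: TM_pres\<close>)

lemma linmap_eqI:
  assumes "module R Q" "h \<in> linmap R TM Q" "k \<in> linmap R TM Q"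
    and "\<And>x. x \<in> XT \<Longrightarrow> h (pure x) = k (pure x)" and "T \<in> carrier TM"
  shows "h T = k T"
  using assms unfolding TM_pres
  by (intro pres.linmap_eqI[of Q h k T]) (auto simp: pure_pres PiE_restrict)

text \<open>The universal property of the tensor product: multilinearity of \<phi> says that its
  free extension kills the relations. The value on a pure tensor is taken at
  \<open>restrict x I\<close>, because generators are extensional families whereas \<phi> might look
  outside \<open>I\<close>.\<close>

lemma
  assumes "module R Q" "multilin R I M Q \<phi>" "\<And>x. x \<in> XT \<Longrightarrow> \<phi> x \<in> carrier Q"
  shows tensor_lift_linmap: "presented_lift R Q \<phi> \<in> linmap R TM Q"
    and tensor_lift_pure: "(\<And>i. i \<in> I \<Longrightarrow> x i \<in> carrier (M i)) \<Longrightarrow>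
      presented_lift R Q \<phi> (pure x) = \<phi> (restrict x I)"
proof -
  interpret Q: module R Q by fact
  have \<phi>: "\<phi> \<in> XT \<rightarrow> carrier Q" using assms(3) by auto
  note lin = free_ext_linmap[OF assms(1) \<phi>]
  note diff = linmap_minus[OF pres.F.module_axioms assms(1) lin]
  have ml: "(\<lambda>a. \<phi> (x(i := a))) \<in> linmap R (M i) Q" if "x \<in> XT" "i \<in> I" for x i
    using assms(2) that by (simp add: multilin_def)
  have rel: "free_ext R Q \<phi> s = \<zero>\<^bsub>Q\<^esub>" if s: "s \<in> multilinear_relations R I M" for s
    using s
  proof (cases rule: relations_cases)
    case (add x i a b)
    interpret Mi: module R "M i" using modules add by blast
    have u: "x(i := a) \<in> XT" "x(i := b) \<in> XT" "x(i := a \<oplus>\<^bsub>M i\<^esub> b) \<in> XT"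
      using add upd_closed by auto
    note f = u[THEN free_gen_closed] and e = u[THEN free_ext_gen[OF assms(1) \<phi>]]
    show ?thesis
      unfolding add(5) using f e linmap_add[OF ml[OF add(1,2)] add(3,4)] u[THEN assms(3)]
      by (simp add: diff linmap_add[OF lin] a_minus_def[of Q] Q.M.r_neg)
  next
    case (smult x i r a)
    interpret Mi: module R "M i" using modules smult by blast
    have u: "x(i := a) \<in> XT" "x(i := r \<odot>\<^bsub>M i\<^esub> a) \<in> XT"
      using smult upd_closed by auto
    note f = u[THEN free_gen_closed] and e = u[THEN free_ext_gen[OF assms(1) \<phi>]]
    show ?thesis
      unfolding smult(5) using f e linmap_smult[OF ml[OF smult(1,2)] smult(3,4)] u[THEN assms(3)] smult(3)
      by (simp add: diff linmap_smult[OF lin] a_minus_def[of Q] Q.M.r_neg)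
  qed
  show "presented_lift R Q \<phi> \<in> linmap R TM Q"
    unfolding TM_pres by (rule pres.presented_lift_linmap[OF assms(1) \<phi> rel])
  show "presented_lift R Q \<phi> (pure x) = \<phi> (restrict x I)" if "\<And>i. i \<in> I \<Longrightarrow> x i \<in> carrier (M i)"
    unfolding pure_pres using that by (intro pres.presented_lift_gen[OF assms(1) \<phi> rel]) auto
qed

text \<open>The distributive law for pure tensors, by induction on the set \<open>I'\<close> of
  coordinates already expanded. The remaining coordinates are held at \<open>z\<close>, which has to
  stay arbitrary: the inductive step stores the summand \<open>y k l\<close> of the new coordinate
  \<open>k\<close> in it.\<close>

lemma pure_finsum_aux:
  assumes "finite I'" "I' \<subseteq> I" "\<And>i. i \<in> I \<Longrightarrow> finite (J i)"
    and "\<And>i j. i \<in> I \<Longrightarrow> j \<in> J i \<Longrightarrow> y i j \<in> carrier (M i)" "\<And>i. i \<in> I \<Longrightarrow> z i \<in> carrier (M i)"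
  shows "pure (\<lambda>i. if i \<in> I' then finsum (M i) (y i) (J i) else z i) =
    finsum TM (\<lambda>j. pure (\<lambda>i. if i \<in> I' then y i (j i) else z i)) (PiE I' J)"
  using assms(1,2,5)
proof (induction I' arbitrary: z rule: finite_induct)
  case empty
  then show ?case using pure_closed[of z] by simp
next
  case (insert k I')
  have k: "k \<in> I" "I' \<subseteq> I" using insert.prems by auto
  interpret Mk: module R "M k" using modules k by blast
  have fs: "finsum (M i) (y i) (J i) \<in> carrier (M i)" if "i \<in> I" for i
  proof -
    interpret Mi: module R "M i" using modules that by blast
    show ?thesis using assms(4) that by auto
  qed
  let ?x = "\<lambda>i. if i \<in> I' then finsum (M i) (y i) (J i) else z i"
  let ?f = "\<lambda>j. pure (\<lambda>i. if i \<in> insert k I' then y i (j i) else z i)"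
  have "pure (\<lambda>i. if i \<in> insert k I' then finsum (M i) (y i) (J i) else z i) =
      pure (?x(k := finsum (M k) (y k) (J k)))"
    by (rule pure_cong) auto
  also have "\<dots> = finsum TM (\<lambda>l. pure (?x(k := y k l))) (J k)"
    using assms(3,4) k fs insert.prems
    by (intro linmap_finsum[OF modules[OF k(1)] module_tensor pure_linmap]) auto
  also have "\<dots> = finsum TM (\<lambda>l. finsum TM ?f ((\<lambda>g. g(k := l)) ` PiE I' J)) (J k)"
  proof (rule TM.M.finsum_cong'[OF refl])
    have fcl: "?f j \<in> carrier TM" if "j \<in> PiE (insert k I') J" for j
    proof (rule pure_closed)
      fix i assume "i \<in> I"
      then show "(if i \<in> insert k I' then y i (j i) else z i) \<in> carrier (M i)"
        using that assms(4) k(1) insert.prems PiE_mem[OF that, of i] by (cases "i \<in> insert k I'") auto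
    qed
    have img: "(\<lambda>g. g(k := l)) ` PiE I' J \<subseteq> PiE (insert k I') J" if "l \<in> J k" for l
      using that PiE_fun_upd[of l J k] by blast
    show "(\<lambda>l. finsum TM ?f ((\<lambda>g. g(k := l)) ` PiE I' J)) \<in> J k \<rightarrow> carrier TM"
      using img by (intro Pi_I TM.M.finsum_closed fcl) blast
    fix l assume l: "l \<in> J k"
    \<comment> \<open>The family to which the induction hypothesis is applied: coordinate
      \<open>k\<close> is fixed to one summand, and the coordinates in \<open>I'\<close> are
      expanded.\<close>
    have z': "(z(k := y k l)) i \<in> carrier (M i)" if "i \<in> I" for i
      using that insert.prems assms(4)[OF k(1) l] by auto
    have inj: "inj_on (\<lambda>g. g(k := l)) (PiE I' J)"
    proof (rule inj_onI)
      fix g h assume gh: "g \<in> PiE I' J" "h \<in> PiE I' J" "g(k := l) = h(k := l)"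
      show "g = h"
      proof (rule PiE_ext[OF gh(1,2)])
        fix i assume "i \<in> I'"
        then have "i \<noteq> k" using insert.hyps by auto
        then show "g i = h i" using gh(3) by (metis fun_upd_other)
      qed
    qed
    have "pure (?x(k := y k l)) = pure (\<lambda>i. if i \<in> I' then finsum (M i) (y i) (J i) else (z(k := y k l)) i)"
      using insert.hyps by (intro pure_cong) auto
    also have "\<dots> = finsum TM (\<lambda>j. pure (\<lambda>i. if i \<in> I' then y i (j i) else (z(k := y k l)) i)) (PiE I' J)"
      by (rule insert.IH[OF k(2) z'])
    also have "\<dots> = finsum TM (\<lambda>g. ?f (g(k := l))) (PiE I' J)"
    proof (rule TM.M.finsum_cong'[OF refl])
      show "(\<lambda>g. ?f (g(k := l))) \<in> PiE I' J \<rightarrow> carrier TM" using l by (intro Pi_I fcl PiE_fun_upd) auto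
      show "pure (\<lambda>i. if i \<in> I' then y i (j i) else (z(k := y k l)) i) = ?f (j(k := l))" for j
        using insert.hyps by (intro pure_cong) auto
    qed
    also have "\<dots> = finsum TM ?f ((\<lambda>g. g(k := l)) ` PiE I' J)"
      using img[OF l] by (intro TM.M.finsum_reindex[symmetric] inj Pi_I fcl) blast
    finally show "pure (?x(k := y k l)) = finsum TM ?f ((\<lambda>g. g(k := l)) ` PiE I' J)" .
  qed
  \<comment> \<open>Choice functions on \<open>insert k I'\<close> are partitioned by their value
    \<open>l\<close> at \<open>k\<close>, so the double sum becomes a single one.\<close>
  also have "\<dots> = finsum TM ?f (\<Union>l\<in>J k. (\<lambda>g. g(k := l)) ` PiE I' J)"
  proof (rule TM.M.add.finprod_UN_disjoint[symmetric])
    show "finite (J k)" using assms(3) k by auto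
    show "finite ((\<lambda>g. g(k := l)) ` PiE I' J)" if "l \<in> J k" for l
      using insert.hyps assms(3) k by (intro finite_imageI finite_PiE) auto
    show "pairwise (\<lambda>l l'. disjnt ((\<lambda>g. g(k := l)) ` PiE I' J) ((\<lambda>g. g(k := l')) ` PiE I' J)) (J k)"
      unfolding pairwise_def disjnt_def by (auto dest: fun_cong[where x = k])
    show "?f j \<in> carrier TM" if "l \<in> J k" "j \<in> (\<lambda>g. g(k := l)) ` PiE I' J" for l j
    proof (rule pure_closed)
      fix i assume "i \<in> I"
      have j: "j \<in> PiE (insert k I') J" using that by (auto intro!: PiE_fun_upd)
      show "(if i \<in> insert k I' then y i (j i) else z i) \<in> carrier (M i)"
        using \<open>i \<in> I\<close> assms(4) k(1) insert.prems PiE_mem[OF j, of i] by (cases "i \<in> insert k I'") auto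
    qed
  qed
  also have "(\<Union>l\<in>J k. (\<lambda>g. g(k := l)) ` PiE I' J) = PiE (insert k I') J"
    by (auto simp: PiE_insert_eq image_iff)
  finally show ?case .
qed

lemma pure_finsum:
  assumes "\<And>i. i \<in> I \<Longrightarrow> finite (J i)" "\<And>i j. i \<in> I \<Longrightarrow> j \<in> J i \<Longrightarrow> y i j \<in> carrier (M i)"
  shows "pure (\<lambda>i. finsum (M i) (y i) (J i)) = finsum TM (\<lambda>j. pure (\<lambda>i. y i (j i))) (PiE I J)"
proof -
  let ?z = "\<lambda>i. \<zero>\<^bsub>M i\<^esub>"
  have z: "?z i \<in> carrier (M i)" if "i \<in> I" for i
  proof -
    interpret Mi: module R "M i" using modules that by blast
    show ?thesis by simp
  qed
  have "pure (\<lambda>i. finsum (M i) (y i) (J i)) = pure (\<lambda>i. if i \<in> I then finsum (M i) (y i) (J i) else ?z i)"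
    by (rule pure_cong) simp
  also have "\<dots> = finsum TM (\<lambda>j. pure (\<lambda>i. if i \<in> I then y i (j i) else ?z i)) (PiE I J)"
    by (rule pure_finsum_aux[OF finite_I subset_refl assms z])
  also have "\<dots> = finsum TM (\<lambda>j. pure (\<lambda>i. y i (j i))) (PiE I J)"
    by (rule arg_cong[where f = "\<lambda>h. finsum TM h (PiE I J)"], rule ext, rule pure_cong) simp
  finally show ?thesis .
qed

lemma pure_zero:
  assumes "\<And>j. j \<in> I \<Longrightarrow> x j \<in> carrier (M j)" "i \<in> I" "x i = \<zero>\<^bsub>M i\<^esub>"
  shows "pure x = \<zero>\<^bsub>TM\<^esub>"
proof -
  have "pure (x(i := \<zero>\<^bsub>M i\<^esub>)) = \<zero>\<^bsub>TM\<^esub>"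
    using linmap_zero[OF modules[OF assms(2)] module_tensor pure_linmap[of i x]] assms by simp
  then show ?thesis using assms(3) by (metis fun_upd_triv)
qed

end

section \<open>Tensor products of linear and of bilinear maps\<close>

text \<open>The maps \<open>act\<close> and \<open>str\<close> of the tensor records, the
  projections of the grading and the tensored functionals all have this form. The source modules do
  not occur, since a lift depends on its source only through the class it is applied to.\<close>

definition tensor_map1 ::
    "('o, 'p) ring_scheme \<Rightarrow> 'i set \<Rightarrow> ('i \<Rightarrow> ('o, 'y, 'z) module_scheme) \<Rightarrow> ('i \<Rightarrow> 'x \<Rightarrow> 'y) \<Rightarrow>
      (('i \<Rightarrow> 'x) \<Rightarrow> 'o) set \<Rightarrow> (('i \<Rightarrow> 'y) \<Rightarrow> 'o) set"
  where "tensor_map1 R I N f =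
    presented_lift R (tensor_module R I N) (\<lambda>x. pure_tensor R I N (\<lambda>i. f i (x i)))"

text \<open>The common form of the multiplication and of both bimodule actions. The nesting mirrors
  their definitions: for a family \<open>x\<close> the inner lift is a map in \<open>T\<close>, and
  the outer lift extends it from families \<open>x\<close> to \<open>S\<close>.\<close>

definition tensor_map2 ::
    "('o, 'p) ring_scheme \<Rightarrow> 'i set \<Rightarrow> ('i \<Rightarrow> ('o, 'z, 'w) module_scheme) \<Rightarrow> ('i \<Rightarrow> 'x \<Rightarrow> 'y \<Rightarrow> 'z) \<Rightarrow>
      (('i \<Rightarrow> 'x) \<Rightarrow> 'o) set \<Rightarrow> (('i \<Rightarrow> 'y) \<Rightarrow> 'o) set \<Rightarrow> (('i \<Rightarrow> 'z) \<Rightarrow> 'o) set"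
  where "tensor_map2 R I P \<beta> S T =
    presented_lift R (tensor_module R I P) (\<lambda>x. tensor_map1 R I P (\<lambda>i. \<beta> i (x i)) T) S"

lemma
  assumes M: "tensor_family R I M" and N: "tensor_family R I N"
    and f: "\<And>i. i \<in> I \<Longrightarrow> f i \<in> linmap R (M i) (N i)"
  shows tensor_map1_linmap: "tensor_map1 R I N f \<in> linmap R (tensor_module R I M) (tensor_module R I N)"
    and tensor_map1_pure: "(\<And>i. i \<in> I \<Longrightarrow> x i \<in> carrier (M i)) \<Longrightarrow>
      tensor_map1 R I N f (pure_tensor R I M x) = pure_tensor R I N (\<lambda>i. f i (x i))"
proof -
  interpret M: tensor_family R I M by fact
  interpret N: tensor_family R I N by fact
  let ?\<phi> = "\<lambda>x. pure_tensor R I N (\<lambda>i. f i (x i))"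
  have cl: "?\<phi> x \<in> carrier N.TM" if "x \<in> M.XT" for x
    using that by (intro N.pure_closed linmap_closed[OF f]) auto
  have ml: "multilin R I M N.TM ?\<phi>"
    unfolding multilin_def
  proof (intro ballI)
    fix x i assume x: "x \<in> M.XT" and i: "i \<in> I"
    have "(\<lambda>a. N.pure ((\<lambda>j. f j (x j))(i := f i a))) \<in> linmap R (M i) N.TM"
      using x by (intro linmap_compose[OF f[OF i] N.pure_linmap] i linmap_closed[OF f]) auto
    moreover have "(\<lambda>j. f j ((x(i := a)) j)) = (\<lambda>j. f j (x j))(i := f i a)" for a
      by (auto simp: fun_eq_iff)
    ultimately show "(\<lambda>a. ?\<phi> (x(i := a))) \<in> linmap R (M i) N.TM" by simp
  qed
  show "tensor_map1 R I N f \<in> linmap R M.TM N.TM"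
    unfolding tensor_map1_def by (rule M.tensor_lift_linmap[OF N.module_tensor ml cl])
  show "tensor_map1 R I N f (M.pure x) = N.pure (\<lambda>i. f i (x i))" if "\<And>i. i \<in> I \<Longrightarrow> x i \<in> carrier (M i)"
  proof -
    have "tensor_map1 R I N f (M.pure x) = ?\<phi> (restrict x I)"
      unfolding tensor_map1_def by (rule M.tensor_lift_pure[OF N.module_tensor ml cl that])
    also have "\<dots> = N.pure (\<lambda>i. f i (x i))" by (rule N.pure_cong) simp
    finally show ?thesis .
  qed
qed

text \<open>Two layers of lifting. The inner lift is linear in \<open>T\<close> by construction, but
  the outer one exists only if the inner one is multilinear in \<open>x\<close> for every fixed
  \<open>T\<close>. That is an equality between maps linear in \<open>T\<close>, hence a matter of
  pure \<open>T\<close>, where it follows from multilinearity of pure tensors.\<close>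

lemma
  assumes M: "tensor_family R I M" and N: "tensor_family R I N" and P: "tensor_family R I P"
    and \<beta>: "\<And>i. i \<in> I \<Longrightarrow> bilin R (M i) (N i) (P i) (\<beta> i)"
  shows tensor_map2_bilin:
      "bilin R (tensor_module R I M) (tensor_module R I N) (tensor_module R I P) (tensor_map2 R I P \<beta>)"
    and tensor_map2_pure:
      "\<lbrakk>\<And>i. i \<in> I \<Longrightarrow> x i \<in> carrier (M i); \<And>i. i \<in> I \<Longrightarrow> y i \<in> carrier (N i)\<rbrakk> \<Longrightarrow>
        tensor_map2 R I P \<beta> (pure_tensor R I M x) (pure_tensor R I N y) =
          pure_tensor R I P (\<lambda>i. \<beta> i (x i) (y i))"
proof -
  interpret M: tensor_family R I M by fact
  interpret N: tensor_family R I N by fact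
  interpret P: tensor_family R I P by fact
  let ?in = "\<lambda>x. tensor_map1 R I P (\<lambda>i. \<beta> i (x i))"
  have lin: "?in x \<in> linmap R N.TM P.TM" if "x \<in> M.XT" for x
    using that by (intro tensor_map1_linmap[OF N P] bilin_right[OF \<beta>]) auto
  have inpure: "?in x (N.pure y) = P.pure (\<lambda>i. \<beta> i (x i) (y i))"
    if "x \<in> M.XT" "\<And>i. i \<in> I \<Longrightarrow> y i \<in> carrier (N i)" for x y
    using that by (intro tensor_map1_pure[OF N P] bilin_right[OF \<beta>]) auto
  \<comment> \<open>On pure tensors, changing \<open>x\<close> at \<open>i\<close> changes the image
    family at \<open>i\<close> only, so \<open>pure_linmap\<close> of the target applies.\<close>
  have upd: "P.pure (\<lambda>j. \<beta> j ((x(i := a)) j) (y j)) = P.pure ((\<lambda>j. \<beta> j (x j) (y j))(i := \<beta> i a (y i)))" for x i a y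
    by (rule P.pure_cong) auto
  have ml: "multilin R I M P.TM (\<lambda>x. ?in x T)" if T: "T \<in> carrier N.TM" for T
    unfolding multilin_def
  proof (intro ballI)
    fix x i assume x: "x \<in> M.XT" and i: "i \<in> I"
    interpret Mi: module R "M i" using M.modules i by blast
    have l: "(\<lambda>a. P.pure ((\<lambda>j. \<beta> j (x j) (y j))(i := \<beta> i a (y i)))) \<in> linmap R (M i) P.TM" if "y \<in> N.XT" for y
      using x i that
      by (intro linmap_compose[OF bilin_left[OF \<beta>[OF i]] P.pure_linmap] bilin_closed[OF \<beta>]) auto
    note c = M.upd_closed[OF x i]
    show "(\<lambda>a. ?in (x(i := a)) T) \<in> linmap R (M i) P.TM"
    proof (rule linmapI)
      show "?in (x(i := a)) T \<in> carrier P.TM" if "a \<in> carrier (M i)" for a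
        by (rule linmap_closed[OF lin[OF c[OF that]] T])
    next
      fix a b assume ab: "a \<in> carrier (M i)" "b \<in> carrier (M i)"
      show "?in (x(i := a \<oplus>\<^bsub>M i\<^esub> b)) T = ?in (x(i := a)) T \<oplus>\<^bsub>P.TM\<^esub> ?in (x(i := b)) T"
      proof (rule N.linmap_eqI[OF P.module_tensor _ _ _ T])
        show "(\<lambda>T. ?in (x(i := a)) T \<oplus>\<^bsub>P.TM\<^esub> ?in (x(i := b)) T) \<in> linmap R N.TM P.TM"
          by (intro linmap_plus_maps[OF N.module_tensor P.module_tensor] lin c ab)
        fix y assume y: "y \<in> N.XT"
        then have y': "y i \<in> carrier (N i)" if "i \<in> I" for i using that by auto
        show "?in (x(i := a \<oplus>\<^bsub>M i\<^esub> b)) (N.pure y) =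
            ?in (x(i := a)) (N.pure y) \<oplus>\<^bsub>P.TM\<^esub> ?in (x(i := b)) (N.pure y)"
          using linmap_add[OF l[OF y] ab] ab c y' by (simp add: inpure upd del: fun_upd_apply)
      qed (intro lin c Mi.M.a_closed ab)
    next
      fix r a assume ra: "r \<in> carrier R" "a \<in> carrier (M i)"
      show "?in (x(i := r \<odot>\<^bsub>M i\<^esub> a)) T = r \<odot>\<^bsub>P.TM\<^esub> ?in (x(i := a)) T"
      proof (rule N.linmap_eqI[OF P.module_tensor _ _ _ T])
        show "(\<lambda>T. r \<odot>\<^bsub>P.TM\<^esub> ?in (x(i := a)) T) \<in> linmap R N.TM P.TM"
          by (intro linmap_smult_map[OF N.module_tensor P.module_tensor] lin c ra)
        fix y assume y: "y \<in> N.XT"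
        then have y': "y i \<in> carrier (N i)" if "i \<in> I" for i using that by auto
        show "?in (x(i := r \<odot>\<^bsub>M i\<^esub> a)) (N.pure y) = r \<odot>\<^bsub>P.TM\<^esub> ?in (x(i := a)) (N.pure y)"
          using linmap_smult[OF l[OF y] ra] ra c y' by (simp add: inpure upd del: fun_upd_apply)
      qed (intro lin c Mi.smult_closed ra)
    qed
  qed
  have cl: "?in x T \<in> carrier P.TM" if "T \<in> carrier N.TM" "x \<in> M.XT" for x T
    using linmap_closed[OF lin] that by auto
  have left: "(\<lambda>S. tensor_map2 R I P \<beta> S T) \<in> linmap R M.TM P.TM" if "T \<in> carrier N.TM" for T
    unfolding tensor_map2_def by (rule M.tensor_lift_linmap[OF P.module_tensor ml[OF that] cl[OF that]])
  have pl: "tensor_map2 R I P \<beta> (M.pure x) T = ?in x T" if "T \<in> carrier N.TM" "x \<in> M.XT" for x T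
    unfolding tensor_map2_def using that
    by (subst M.tensor_lift_pure[OF P.module_tensor ml[OF that(1)] cl[OF that(1)]]) (auto simp: PiE_restrict)
  \<comment> \<open>As an outer lift the map is known to be linear in \<open>S\<close>. Linearity in
    \<open>T\<close> is an equality of maps linear in \<open>S\<close>; pure \<open>S\<close>
    suffice, and there the map is the inner lift.\<close>
  have right: "tensor_map2 R I P \<beta> S \<in> linmap R N.TM P.TM" if "S \<in> carrier M.TM" for S
  proof (rule linmapI)
    fix T assume "T \<in> carrier N.TM"
    then show "tensor_map2 R I P \<beta> S T \<in> carrier P.TM" using linmap_closed[OF left that] by simp
  next
    fix T U assume TU: "T \<in> carrier N.TM" "U \<in> carrier N.TM"
    show "tensor_map2 R I P \<beta> S (T \<oplus>\<^bsub>N.TM\<^esub> U) = tensor_map2 R I P \<beta> S T \<oplus>\<^bsub>P.TM\<^esub> tensor_map2 R I P \<beta> S U"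
      using TU
      by (intro M.linmap_eqI[OF P.module_tensor left linmap_plus_maps[OF M.module_tensor P.module_tensor left left] _ that])
        (auto simp: pl linmap_add[OF lin])
  next
    fix r T assume rT: "r \<in> carrier R" "T \<in> carrier N.TM"
    show "tensor_map2 R I P \<beta> S (r \<odot>\<^bsub>N.TM\<^esub> T) = r \<odot>\<^bsub>P.TM\<^esub> tensor_map2 R I P \<beta> S T"
      using rT
      by (intro M.linmap_eqI[OF P.module_tensor left linmap_smult_map[OF M.module_tensor P.module_tensor left] _ that])
        (auto simp: pl linmap_smult[OF lin])
  qed
  show "bilin R M.TM N.TM P.TM (tensor_map2 R I P \<beta>)"
    using left right by (auto simp: bilin_def)
  show "tensor_map2 R I P \<beta> (M.pure x) (N.pure y) = P.pure (\<lambda>i. \<beta> i (x i) (y i))"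
    if x: "\<And>i. i \<in> I \<Longrightarrow> x i \<in> carrier (M i)" and y: "\<And>i. i \<in> I \<Longrightarrow> y i \<in> carrier (N i)"
  proof -
    have r: "restrict x I \<in> M.XT" using x by auto
    have "M.pure x = M.pure (restrict x I)" by (rule M.pure_cong) simp
    then have "tensor_map2 R I P \<beta> (M.pure x) (N.pure y) = ?in (restrict x I) (N.pure y)"
      using pl[OF N.pure_closed r] y by simp
    also have "\<dots> = P.pure (\<lambda>i. \<beta> i (x i) (y i))"
      by (subst inpure[OF r y]) (simp, rule P.pure_cong, simp)
    finally show ?thesis .
  qed
qed

lemma bilin_simps:
  assumes "bilin R M N P \<beta>"
  shows "\<lbrakk>m \<in> carrier M; n \<in> carrier N\<rbrakk> \<Longrightarrow> \<beta> m n \<in> carrier P"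
    and "\<lbrakk>m \<in> carrier M; m' \<in> carrier M; n \<in> carrier N\<rbrakk> \<Longrightarrow> \<beta> (m \<oplus>\<^bsub>M\<^esub> m') n = \<beta> m n \<oplus>\<^bsub>P\<^esub> \<beta> m' n"
    and "\<lbrakk>m \<in> carrier M; n \<in> carrier N; n' \<in> carrier N\<rbrakk> \<Longrightarrow> \<beta> m (n \<oplus>\<^bsub>N\<^esub> n') = \<beta> m n \<oplus>\<^bsub>P\<^esub> \<beta> m n'"
    and "\<lbrakk>r \<in> carrier R; m \<in> carrier M; n \<in> carrier N\<rbrakk> \<Longrightarrow> \<beta> (r \<odot>\<^bsub>M\<^esub> m) n = r \<odot>\<^bsub>P\<^esub> \<beta> m n"
    and "\<lbrakk>r \<in> carrier R; m \<in> carrier M; n \<in> carrier N\<rbrakk> \<Longrightarrow> \<beta> m (r \<odot>\<^bsub>N\<^esub> n) = r \<odot>\<^bsub>P\<^esub> \<beta> m n"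
  using assms by (auto simp: bilin_def linmap_def)

lemma bilin_zero:
  assumes "bilin R M N P \<beta>" "module R M" "module R N" "module R P"
  shows "n \<in> carrier N \<Longrightarrow> \<beta> \<zero>\<^bsub>M\<^esub> n = \<zero>\<^bsub>P\<^esub>" and "m \<in> carrier M \<Longrightarrow> \<beta> m \<zero>\<^bsub>N\<^esub> = \<zero>\<^bsub>P\<^esub>"
  using linmap_zero[OF assms(2,4) bilin_left[OF assms(1)]] linmap_zero[OF assms(3,4) bilin_right[OF assms(1)]]
  by auto

lemma bilinI:
  assumes "\<And>m n. \<lbrakk>m \<in> carrier M; n \<in> carrier N\<rbrakk> \<Longrightarrow> \<beta> m n \<in> carrier P"
    and "\<And>m m' n. \<lbrakk>m \<in> carrier M; m' \<in> carrier M; n \<in> carrier N\<rbrakk> \<Longrightarrow> \<beta> (m \<oplus>\<^bsub>M\<^esub> m') n = \<beta> m n \<oplus>\<^bsub>P\<^esub> \<beta> m' n"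
    and "\<And>m n n'. \<lbrakk>m \<in> carrier M; n \<in> carrier N; n' \<in> carrier N\<rbrakk> \<Longrightarrow> \<beta> m (n \<oplus>\<^bsub>N\<^esub> n') = \<beta> m n \<oplus>\<^bsub>P\<^esub> \<beta> m n'"
    and "\<And>r m n. \<lbrakk>r \<in> carrier R; m \<in> carrier M; n \<in> carrier N\<rbrakk> \<Longrightarrow> \<beta> (r \<odot>\<^bsub>M\<^esub> m) n = r \<odot>\<^bsub>P\<^esub> \<beta> m n"
    and "\<And>r m n. \<lbrakk>r \<in> carrier R; m \<in> carrier M; n \<in> carrier N\<rbrakk> \<Longrightarrow> \<beta> m (r \<odot>\<^bsub>N\<^esub> n) = r \<odot>\<^bsub>P\<^esub> \<beta> m n"
  shows "bilin R M N P \<beta>"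
  using assms by (auto simp: bilin_def linmap_def)

section \<open>Gradings\<close>

text \<open>The projections recast unique decomposition as a family of linear maps. Linear maps can
  be tensored, whereas the unique existence statement cannot.\<close>

definition proj ::
    "('g, 'q) monoid_scheme \<Rightarrow> ('o, 'g, 'x, 'z) graded_scheme \<Rightarrow> 'g \<Rightarrow> 'x \<Rightarrow> 'x"
  where "proj \<Gamma> M g x =
    (THE f. f \<in> (\<Pi>\<^sub>E g\<in>carrier \<Gamma>. homog M g) \<and> x = finsum M f (carrier \<Gamma>)) g"

context graded_module begin

lemma homog_carrier: "\<lbrakk>g \<in> carrier \<Gamma>; x \<in> homog M g\<rbrakk> \<Longrightarrow> x \<in> carrier M"
  using submoduleE(1)[OF homog_submodule] by auto

lemma
  assumes "x \<in> carrier M"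
  shows proj_homog: "g \<in> carrier \<Gamma> \<Longrightarrow> proj \<Gamma> M g x \<in> homog M g"
    and proj_sum: "finsum M (\<lambda>g. proj \<Gamma> M g x) (carrier \<Gamma>) = x"
proof -
  let ?f = "THE f. f \<in> (\<Pi>\<^sub>E g\<in>carrier \<Gamma>. homog M g) \<and> x = finsum M f (carrier \<Gamma>)"
  have f: "?f \<in> (\<Pi>\<^sub>E g\<in>carrier \<Gamma>. homog M g) \<and> x = finsum M ?f (carrier \<Gamma>)"
    by (rule theI'[OF direct_sum[OF assms]])
  have pf: "(\<lambda>g. proj \<Gamma> M g x) = ?f" by (simp add: proj_def)
  show "g \<in> carrier \<Gamma> \<Longrightarrow> proj \<Gamma> M g x \<in> homog M g" using f by (auto simp: proj_def)
  show "finsum M (\<lambda>g. proj \<Gamma> M g x) (carrier \<Gamma>) = x" using f unfolding pf by simp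
qed

lemma proj_unique:
  assumes "\<And>g. g \<in> carrier \<Gamma> \<Longrightarrow> f g \<in> homog M g" "finsum M f (carrier \<Gamma>) = x" "g \<in> carrier \<Gamma>"
  shows "proj \<Gamma> M g x = f g"
proof -
  have fc: "f \<in> carrier \<Gamma> \<rightarrow> carrier M" using assms(1) homog_carrier by auto
  then have x: "x \<in> carrier M" using assms(2) by auto
  have "finsum M (restrict f (carrier \<Gamma>)) (carrier \<Gamma>) = x"
    unfolding assms(2)[symmetric] by (rule M.finsum_cong') (use fc in auto)
  moreover have "restrict f (carrier \<Gamma>) \<in> (\<Pi>\<^sub>E g\<in>carrier \<Gamma>. homog M g)" using assms(1) by auto
  ultimately have "(THE f. f \<in> (\<Pi>\<^sub>E g\<in>carrier \<Gamma>. homog M g) \<and> x = finsum M f (carrier \<Gamma>)) = restrict f (carrier \<Gamma>)"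
    by (intro the1_equality[OF direct_sum[OF x]]) auto
  then show ?thesis using assms(3) by (simp add: proj_def)
qed

lemma proj_carrier: "\<lbrakk>g \<in> carrier \<Gamma>; x \<in> carrier M\<rbrakk> \<Longrightarrow> proj \<Gamma> M g x \<in> carrier M"
  using homog_carrier proj_homog by blast

text \<open>Adding or scaling decompositions termwise gives decompositions of the sum or multiple,
  since components are submodules; uniqueness identifies their terms.\<close>

lemma proj_linmap: "g \<in> carrier \<Gamma> \<Longrightarrow> proj \<Gamma> M g \<in> linmap R M M"
proof (rule linmapI)
  assume g: "g \<in> carrier \<Gamma>"
  show "x \<in> carrier M \<Longrightarrow> proj \<Gamma> M g x \<in> carrier M" for x by (rule proj_carrier[OF g])
  show "proj \<Gamma> M g (x \<oplus>\<^bsub>M\<^esub> y) = proj \<Gamma> M g x \<oplus>\<^bsub>M\<^esub> proj \<Gamma> M g y" if "x \<in> carrier M" "y \<in> carrier M" for x y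
  proof (rule proj_unique[OF _ _ g])
    show "finsum M (\<lambda>g. proj \<Gamma> M g x \<oplus>\<^bsub>M\<^esub> proj \<Gamma> M g y) (carrier \<Gamma>) = x \<oplus>\<^bsub>M\<^esub> y"
      using that proj_carrier by (subst M.finsum_addf) (auto simp: proj_sum)
  qed (use that proj_homog submoduleE(5)[OF homog_submodule] in auto)
  show "proj \<Gamma> M g (r \<odot>\<^bsub>M\<^esub> x) = r \<odot>\<^bsub>M\<^esub> proj \<Gamma> M g x" if "r \<in> carrier R" "x \<in> carrier M" for r x
  proof (rule proj_unique[OF _ _ g])
    show "finsum M (\<lambda>g. r \<odot>\<^bsub>M\<^esub> proj \<Gamma> M g x) (carrier \<Gamma>) = r \<odot>\<^bsub>M\<^esub> x"
      using that proj_carrier finite_\<Gamma> by (subst finsum_smult_ldistr[symmetric]) (auto simp: proj_sum)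
  qed (use that proj_homog submoduleE(4)[OF homog_submodule] in auto)
qed

lemma proj_of_homog:
  assumes "h \<in> carrier \<Gamma>" "x \<in> homog M h" "g \<in> carrier \<Gamma>"
  shows "proj \<Gamma> M g x = (if g = h then x else \<zero>\<^bsub>M\<^esub>)"
proof (rule proj_unique[OF _ _ assms(3)])
  have x: "x \<in> carrier M" using homog_carrier assms by blast
  show "finsum M (\<lambda>g. if g = h then x else \<zero>\<^bsub>M\<^esub>) (carrier \<Gamma>) = x"
    using M.add.finprod_singleton_swap[OF assms(1) finite_\<Gamma>, of "\<lambda>_. x"] x by simp
qed (use assms submodule_zero[OF homog_submodule] in auto)

end

text \<open>Existence of a decomposition is the condition that the \<open>p g\<close> add up to the
  identity. Uniqueness holds because applying \<open>p g\<close> to any decomposition annihilates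
  every term except the one of degree \<open>g\<close>, which it returns.\<close>

lemma graded_moduleI_proj:
  assumes "module R M" "group \<Gamma>" "finite (carrier \<Gamma>)"
    and sub: "\<And>g. g \<in> carrier \<Gamma> \<Longrightarrow> submodule (homog M g) R M"
    and lin: "\<And>g. g \<in> carrier \<Gamma> \<Longrightarrow> p g \<in> linmap R M M"
    and img: "\<And>g x. \<lbrakk>g \<in> carrier \<Gamma>; x \<in> carrier M\<rbrakk> \<Longrightarrow> p g x \<in> homog M g"
    and sum: "\<And>x. x \<in> carrier M \<Longrightarrow> finsum M (\<lambda>g. p g x) (carrier \<Gamma>) = x"
    and hom: "\<And>g h x. \<lbrakk>g \<in> carrier \<Gamma>; h \<in> carrier \<Gamma>; x \<in> homog M h\<rbrakk> \<Longrightarrow> p g x = (if g = h then x else \<zero>\<^bsub>M\<^esub>)"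
  shows "graded_module R \<Gamma> M"
proof (intro graded_module.intro graded_module_axioms.intro assms(1-4))
  interpret module R M by fact
  have hc: "x \<in> carrier M" if "g \<in> carrier \<Gamma>" "x \<in> homog M g" for g x
    using submoduleE(1)[OF sub] that by auto
  fix x assume x: "x \<in> carrier M"
  show "\<exists>!f. f \<in> (\<Pi>\<^sub>E g\<in>carrier \<Gamma>. homog M g) \<and> x = finsum M f (carrier \<Gamma>)"
  proof (rule ex1I[of _ "\<lambda>g\<in>carrier \<Gamma>. p g x"])
    have "finsum M (\<lambda>g\<in>carrier \<Gamma>. p g x) (carrier \<Gamma>) = finsum M (\<lambda>g. p g x) (carrier \<Gamma>)"
      by (rule M.finsum_cong') (use img hc x in auto)
    then show "(\<lambda>g\<in>carrier \<Gamma>. p g x) \<in> (\<Pi>\<^sub>E g\<in>carrier \<Gamma>. homog M g) \<and>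
        x = finsum M (\<lambda>g\<in>carrier \<Gamma>. p g x) (carrier \<Gamma>)"
      using img x sum by auto
  next
    fix f assume f: "f \<in> (\<Pi>\<^sub>E g\<in>carrier \<Gamma>. homog M g) \<and> x = finsum M f (carrier \<Gamma>)"
    have fc: "f \<in> carrier \<Gamma> \<rightarrow> carrier M" using f hc by (auto simp: PiE_iff)
    show "f = (\<lambda>g\<in>carrier \<Gamma>. p g x)"
    proof (rule extensionalityI[of _ "carrier \<Gamma>"])
      fix g assume g: "g \<in> carrier \<Gamma>"
      have "p g x = finsum M (\<lambda>h. p g (f h)) (carrier \<Gamma>)"
        using f linmap_finsum[OF assms(1) assms(1) lin[OF g] assms(3) fc] by simp
      also have "\<dots> = finsum M (\<lambda>h. if g = h then f h else \<zero>\<^bsub>M\<^esub>) (carrier \<Gamma>)"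
        by (rule M.finsum_cong') (use f fc g hom in \<open>auto simp: PiE_iff\<close>)
      also have "\<dots> = f g" using M.finsum_singleton[OF g assms(3) fc] by simp
      finally show "f g = (\<lambda>g\<in>carrier \<Gamma>. p g x) g" using g by simp
    qed (use f in \<open>auto simp: PiE_iff\<close>)
  qed
qed

locale tensor_graded = tensor_family R I M
  for R (structure) and I :: "'i set" and M :: "'i \<Rightarrow> ('o, 'g, 'x, 'z) graded_scheme" +
  fixes \<Gamma> :: "'i \<Rightarrow> ('g, 'q) monoid_scheme"
  assumes graded: "i \<in> I \<Longrightarrow> graded_module R (\<Gamma> i) (M i)"
begin

abbreviation "PG \<equiv> product_group I \<Gamma>"

lemma group_PG: "group PG"
  using graded graded_module.axioms(2) by (intro product_group) blast

lemma finite_PG: "finite (carrier PG)"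
  using graded graded_module.finite_\<Gamma> by (auto intro!: finite_PiE finite_I)

lemma homog_gens: "g \<in> carrier PG \<Longrightarrow> pure ` (\<Pi>\<^sub>E i\<in>I. homog (M i) (g i)) \<subseteq> carrier TM"
  using graded graded_module.homog_carrier
  by (auto intro!: pure_closed dest!: PiE_mem intro: graded_module.homog_carrier)

lemma tensor_homog_submodule: "g \<in> carrier PG \<Longrightarrow> submodule (tensor_homog R I M g) R TM"
  unfolding tensor_homog_def by (rule TM.submodule_span_submodule[OF homog_gens])

lemma tensor_homog_carrier: "\<lbrakk>g \<in> carrier PG; T \<in> tensor_homog R I M g\<rbrakk> \<Longrightarrow> T \<in> carrier TM"
  using TM.submoduleE(1)[OF tensor_homog_submodule] by blast

lemma pure_homog:
  assumes "\<And>i. i \<in> I \<Longrightarrow> x i \<in> homog (M i) (g i)"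
  shows "pure x \<in> tensor_homog R I M g"
proof -
  have "pure x = pure (restrict x I)" by (rule pure_cong) simp
  moreover have "restrict x I \<in> (\<Pi>\<^sub>E i\<in>I. homog (M i) (g i))" using assms by auto
  ultimately show ?thesis unfolding tensor_homog_def by (intro TM.submodule_span_incl) auto
qed

lemma homog_induct [consumes 2, case_names pure zero add smult]:
  assumes "T \<in> tensor_homog R I M g" "g \<in> carrier PG"
    and "\<And>x. \<lbrakk>x \<in> XT; \<And>i. i \<in> I \<Longrightarrow> x i \<in> homog (M i) (g i)\<rbrakk> \<Longrightarrow> Q (pure x)"
    and "Q \<zero>\<^bsub>TM\<^esub>"
    and "\<And>T U. \<lbrakk>T \<in> carrier TM; U \<in> carrier TM; Q T; Q U\<rbrakk> \<Longrightarrow> Q (T \<oplus>\<^bsub>TM\<^esub> U)"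
    and "\<And>r T. \<lbrakk>r \<in> carrier R; T \<in> carrier TM; Q T\<rbrakk> \<Longrightarrow> Q (r \<odot>\<^bsub>TM\<^esub> T)"
  shows "Q T"
  using assms(1) homog_gens[OF assms(2)] unfolding tensor_homog_def
proof (induction rule: TM.submodule_span_induct)
  case (gen T)
  then obtain x where x: "x \<in> (\<Pi>\<^sub>E i\<in>I. homog (M i) (g i))" "T = pure x" by auto
  have "x i \<in> carrier (M i)" if "i \<in> I" for i
    using that x(1) assms(2) by (intro graded_module.homog_carrier[OF graded[OF that], of "g i"]) auto
  then show ?case unfolding x(2) using x(1) by (intro assms(3)) (auto simp: PiE_iff)
qed (use assms in auto)

text \<open>The projections are the tensor products of the projections of the factors.
  \<open>Z\<close> is any record with the module fields and components of the tensor module, so that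
  algebras and bimodules are covered together.\<close>

lemma tensor_graded_module:
  assumes Z: "carrier Z = carrier TM" "add Z = add TM" "zero Z = zero TM" "smult Z = smult TM"
    and hZ: "\<And>g. g \<in> carrier PG \<Longrightarrow> homog Z g = tensor_homog R I M g"
  shows "graded_module R PG Z"
proof -
  let ?p = "\<lambda>g. tensor_map1 R I M (\<lambda>i. proj (\<Gamma> i) (M i) (g i))"
  have fam: "tensor_family R I M" by (rule tensor_family_axioms)
  have pl: "proj (\<Gamma> i) (M i) (g i) \<in> linmap R (M i) (M i)" if "i \<in> I" "g \<in> carrier PG" for i g
    using that graded_module.proj_linmap[OF graded[OF that(1)]] by auto
  have lin: "?p g \<in> linmap R TM TM" if "g \<in> carrier PG" for g
    by (rule tensor_map1_linmap[OF fam fam pl[OF _ that]])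
  have pp: "?p g (pure x) = pure (\<lambda>i. proj (\<Gamma> i) (M i) (g i) (x i))" if "g \<in> carrier PG" "x \<in> XT" for g x
    by (rule tensor_map1_pure[OF fam fam pl[OF _ that(1)]]) (use that in auto)
  have img: "?p g T \<in> tensor_homog R I M g" if g: "g \<in> carrier PG" and T: "T \<in> carrier TM" for g T
    using T
  proof (induction rule: carrier_induct)
    case (pure x)
    show ?case unfolding pp[OF g pure]
      using pure g by (intro pure_homog graded_module.proj_homog[OF graded]) auto
  qed (use g TM.submodule_zero[OF tensor_homog_submodule[OF g]] TM.submoduleE(4,5)[OF tensor_homog_submodule[OF g]]
      linmap_zero[OF module_tensor module_tensor lin[OF g]] in
      \<open>simp_all add: linmap_add[OF lin] linmap_smult[OF lin]\<close>)
  have sum: "finsum TM (\<lambda>g. ?p g T) (carrier PG) = T" if T: "T \<in> carrier TM" for T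
    using T
  proof (induction rule: carrier_induct)
    case (pure x)
    have xc: "x i \<in> carrier (M i)" if "i \<in> I" for i using pure that by auto
    \<comment> \<open>Each factor is the sum of its homogeneous components. Expanding the tensor
      gives a sum over choices of one degree per factor, and these choices are the elements of the
      product group.\<close>
    have "finsum TM (\<lambda>g. ?p g (pure x)) (carrier PG) =
        finsum TM (\<lambda>g. pure (\<lambda>i. proj (\<Gamma> i) (M i) (g i) (x i))) (PiE I (\<lambda>i. carrier (\<Gamma> i)))"
    proof (rule TM.M.finsum_cong')
      show "?p g (pure x) = pure (\<lambda>i. proj (\<Gamma> i) (M i) (g i) (x i))" if "g \<in> PiE I (\<lambda>i. carrier (\<Gamma> i))" for g
        by (rule pp) (use that pure in simp_all)
    qed (auto intro!: pure_closed graded_module.proj_carrier[OF graded] xc)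
    also have "\<dots> = pure (\<lambda>i. finsum (M i) (\<lambda>g. proj (\<Gamma> i) (M i) g (x i)) (carrier (\<Gamma> i)))"
      by (rule pure_finsum[symmetric])
        (auto intro: graded_module.finite_\<Gamma>[OF graded] graded_module.proj_carrier[OF graded] xc)
    also have "\<dots> = pure x"
      by (rule pure_cong) (simp add: graded_module.proj_sum[OF graded] xc)
    finally show ?case .
  next
    case zero
    then show ?case
      using linmap_zero[OF module_tensor module_tensor lin] by (intro TM.M.add.finprod_one_eqI) simp
  next
    case (add T U)
    have "finsum TM (\<lambda>g. ?p g (T \<oplus>\<^bsub>TM\<^esub> U)) (carrier PG) = finsum TM (\<lambda>g. ?p g T \<oplus>\<^bsub>TM\<^esub> ?p g U) (carrier PG)"
      by (rule TM.M.finsum_cong') (use add linmap_add[OF lin] linmap_closed[OF lin] in auto)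
    also have "\<dots> = T \<oplus>\<^bsub>TM\<^esub> U"
      using add linmap_closed[OF lin] by (subst TM.M.finsum_addf) auto
    finally show ?case .
  next
    case (smult r T)
    have "finsum TM (\<lambda>g. ?p g (r \<odot>\<^bsub>TM\<^esub> T)) (carrier PG) = finsum TM (\<lambda>g. r \<odot>\<^bsub>TM\<^esub> ?p g T) (carrier PG)"
      by (rule TM.M.finsum_cong') (use smult linmap_smult[OF lin] linmap_closed[OF lin] in auto)
    also have "\<dots> = r \<odot>\<^bsub>TM\<^esub> T"
      using smult linmap_closed[OF lin] finite_PG by (subst TM.finsum_smult_ldistr[symmetric]) auto
    finally show ?case .
  qed
  have hom: "?p g T = (if g = h then T else \<zero>\<^bsub>TM\<^esub>)"
    if g: "g \<in> carrier PG" and h: "h \<in> carrier PG" and T: "T \<in> tensor_homog R I M h" for g h T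
    using T h
  proof (induction rule: homog_induct)
    case (pure x)
    have pr: "proj (\<Gamma> i) (M i) (g i) (x i) = (if g i = h i then x i else \<zero>\<^bsub>M i\<^esub>)" if "i \<in> I" for i
      using that g h pure by (intro graded_module.proj_of_homog[OF graded]) auto
    show ?case
    proof (cases "g = h")
      case True
      then show ?thesis unfolding pp[OF g pure(1)] using pr by (simp cong: pure_cong)
    next
      case False
      \<comment> \<open>Elements of the product group are extensional, so two different ones differ
        at some index in \<open>I\<close>; the factor of the projected tensor at that index is
        zero.\<close>
      then obtain i where i: "i \<in> I" "g i \<noteq> h i" using g h by (auto simp: PiE_iff extensional_def fun_eq_iff) metis
      have "pure (\<lambda>i. proj (\<Gamma> i) (M i) (g i) (x i)) = \<zero>\<^bsub>TM\<^esub>"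
        using i pr pure g by (intro pure_zero[OF _ i(1)] graded_module.proj_carrier[OF graded]) auto
      then show ?thesis using False pp[OF g pure(1)] by simp
    qed
  qed (use g linmap_zero[OF module_tensor module_tensor lin[OF g]] in
      \<open>simp_all add: linmap_add[OF lin] linmap_smult[OF lin]\<close>)
  have fin: "finsum Z f K = finsum TM f K" for f K by (rule finsum_fields_cong[OF Z(1-3)])
  show ?thesis
  proof (rule graded_moduleI_proj[where p = ?p])
    show "module R Z" by (rule module_fields_cong[OF module_tensor Z])
    show "submodule (homog Z g) R Z" if "g \<in> carrier PG" for g
      using tensor_homog_submodule[OF that] by (simp add: hZ[OF that] submodule_fields_cong[OF Z])
    show "?p g \<in> linmap R Z Z" if "g \<in> carrier PG" for g
      using lin[OF that] by (simp add: linmap_def Z)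
  qed (use group_PG finite_PG img sum hom in \<open>auto simp: Z hZ fin simp del: carrier_product_group\<close>)
qed

end

lemma tensor_gradedI:
  assumes "cring R" "finite I" "\<And>i. i \<in> I \<Longrightarrow> graded_module R (\<Gamma> i) (M i)"
  shows "tensor_graded R I M \<Gamma>"
  using assms graded_module.axioms(1)[OF assms(3)]
  by (intro tensor_graded.intro tensor_graded_axioms.intro tensor_family.intro tensor_family_axioms.intro)

text \<open>The two degree families are independent parameters, because the maps in question change
  degrees in different ways: \<open>act\<close> conjugates them, \<open>str\<close> keeps them,
  functionals multiply them on the right, and the maps \<open>p\<close> of the Morita data multiply
  them on the left.\<close>

lemma tensor_map1_homog:
  assumes "tensor_graded R I M \<Gamma>" "tensor_graded R I N \<Delta>"
    and f: "\<And>i. i \<in> I \<Longrightarrow> f i \<in> linmap R (M i) (N i)"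
    and h: "\<And>i x. \<lbrakk>i \<in> I; x \<in> homog (M i) (g i)\<rbrakk> \<Longrightarrow> f i x \<in> homog (N i) (h i)"
    and gh: "g \<in> carrier (product_group I \<Gamma>)" "h \<in> carrier (product_group I \<Delta>)"
    and T: "T \<in> tensor_homog R I M g"
  shows "tensor_map1 R I N f T \<in> tensor_homog R I N h"
proof -
  interpret M: tensor_graded R I M \<Gamma> by fact
  interpret N: tensor_graded R I N \<Delta> by fact
  note lin = tensor_map1_linmap[OF M.tensor_family_axioms N.tensor_family_axioms f]
  note sub = N.tensor_homog_submodule[OF gh(2)]
  show ?thesis using T gh(1)
  proof (induction rule: M.homog_induct)
    case (pure x)
    have "tensor_map1 R I N f (M.pure x) = N.pure (\<lambda>i. f i (x i))"
      by (rule tensor_map1_pure[OF M.tensor_family_axioms N.tensor_family_axioms f]) (use pure in auto)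
    then show ?case using pure h by (auto intro: N.pure_homog)
  qed (simp_all add: linmap_zero[OF M.module_tensor N.module_tensor lin] linmap_add[OF lin] linmap_smult[OF lin]
      N.TM.submodule_zero[OF sub] N.TM.submoduleE(4,5)[OF sub])
qed

lemma tensor_map2_homog:
  assumes "tensor_graded R I M \<Gamma>" "tensor_graded R I N \<Delta>" "tensor_graded R I P \<Theta>"
    and \<beta>: "\<And>i. i \<in> I \<Longrightarrow> bilin R (M i) (N i) (P i) (\<beta> i)"
    and h: "\<And>i x y. \<lbrakk>i \<in> I; x \<in> homog (M i) (g i); y \<in> homog (N i) (h i)\<rbrakk> \<Longrightarrow> \<beta> i x y \<in> homog (P i) (k i)"
    and gh: "g \<in> carrier (product_group I \<Gamma>)" "h \<in> carrier (product_group I \<Delta>)" "k \<in> carrier (product_group I \<Theta>)"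
    and S: "S \<in> tensor_homog R I M g" and T: "T \<in> tensor_homog R I N h"
  shows "tensor_map2 R I P \<beta> S T \<in> tensor_homog R I P k"
proof -
  interpret M: tensor_graded R I M \<Gamma> by fact
  interpret N: tensor_graded R I N \<Delta> by fact
  interpret P: tensor_graded R I P \<Theta> by fact
  note fams = M.tensor_family_axioms N.tensor_family_axioms P.tensor_family_axioms
  note bil = tensor_map2_bilin[OF fams \<beta>]
  note sub = P.tensor_homog_submodule[OF gh(3)]
  note simps = bilin_zero[OF bil M.module_tensor N.module_tensor P.module_tensor] bilin_simps[OF bil]
    P.TM.submodule_zero[OF sub] P.TM.submoduleE(4,5)[OF sub]
  have Tc: "T \<in> carrier N.TM" using N.tensor_homog_carrier[OF gh(2) T] .
  show ?thesis using S gh(1)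
  proof (induction rule: M.homog_induct)
    case (pure x)
    have xc: "M.pure x \<in> carrier M.TM" using pure by (auto intro: M.pure_closed)
    show ?case using T gh(2)
    proof (induction rule: N.homog_induct)
      case (pure y)
      have "tensor_map2 R I P \<beta> (M.pure x) (N.pure y) = P.pure (\<lambda>i. \<beta> i (x i) (y i))"
        by (rule tensor_map2_pure[OF fams \<beta>]) (use \<open>x \<in> M.XT\<close> pure in auto)
      then show ?case using pure h \<open>\<And>i. i \<in> I \<Longrightarrow> x i \<in> homog (M i) (g i)\<close> by (auto intro: P.pure_homog)
    qed (simp_all add: xc simps)
  qed (simp_all add: Tc simps)
qed

section \<open>Tensor products of algebras\<close>

lemma tensor_mult_map2: "tensor_mult R I A = tensor_map2 R I A (\<lambda>i. mult (A i))"
  by (simp add: tensor_mult_def tensor_map2_def tensor_map1_def fun_eq_iff)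

text \<open>Every multiplication, action and structure map of the three tensor records is an
  instance of \<open>tensor_map1\<close> or \<open>tensor_map2\<close>. As simplification rules,
  these equations reduce questions on the records to questions on those two operations.\<close>

lemma tensor_acted_fields [simp]:
  "carrier (tensor_acted R I C) = carrier (tensor_module R I C)"
  "add (tensor_acted R I C) = add (tensor_module R I C)"
  "zero (tensor_acted R I C) = zero (tensor_module R I C)"
  "smult (tensor_acted R I C) = smult (tensor_module R I C)"
  "mult (tensor_acted R I C) = tensor_map2 R I C (\<lambda>i. mult (C i))"
  "one (tensor_acted R I C) = pure_tensor R I C (\<lambda>i. \<one>\<^bsub>C i\<^esub>)"
  "homog (tensor_acted R I C) = tensor_homog R I C"
  "act (tensor_acted R I C) = (\<lambda>g. tensor_map1 R I C (\<lambda>i. act (C i) (g i)))"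
  by (simp_all add: tensor_acted_def Let_def tensor_mult_map2 tensor_map1_def fun_eq_iff)

lemma tensor_crossed_fields [simp]:
  "carrier (tensor_crossed R I A) = carrier (tensor_module R I A)"
  "add (tensor_crossed R I A) = add (tensor_module R I A)"
  "zero (tensor_crossed R I A) = zero (tensor_module R I A)"
  "smult (tensor_crossed R I A) = smult (tensor_module R I A)"
  "mult (tensor_crossed R I A) = tensor_map2 R I A (\<lambda>i. mult (A i))"
  "one (tensor_crossed R I A) = pure_tensor R I A (\<lambda>i. \<one>\<^bsub>A i\<^esub>)"
  "homog (tensor_crossed R I A) = tensor_homog R I A"
  "str (tensor_crossed R I A) = tensor_map1 R I A (\<lambda>i. str (A i))"
  by (simp_all add: tensor_crossed_def Let_def tensor_mult_map2 tensor_map1_def fun_eq_iff)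

lemma tensor_bimod_fields [simp]:
  "carrier (tensor_bimod R I M) = carrier (tensor_module R I M)"
  "add (tensor_bimod R I M) = add (tensor_module R I M)"
  "zero (tensor_bimod R I M) = zero (tensor_module R I M)"
  "smult (tensor_bimod R I M) = smult (tensor_module R I M)"
  "homog (tensor_bimod R I M) = tensor_homog R I M"
  "lact (tensor_bimod R I M) = tensor_map2 R I M (\<lambda>i. lact (M i))"
  "ract (tensor_bimod R I M) = tensor_map2 R I M (\<lambda>i. ract (M i))"
  by (simp_all add: tensor_bimod_def Let_def tensor_map2_def tensor_map1_def fun_eq_iff)

lemma (in assoc_algebra) mult_bilin: "bilin R M M M (mult M)"
  by (rule bilinI) (simp_all add: l_distr r_distr smult_mult_left smult_mult_right)

lemma assoc_algebraI:
  assumes "module R A" "bilin R A A A (mult A)" "\<one>\<^bsub>A\<^esub> \<in> carrier A"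
    and "\<And>x y z. \<lbrakk>x \<in> carrier A; y \<in> carrier A; z \<in> carrier A\<rbrakk> \<Longrightarrow>
      (x \<otimes>\<^bsub>A\<^esub> y) \<otimes>\<^bsub>A\<^esub> z = x \<otimes>\<^bsub>A\<^esub> (y \<otimes>\<^bsub>A\<^esub> z)"
    and "\<And>x. x \<in> carrier A \<Longrightarrow> \<one>\<^bsub>A\<^esub> \<otimes>\<^bsub>A\<^esub> x = x" "\<And>x. x \<in> carrier A \<Longrightarrow> x \<otimes>\<^bsub>A\<^esub> \<one>\<^bsub>A\<^esub> = x"
  shows "assoc_algebra R A"
proof -
  interpret module R A by fact
  note b = bilin_simps[OF assms(2)]
  have "ring A"
    by (rule ringI) (auto intro: M.abelian_group_axioms monoidI simp: assms b)
  then show ?thesis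
    using assms(1) b by (intro assoc_algebra.intro assoc_algebra_axioms.intro) auto
qed

text \<open>Four unrelated pairings are allowed so that one law covers associativity of
  multiplication, the module axioms for the left and the right action, and the compatibility of
  these two actions.\<close>

lemma tensor_map2_assoc:
  assumes fams: "tensor_family R I M" "tensor_family R I N" "tensor_family R I P"
      "tensor_family R I MN" "tensor_family R I NP" "tensor_family R I Q"
    and \<alpha>: "\<And>i. i \<in> I \<Longrightarrow> bilin R (M i) (N i) (MN i) (\<alpha> i)"
    and \<beta>: "\<And>i. i \<in> I \<Longrightarrow> bilin R (MN i) (P i) (Q i) (\<beta> i)"
    and \<gamma>: "\<And>i. i \<in> I \<Longrightarrow> bilin R (N i) (P i) (NP i) (\<gamma> i)"
    and \<delta>: "\<And>i. i \<in> I \<Longrightarrow> bilin R (M i) (NP i) (Q i) (\<delta> i)"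
    and eq: "\<And>i m n p. \<lbrakk>i \<in> I; m \<in> carrier (M i); n \<in> carrier (N i); p \<in> carrier (P i)\<rbrakk> \<Longrightarrow>
      \<beta> i (\<alpha> i m n) p = \<delta> i m (\<gamma> i n p)"
    and S: "S \<in> carrier (tensor_module R I M)" and T: "T \<in> carrier (tensor_module R I N)"
    and U: "U \<in> carrier (tensor_module R I P)"
  shows "tensor_map2 R I Q \<beta> (tensor_map2 R I MN \<alpha> S T) U = tensor_map2 R I Q \<delta> S (tensor_map2 R I NP \<gamma> T U)"
proof -
  interpret M: tensor_family R I M by fact
  interpret N: tensor_family R I N by fact
  interpret P: tensor_family R I P by fact
  interpret MN: tensor_family R I MN by fact
  interpret NP: tensor_family R I NP by fact
  interpret Q: tensor_family R I Q by fact
  note a = tensor_map2_bilin[OF fams(1,2,4) \<alpha>] and b = tensor_map2_bilin[OF fams(4,3,6) \<beta>]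
    and c = tensor_map2_bilin[OF fams(2,3,5) \<gamma>] and d = tensor_map2_bilin[OF fams(1,5,6) \<delta>]
  note simps = bilin_simps[OF a] bilin_simps[OF b] bilin_simps[OF c] bilin_simps[OF d]
    bilin_zero[OF a M.module_tensor N.module_tensor MN.module_tensor]
    bilin_zero[OF b MN.module_tensor P.module_tensor Q.module_tensor]
    bilin_zero[OF c N.module_tensor P.module_tensor NP.module_tensor]
    bilin_zero[OF d M.module_tensor NP.module_tensor Q.module_tensor]
  show ?thesis using S
  proof (induction rule: M.carrier_induct)
    case (pure x)
    have x: "M.pure x \<in> carrier M.TM" using pure by (auto intro: M.pure_closed)
    show ?case using T
    proof (induction rule: N.carrier_induct)
      case (pure y)
      have y: "N.pure y \<in> carrier N.TM" using pure by (auto intro: N.pure_closed)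
      show ?case using U
      proof (induction rule: P.carrier_induct)
        case (pure z)
        have el: "i \<in> I \<Longrightarrow> x i \<in> carrier (M i)" "i \<in> I \<Longrightarrow> y i \<in> carrier (N i)"
          "i \<in> I \<Longrightarrow> z i \<in> carrier (P i)" for i
          using \<open>x \<in> M.XT\<close> \<open>y \<in> N.XT\<close> \<open>z \<in> P.XT\<close> by auto
        have "tensor_map2 R I MN \<alpha> (M.pure x) (N.pure y) = MN.pure (\<lambda>i. \<alpha> i (x i) (y i))"
          by (rule tensor_map2_pure[OF fams(1,2,4) \<alpha> el(1,2)])
        moreover have "tensor_map2 R I NP \<gamma> (N.pure y) (P.pure z) = NP.pure (\<lambda>i. \<gamma> i (y i) (z i))"
          by (rule tensor_map2_pure[OF fams(2,3,5) \<gamma> el(2,3)])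
        moreover have "tensor_map2 R I Q \<beta> (MN.pure (\<lambda>i. \<alpha> i (x i) (y i))) (P.pure z) =
            Q.pure (\<lambda>i. \<beta> i (\<alpha> i (x i) (y i)) (z i))"
          by (rule tensor_map2_pure[OF fams(4,3,6) \<beta>]) (use el bilin_closed[OF \<alpha>] in auto)
        moreover have "tensor_map2 R I Q \<delta> (M.pure x) (NP.pure (\<lambda>i. \<gamma> i (y i) (z i))) =
            Q.pure (\<lambda>i. \<delta> i (x i) (\<gamma> i (y i) (z i)))"
          by (rule tensor_map2_pure[OF fams(1,5,6) \<delta>]) (use el bilin_closed[OF \<gamma>] in auto)
        moreover have "Q.pure (\<lambda>i. \<beta> i (\<alpha> i (x i) (y i)) (z i)) = Q.pure (\<lambda>i. \<delta> i (x i) (\<gamma> i (y i) (z i)))"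
          by (rule Q.pure_cong) (simp add: eq el)
        ultimately show ?case by simp
      qed (simp_all add: x y simps)
    qed (simp_all add: x U simps)
  qed (simp_all add: T U simps)
qed

text \<open>Supplies multiplicativity of \<open>act\<close> and of \<open>str\<close> on tensor
  products. Both sides are bilinear in \<open>S\<close> and \<open>T\<close>, so two inductions
  leave only pure tensors.\<close>

lemma tensor_map1_mult:
  assumes fams: "tensor_family R I A" "tensor_family R I B"
    and f: "\<And>i. i \<in> I \<Longrightarrow> f i \<in> linmap R (A i) (B i)"
    and A: "\<And>i. i \<in> I \<Longrightarrow> bilin R (A i) (A i) (A i) (\<alpha> i)"
    and B: "\<And>i. i \<in> I \<Longrightarrow> bilin R (B i) (B i) (B i) (\<beta> i)"
    and eq: "\<And>i x y. \<lbrakk>i \<in> I; x \<in> carrier (A i); y \<in> carrier (A i)\<rbrakk> \<Longrightarrow> f i (\<alpha> i x y) = \<beta> i (f i x) (f i y)"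
    and S: "S \<in> carrier (tensor_module R I A)" and T: "T \<in> carrier (tensor_module R I A)"
  shows "tensor_map1 R I B f (tensor_map2 R I A \<alpha> S T) =
    tensor_map2 R I B \<beta> (tensor_map1 R I B f S) (tensor_map1 R I B f T)"
proof -
  interpret A: tensor_family R I A by fact
  interpret B: tensor_family R I B by fact
  note a = tensor_map2_bilin[OF fams(1,1,1) A] and b = tensor_map2_bilin[OF fams(2,2,2) B]
  note lin = tensor_map1_linmap[OF fams f]
  note simps = bilin_simps[OF a] bilin_simps[OF b]
    bilin_zero[OF a A.module_tensor A.module_tensor A.module_tensor]
    bilin_zero[OF b B.module_tensor B.module_tensor B.module_tensor]
    linmap_zero[OF A.module_tensor B.module_tensor lin] linmap_closed[OF lin] linmap_add[OF lin] linmap_smult[OF lin]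
  show ?thesis using S
  proof (induction rule: A.carrier_induct)
    case (pure x)
    have x: "A.pure x \<in> carrier A.TM" using pure by (auto intro: A.pure_closed)
    show ?case using T
    proof (induction rule: A.carrier_induct)
      case (pure y)
      have el: "i \<in> I \<Longrightarrow> x i \<in> carrier (A i)" "i \<in> I \<Longrightarrow> y i \<in> carrier (A i)" for i
        using \<open>x \<in> A.XT\<close> \<open>y \<in> A.XT\<close> by auto
      have "tensor_map2 R I A \<alpha> (A.pure x) (A.pure y) = A.pure (\<lambda>i. \<alpha> i (x i) (y i))"
        by (rule tensor_map2_pure[OF fams(1,1,1) A el])
      moreover have "tensor_map1 R I B f (A.pure (\<lambda>i. \<alpha> i (x i) (y i))) = B.pure (\<lambda>i. f i (\<alpha> i (x i) (y i)))"
        by (rule tensor_map1_pure[OF fams f]) (use el bilin_closed[OF A] in auto)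
      moreover have "tensor_map1 R I B f (A.pure x) = B.pure (\<lambda>i. f i (x i))"
        "tensor_map1 R I B f (A.pure y) = B.pure (\<lambda>i. f i (y i))"
        by (rule tensor_map1_pure[OF fams f]; simp add: el)+
      moreover have "tensor_map2 R I B \<beta> (B.pure (\<lambda>i. f i (x i))) (B.pure (\<lambda>i. f i (y i))) =
          B.pure (\<lambda>i. \<beta> i (f i (x i)) (f i (y i)))"
        by (rule tensor_map2_pure[OF fams(2,2,2) B]) (use el linmap_closed[OF f] in auto)
      moreover have "B.pure (\<lambda>i. f i (\<alpha> i (x i) (y i))) = B.pure (\<lambda>i. \<beta> i (f i (x i)) (f i (y i)))"
        by (rule B.pure_cong) (simp add: eq el)
      ultimately show ?case by simp
    qed (simp_all add: x simps)
  qed (simp_all add: T simps)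
qed

text \<open>Used with \<open>e\<close> the family of units: it yields the left unit law of the
  algebra and the one of the left action.\<close>

lemma tensor_map2_fixed_left:
  assumes fams: "tensor_family R I A" "tensor_family R I M"
    and \<beta>: "\<And>i. i \<in> I \<Longrightarrow> bilin R (A i) (M i) (M i) (\<beta> i)"
    and e: "\<And>i. i \<in> I \<Longrightarrow> e i \<in> carrier (A i)"
    and eq: "\<And>i x. \<lbrakk>i \<in> I; x \<in> carrier (M i)\<rbrakk> \<Longrightarrow> \<beta> i (e i) x = x"
    and T: "T \<in> carrier (tensor_module R I M)"
  shows "tensor_map2 R I M \<beta> (pure_tensor R I A e) T = T"
proof -
  interpret A: tensor_family R I A by fact
  interpret M: tensor_family R I M by fact
  note b = tensor_map2_bilin[OF fams(1,2,2) \<beta>]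
  note pe = A.pure_closed[OF e]
  show ?thesis using T
  proof (induction rule: M.carrier_induct)
    case (pure y)
    have "tensor_map2 R I M \<beta> (A.pure e) (M.pure y) = M.pure (\<lambda>i. \<beta> i (e i) (y i))"
      by (rule tensor_map2_pure[OF fams(1,2,2) \<beta>]) (use e pure in auto)
    also have "\<dots> = M.pure y" by (rule M.pure_cong) (use eq pure in auto)
    finally show ?case .
  qed (simp_all add: pe bilin_simps[OF b] bilin_zero[OF b A.module_tensor M.module_tensor M.module_tensor])
qed

lemma tensor_map2_fixed_right:
  assumes fams: "tensor_family R I M" "tensor_family R I A"
    and \<beta>: "\<And>i. i \<in> I \<Longrightarrow> bilin R (M i) (A i) (M i) (\<beta> i)"
    and e: "\<And>i. i \<in> I \<Longrightarrow> e i \<in> carrier (A i)"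
    and eq: "\<And>i x. \<lbrakk>i \<in> I; x \<in> carrier (M i)\<rbrakk> \<Longrightarrow> \<beta> i x (e i) = x"
    and T: "T \<in> carrier (tensor_module R I M)"
  shows "tensor_map2 R I M \<beta> T (pure_tensor R I A e) = T"
proof -
  interpret A: tensor_family R I A by fact
  interpret M: tensor_family R I M by fact
  note b = tensor_map2_bilin[OF fams(1,2,1) \<beta>]
  note pe = A.pure_closed[OF e]
  show ?thesis using T
  proof (induction rule: M.carrier_induct)
    case (pure y)
    have "tensor_map2 R I M \<beta> (M.pure y) (A.pure e) = M.pure (\<lambda>i. \<beta> i (y i) (e i))"
      by (rule tensor_map2_pure[OF fams(1,2,1) \<beta>]) (use e pure in auto)
    also have "\<dots> = M.pure y" by (rule M.pure_cong) (use eq pure in auto)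
    finally show ?case .
  qed (simp_all add: pe bilin_simps[OF b] bilin_zero[OF b M.module_tensor A.module_tensor M.module_tensor])
qed

lemma bilin_fields_cong:
  assumes "carrier M' = carrier M" "add M' = add M" "smult M' = smult M"
    "carrier N' = carrier N" "add N' = add N" "smult N' = smult N"
    "carrier P' = carrier P" "add P' = add P" "smult P' = smult P"
  shows "bilin R M' N' P' \<beta> \<longleftrightarrow> bilin R M N P \<beta>"
  by (simp add: bilin_def linmap_def assms)

lemma tensor_assoc_algebra:
  assumes fam: "tensor_family R I A" and alg: "\<And>i. i \<in> I \<Longrightarrow> assoc_algebra R (A i)"
    and Z: "carrier Z = carrier (tensor_module R I A)" "add Z = add (tensor_module R I A)"
      "zero Z = zero (tensor_module R I A)" "smult Z = smult (tensor_module R I A)"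
    and mZ: "mult Z = tensor_map2 R I A (\<lambda>i. mult (A i))" and oZ: "one Z = pure_tensor R I A (\<lambda>i. \<one>\<^bsub>A i\<^esub>)"
  shows "assoc_algebra R Z"
proof -
  interpret A: tensor_family R I A by fact
  note bil = assoc_algebra.mult_bilin[OF alg]
  have ring: "ring (A i)" if "i \<in> I" for i using assoc_algebra.axioms(2)[OF alg[OF that]] .
  have one: "\<one>\<^bsub>A i\<^esub> \<in> carrier (A i)" if "i \<in> I" for i using ring.ring_simprules(6)[OF ring[OF that]] .
  show ?thesis
  proof (rule assoc_algebraI)
    show "module R Z" by (rule module_fields_cong[OF A.module_tensor Z])
    show "bilin R Z Z Z (mult Z)"
      using tensor_map2_bilin[OF fam fam fam bil] by (simp add: mZ bilin_fields_cong[OF Z(1,2,4) Z(1,2,4) Z(1,2,4)])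
    show "\<one>\<^bsub>Z\<^esub> \<in> carrier Z" by (simp add: Z oZ A.pure_closed one)
    show "(x \<otimes>\<^bsub>Z\<^esub> y) \<otimes>\<^bsub>Z\<^esub> z = x \<otimes>\<^bsub>Z\<^esub> (y \<otimes>\<^bsub>Z\<^esub> z)"
      if "x \<in> carrier Z" "y \<in> carrier Z" "z \<in> carrier Z" for x y z
      unfolding mZ using that
      by (intro tensor_map2_assoc[OF fam fam fam fam fam fam bil bil bil bil]) (auto simp: Z ring.ring_simprules(11)[OF ring])
    show "\<one>\<^bsub>Z\<^esub> \<otimes>\<^bsub>Z\<^esub> x = x" if "x \<in> carrier Z" for x
      unfolding mZ oZ using that
      by (intro tensor_map2_fixed_left[OF fam fam bil]) (auto simp: Z one ring.ring_simprules(12)[OF ring])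
    show "x \<otimes>\<^bsub>Z\<^esub> \<one>\<^bsub>Z\<^esub> = x" if "x \<in> carrier Z" for x
      unfolding mZ oZ using that
      by (intro tensor_map2_fixed_right[OF fam fam bil]) (auto simp: Z one monoid.r_one[OF ring.is_monoid[OF ring]])
  qed
qed

lemma tensor_graded_algebra:
  assumes R: "cring R" "finite I" and alg: "\<And>i. i \<in> I \<Longrightarrow> graded_algebra R (\<Gamma> i) (A i)"
    and Z: "carrier Z = carrier (tensor_module R I A)" "add Z = add (tensor_module R I A)"
      "zero Z = zero (tensor_module R I A)" "smult Z = smult (tensor_module R I A)"
    and mZ: "mult Z = tensor_map2 R I A (\<lambda>i. mult (A i))" and oZ: "one Z = pure_tensor R I A (\<lambda>i. \<one>\<^bsub>A i\<^esub>)"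
    and hZ: "homog Z = tensor_homog R I A"
  shows "graded_algebra R (product_group I \<Gamma>) Z"
proof -
  have gr: "graded_module R (\<Gamma> i) (A i)" and al: "assoc_algebra R (A i)" if "i \<in> I" for i
    using graded_algebra.axioms[OF alg[OF that]] by auto
  have A: "tensor_graded R I A \<Gamma>"
    by (rule tensor_gradedI[OF R gr])
  then interpret A: tensor_graded R I A \<Gamma> .
  show ?thesis
  proof (intro graded_algebra.intro graded_algebra_axioms.intro)
    show "graded_module R (product_group I \<Gamma>) Z" by (rule A.tensor_graded_module[OF Z]) (simp add: hZ)
    show "assoc_algebra R Z" by (rule tensor_assoc_algebra[OF A.tensor_family_axioms al Z mZ oZ])
    show "a \<otimes>\<^bsub>Z\<^esub> b \<in> homog Z (g \<otimes>\<^bsub>product_group I \<Gamma>\<^esub> h)"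
      if "g \<in> carrier (product_group I \<Gamma>)" "h \<in> carrier (product_group I \<Gamma>)" "a \<in> homog Z g" "b \<in> homog Z h"
      for g h a b
      unfolding mZ hZ
    proof (rule tensor_map2_homog[OF A A A assoc_algebra.mult_bilin[OF al] _ that(1,2)])
      show "g \<otimes>\<^bsub>product_group I \<Gamma>\<^esub> h \<in> carrier (product_group I \<Gamma>)"
        using that A.group_PG by (intro monoid.m_closed group.is_monoid)
    qed (use that in \<open>auto simp: hZ intro!: graded_algebra.homog_mult[OF alg]\<close>)
  qed
qed

lemma algebra_hom_linmap: "h \<in> algebra_hom R A B \<Longrightarrow> h \<in> linmap R A B"
  by (auto simp: algebra_hom_def ring_hom_def linmap_def)

text \<open>The axioms are linear in each algebra element, so pure tensors decide, and on these the
  group acts coordinatewise. Degrees behave in the same way: conjugation in the product group is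
  conjugation in every coordinate.\<close>

lemma tensor_graded_acted_algebra:
  assumes R: "cring R" "finite I" and C: "\<And>i. i \<in> I \<Longrightarrow> graded_acted_algebra R (\<Gamma> i) (C i)"
  shows "graded_acted_algebra R (product_group I \<Gamma>) (tensor_acted R I C)"
proof -
  let ?Z = "tensor_acted R I C" and ?P = "product_group I \<Gamma>"
  have alg: "graded_algebra R (\<Gamma> i) (C i)" if "i \<in> I" for i
    using graded_acted_algebra.axioms(1)[OF C[OF that]] .
  have gr: "graded_module R (\<Gamma> i) (C i)" and al: "assoc_algebra R (C i)" if "i \<in> I" for i
    using graded_algebra.axioms[OF alg[OF that]] by auto
  have Ct: "tensor_graded R I C \<Gamma>"
    by (rule tensor_gradedI[OF R gr])
  then interpret C: tensor_graded R I C \<Gamma> .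
  note fam = C.tensor_family_axioms
  interpret P: group ?P by (rule C.group_PG)
  note bil = assoc_algebra.mult_bilin[OF al]
  have ah: "act (C i) (g i) \<in> algebra_hom R (C i) (C i)" if "i \<in> I" "g \<in> carrier ?P" for i g
    using that by (intro graded_acted_algebra.act_hom[OF C]) auto
  have lin: "tensor_map1 R I C (\<lambda>i. act (C i) (g i)) \<in> linmap R C.TM C.TM" if "g \<in> carrier ?P" for g
    by (rule tensor_map1_linmap[OF fam fam algebra_hom_linmap[OF ah[OF _ that]]])
  have pa: "act ?Z g (C.pure x) = C.pure (\<lambda>i. act (C i) (g i) (x i))"
    if "g \<in> carrier ?P" "\<And>i. i \<in> I \<Longrightarrow> x i \<in> carrier (C i)" for g x
    using tensor_map1_pure[OF fam fam algebra_hom_linmap[OF ah[OF _ that(1)]] that(2)] by simp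
  have one: "\<one>\<^bsub>C i\<^esub> \<in> carrier (C i)" if "i \<in> I" for i
    using ring.ring_simprules(6)[OF assoc_algebra.axioms(2)[OF al[OF that]]] .
  show ?thesis
  proof (intro graded_acted_algebra.intro graded_acted_algebra_axioms.intro)
    show "graded_algebra R ?P ?Z" by (rule tensor_graded_algebra[OF R alg]) simp_all
    show "act ?Z g \<in> algebra_hom R ?Z ?Z" if g: "g \<in> carrier ?P" for g
    proof -
      have "act ?Z g (C.pure (\<lambda>i. \<one>\<^bsub>C i\<^esub>)) = C.pure (\<lambda>i. act (C i) (g i) \<one>\<^bsub>C i\<^esub>)"
        by (rule pa[OF g one])
      also have "\<dots> = C.pure (\<lambda>i. \<one>\<^bsub>C i\<^esub>)"
        by (rule C.pure_cong) (use ah g in \<open>auto simp: algebra_hom_def ring_hom_def\<close>)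
      finally have o: "act ?Z g \<one>\<^bsub>?Z\<^esub> = \<one>\<^bsub>?Z\<^esub>" by simp
      have m: "act ?Z g (S \<otimes>\<^bsub>?Z\<^esub> T) = act ?Z g S \<otimes>\<^bsub>?Z\<^esub> act ?Z g T"
        if "S \<in> carrier ?Z" "T \<in> carrier ?Z" for S T
        using that ah[OF _ g]
        by (simp, intro tensor_map1_mult[OF fam fam algebra_hom_linmap[OF ah] bil bil])
          (auto simp: algebra_hom_def ring_hom_def g simp del: carrier_product_group)
      show ?thesis
        using o m linmap_closed[OF lin[OF g]] linmap_add[OF lin[OF g]] linmap_smult[OF lin[OF g]]
        by (auto simp: algebra_hom_def ring_hom_def simp del: carrier_product_group)
    qed
    show "act ?Z \<one>\<^bsub>?P\<^esub> c = c" if "c \<in> carrier ?Z" for c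
    proof -
      have "c \<in> carrier C.TM" using that by simp
      then show ?thesis
      proof (induction rule: C.carrier_induct)
        case (pure x)
        have xc: "x i \<in> carrier (C i)" if "i \<in> I" for i using pure that by auto
        have "act ?Z \<one>\<^bsub>?P\<^esub> (C.pure x) = C.pure (\<lambda>i. act (C i) (\<one>\<^bsub>?P\<^esub> i) (x i))" by (rule pa[OF P.one_closed xc])
        also have "\<dots> = C.pure x"
          by (rule C.pure_cong) (use pure in \<open>auto intro!: graded_acted_algebra.act_one[OF C]\<close>)
        finally show ?case .
      qed (use linmap_zero[OF C.module_tensor C.module_tensor lin] linmap_add[OF lin] linmap_smult[OF lin] P.one_closed in
          \<open>simp_all del: carrier_product_group one_product_group\<close>)
    qed
    show "act ?Z (g \<otimes>\<^bsub>?P\<^esub> h) c = act ?Z g (act ?Z h c)"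
      if "g \<in> carrier ?P" "h \<in> carrier ?P" "c \<in> carrier ?Z" for g h c
    proof -
      note gh = P.m_closed[OF that(1,2)]
      have "c \<in> carrier C.TM" using that by simp
      then show ?thesis
      proof (induction rule: C.carrier_induct)
        case (pure x)
        have xc: "x i \<in> carrier (C i)" if "i \<in> I" for i using pure that by auto
        have hx: "act (C i) (h i) (x i) \<in> carrier (C i)" if "i \<in> I" for i
          using linmap_closed[OF algebra_hom_linmap[OF ah]] xc that \<open>h \<in> carrier ?P\<close> by blast
        have "act ?Z (g \<otimes>\<^bsub>?P\<^esub> h) (C.pure x) = C.pure (\<lambda>i. act (C i) ((g \<otimes>\<^bsub>?P\<^esub> h) i) (x i))"
          by (rule pa[OF gh xc])
        also have "\<dots> = C.pure (\<lambda>i. act (C i) (g i) (act (C i) (h i) (x i)))"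
          by (rule C.pure_cong) (use pure that in \<open>auto intro!: graded_acted_algebra.act_mult[OF C]\<close>)
        also have "\<dots> = act ?Z g (act ?Z h (C.pure x))"
          using pa[OF that(2) xc] pa[OF that(1) hx] by simp
        finally show ?case .
      qed (use gh that linmap_zero[OF C.module_tensor C.module_tensor lin] linmap_add[OF lin] linmap_smult[OF lin]
          linmap_closed[OF lin] in \<open>simp_all del: carrier_product_group mult_product_group\<close>)
    qed
    show "act ?Z g c \<in> homog ?Z (g \<otimes>\<^bsub>?P\<^esub> h \<otimes>\<^bsub>?P\<^esub> inv\<^bsub>?P\<^esub> g)"
      if "g \<in> carrier ?P" "h \<in> carrier ?P" "c \<in> homog ?Z h" for g h c
    proof -
      have grp: "group (\<Gamma> i)" if "i \<in> I" for i using graded_module.axioms(2)[OF gr[OF that]] .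
      have "inv\<^bsub>?P\<^esub> g = (\<lambda>i\<in>I. inv\<^bsub>\<Gamma> i\<^esub> g i)"
        using that(1) by (intro inv_product_group grp) auto
      moreover have gh: "g i \<in> carrier (\<Gamma> i)" "h i \<in> carrier (\<Gamma> i)" if "i \<in> I" for i
        using that \<open>g \<in> carrier ?P\<close> \<open>h \<in> carrier ?P\<close> by auto
      moreover have "g \<otimes>\<^bsub>?P\<^esub> h \<otimes>\<^bsub>?P\<^esub> inv\<^bsub>?P\<^esub> g \<in> carrier ?P" using that by (intro P.m_closed P.inv_closed)
      ultimately have "tensor_map1 R I C (\<lambda>i. act (C i) (g i)) c \<in> tensor_homog R I C (g \<otimes>\<^bsub>?P\<^esub> h \<otimes>\<^bsub>?P\<^esub> inv\<^bsub>?P\<^esub> g)"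
        using that graded_acted_algebra.act_homog[OF C gh]
        by (intro tensor_map1_homog[OF Ct Ct algebra_hom_linmap[OF ah[OF _ that(1)]] _ that(2)]) simp_all
      then show ?thesis by simp
    qed
  qed
qed

section \<open>Crossed products over a graded acted algebra\<close>

text \<open>Compare the units \<open>u\<close>, \<open>v\<close> through a unit of degree \<open>g\<inverse>\<close>; the inverses of \<open>u\<close>, \<open>v\<close> need not be
  known to be homogeneous.\<close>

lemma (in crossed_product) unit_commute_transfer:
  assumes "g \<in> carrier \<Gamma>" "u \<in> homog A g" "v \<in> homog A g" "x \<in> carrier A" "y \<in> carrier A"
    and cx: "\<And>b. b \<in> homog A \<one>\<^bsub>\<Gamma>\<^esub> \<Longrightarrow> x \<otimes>\<^bsub>A\<^esub> b = b \<otimes>\<^bsub>A\<^esub> x"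
    and u: "u \<in> Units A" and ux: "u \<otimes>\<^bsub>A\<^esub> x = y \<otimes>\<^bsub>A\<^esub> u"
  shows "v \<otimes>\<^bsub>A\<^esub> x = y \<otimes>\<^bsub>A\<^esub> v"
proof -
  have rA: "ring A" using assoc_algebra_axioms by (rule assoc_algebra.axioms(2))
  note mon = ring.is_monoid[OF rA]
  have gi: "inv\<^bsub>\<Gamma>\<^esub> g \<in> carrier \<Gamma>" using assms(1) by simp
  obtain w where w: "w \<in> homog A (inv\<^bsub>\<Gamma>\<^esub> g)" "w \<in> Units A" using homog_unit[OF gi] by blast
  have wu: "w \<otimes>\<^bsub>A\<^esub> u \<in> homog A \<one>\<^bsub>\<Gamma>\<^esub>" "w \<otimes>\<^bsub>A\<^esub> v \<in> homog A \<one>\<^bsub>\<Gamma>\<^esub>"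
    using homog_mult[OF gi assms(1) w(1)] assms(1-3) by force+
  have c: "w \<in> carrier A" "u \<in> carrier A" "v \<in> carrier A"
    using w u assms homog_carrier by blast+
  have "(w \<otimes>\<^bsub>A\<^esub> y) \<otimes>\<^bsub>A\<^esub> u = w \<otimes>\<^bsub>A\<^esub> (u \<otimes>\<^bsub>A\<^esub> x)" using c assms(4,5) ux by (simp add: monoid.m_assoc[OF mon])
  also have "\<dots> = (w \<otimes>\<^bsub>A\<^esub> u) \<otimes>\<^bsub>A\<^esub> x" using c assms(4,5) by (simp add: monoid.m_assoc[OF mon])
  also have "\<dots> = (x \<otimes>\<^bsub>A\<^esub> w) \<otimes>\<^bsub>A\<^esub> u" using c assms(4,5) cx[OF wu(1)] by (simp add: monoid.m_assoc[OF mon])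
  \<comment> \<open>Cancelling the unit \<open>u\<close> on the right leaves a relation between
    \<open>x\<close> and \<open>y\<close> that involves \<open>w\<close> only, so \<open>v\<close>
    can take the place of \<open>u\<close> in what follows.\<close>
  finally have wy: "w \<otimes>\<^bsub>A\<^esub> y = x \<otimes>\<^bsub>A\<^esub> w"
    using monoid.Units_r_inv[OF mon u] monoid.Units_inv_closed[OF mon u] c assms(4,5)
    by (metis monoid.m_assoc[OF mon] monoid.m_closed[OF mon] monoid.r_one[OF mon])
  have "w \<otimes>\<^bsub>A\<^esub> (v \<otimes>\<^bsub>A\<^esub> x) = x \<otimes>\<^bsub>A\<^esub> (w \<otimes>\<^bsub>A\<^esub> v)" using c assms(4,5) cx[OF wu(2)] by (simp add: monoid.m_assoc[OF mon])
  also have "\<dots> = w \<otimes>\<^bsub>A\<^esub> (y \<otimes>\<^bsub>A\<^esub> v)" using c assms(4,5) wy by (simp add: monoid.m_assoc[OF mon, symmetric])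
  finally show ?thesis using monoid.Units_l_cancel[OF mon w(2)] c assms(4,5) by simp
qed

lemma centralizer_fields [simp]:
  "carrier (centralizer \<Gamma> A) = {a \<in> carrier A. \<forall>b\<in>homog A \<one>\<^bsub>\<Gamma>\<^esub>. a \<otimes>\<^bsub>A\<^esub> b = b \<otimes>\<^bsub>A\<^esub> a}"
  "mult (centralizer \<Gamma> A) = mult A" "one (centralizer \<Gamma> A) = one A" "add (centralizer \<Gamma> A) = add A"
  "smult (centralizer \<Gamma> A) = smult A"
  "homog (centralizer \<Gamma> A) g = {a \<in> carrier A. \<forall>b\<in>homog A \<one>\<^bsub>\<Gamma>\<^esub>. a \<otimes>\<^bsub>A\<^esub> b = b \<otimes>\<^bsub>A\<^esub> a} \<inter> homog A g"
  "act (centralizer \<Gamma> A) g a =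
    (SOME u. u \<in> homog A g \<inter> Units A) \<otimes>\<^bsub>A\<^esub> a \<otimes>\<^bsub>A\<^esub> inv\<^bsub>A\<^esub> (SOME u. u \<in> homog A g \<inter> Units A)"
  by (simp_all add: centralizer_def Let_def)

context crossed_product_over begin

lemma str_algebra_hom: "str A \<in> algebra_hom R D A"
  using str_hom by (auto simp: graded_acted_hom_def algebra_hom_def ring_hom_def)

lemma str_commute: "\<lbrakk>c \<in> carrier D; b \<in> homog A \<one>\<^bsub>\<Gamma>\<^esub>\<rbrakk> \<Longrightarrow> str A c \<otimes>\<^bsub>A\<^esub> b = b \<otimes>\<^bsub>A\<^esub> str A c"
  using str_hom by (auto simp: graded_acted_hom_def algebra_hom_def ring_hom_def Pi_iff)

lemma str_homog: "\<lbrakk>g \<in> carrier \<Gamma>; c \<in> homog D g\<rbrakk> \<Longrightarrow> str A c \<in> homog A g"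
  using str_hom by (simp add: graded_acted_hom_def) blast

text \<open>The action of \<open>centralizer\<close> uses a unit picked by \<open>SOME\<close>, and
  the unit picked in a tensor product need not be built from those picked in the factors. The
  equation u c = (gc) u for at least one unit u, with neither choice nor inverse, does pass to
  tensor products.\<close>

lemma str_act_ex:
  assumes "g \<in> carrier \<Gamma>"
  shows "\<exists>u\<in>homog A g \<inter> Units A. \<forall>c\<in>carrier D. u \<otimes>\<^bsub>A\<^esub> str A c = str A (act D g c) \<otimes>\<^bsub>A\<^esub> u"
proof -
  have rA: "ring A" using assoc_algebra_axioms by (rule assoc_algebra.axioms(2))
  note mon = ring.is_monoid[OF rA]
  let ?u = "SOME u. u \<in> homog A g \<inter> Units A"
  have u: "?u \<in> homog A g \<inter> Units A" using homog_unit[OF assms] by (simp only: some_in_eq) simp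
  have "?u \<otimes>\<^bsub>A\<^esub> str A c = str A (act D g c) \<otimes>\<^bsub>A\<^esub> ?u" if c: "c \<in> carrier D" for c
  proof -
    have "str A (act D g c) = ?u \<otimes>\<^bsub>A\<^esub> str A c \<otimes>\<^bsub>A\<^esub> inv\<^bsub>A\<^esub> ?u"
      using str_hom assms c by (simp add: graded_acted_hom_def)
    moreover have "str A c \<in> carrier A" using linmap_closed[OF algebra_hom_linmap[OF str_algebra_hom] c] .
    moreover have "?u \<in> Units A" using u by blast
    ultimately show ?thesis
      by (simp add: monoid.m_assoc[OF mon] monoid.Units_closed[OF mon] monoid.Units_inv_closed[OF mon]
        monoid.Units_l_inv[OF mon] monoid.r_one[OF mon])
  qed
  then show ?thesis using u by blast
qed

end

text \<open>Converse of \<open>str_act_ex\<close>. One suitable unit in each degree is enough: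
  \<open>unit_commute_transfer\<close> carries the relation to the unit that
  \<open>centralizer\<close> has picked, where multiplying by its inverse gives the required formula
  for the action.\<close>

lemma crossed_product_overI:
  assumes A: "crossed_product R \<Gamma> A" and D: "graded_acted_algebra R \<Gamma> D"
    and hom: "str A \<in> algebra_hom R D A"
    and com: "\<And>c b. \<lbrakk>c \<in> carrier D; b \<in> homog A \<one>\<^bsub>\<Gamma>\<^esub>\<rbrakk> \<Longrightarrow> str A c \<otimes>\<^bsub>A\<^esub> b = b \<otimes>\<^bsub>A\<^esub> str A c"
    and hmg: "\<And>g c. \<lbrakk>g \<in> carrier \<Gamma>; c \<in> homog D g\<rbrakk> \<Longrightarrow> str A c \<in> homog A g"
    and act: "\<And>g. g \<in> carrier \<Gamma> \<Longrightarrow>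
      \<exists>u\<in>homog A g \<inter> Units A. \<forall>c\<in>carrier D. u \<otimes>\<^bsub>A\<^esub> str A c = str A (act D g c) \<otimes>\<^bsub>A\<^esub> u"
  shows "crossed_product_over R \<Gamma> D A"
proof (intro crossed_product_over.intro crossed_product_over_axioms.intro A D)
  interpret crossed_product R \<Gamma> A by fact
  interpret D: graded_acted_algebra R \<Gamma> D by fact
  have rA: "ring A" using assoc_algebra_axioms by (rule assoc_algebra.axioms(2))
  note mon = ring.is_monoid[OF rA]
  note cl = linmap_closed[OF algebra_hom_linmap[OF hom]]
  have "str A (act D g c) = act (centralizer \<Gamma> A) g (str A c)"
    if g: "g \<in> carrier \<Gamma>" and c: "c \<in> carrier D" for g c
  proof -
    let ?v = "SOME u. u \<in> homog A g \<inter> Units A"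
    have v: "?v \<in> homog A g \<inter> Units A" using homog_unit[OF g] by (simp only: some_in_eq) simp
    obtain u where u: "u \<in> homog A g" "u \<in> Units A" "u \<otimes>\<^bsub>A\<^esub> str A c = str A (act D g c) \<otimes>\<^bsub>A\<^esub> u"
      using act[OF g] c by blast
    have gc: "act D g c \<in> carrier D"
      using linmap_closed[OF algebra_hom_linmap[OF D.act_hom[OF g]] c] .
    have "?v \<otimes>\<^bsub>A\<^esub> str A c = str A (act D g c) \<otimes>\<^bsub>A\<^esub> ?v"
      by (rule unit_commute_transfer[OF g u(1) _ cl[OF c] cl[OF gc] com[OF c] u(2,3)]) (use v in auto)
    moreover have "?v \<in> Units A" using v by blast
    ultimately show ?thesis using cl[OF gc] cl[OF c]
      by (simp add: monoid.m_assoc[OF mon] monoid.Units_closed[OF mon] monoid.Units_inv_closed[OF mon]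
        monoid.Units_r_inv[OF mon] monoid.r_one[OF mon])
  qed
  moreover have "str A ` homog D g \<subseteq> homog (centralizer \<Gamma> A) g" if "g \<in> carrier \<Gamma>" for g
    using hmg[OF that] com cl D.homog_carrier[OF that] by auto
  ultimately show "str A \<in> graded_acted_hom R \<Gamma> D (centralizer \<Gamma> A)"
    using hom com by (auto simp: graded_acted_hom_def algebra_hom_def ring_hom_def Pi_iff simp del: centralizer_fields(7))
qed

text \<open>Pure tensors of homogeneous units are homogeneous units. This gives the crossed product
  property, and taking units that realise the action in the factors gives a unit that realises it in
  the tensor product.\<close>

lemma tensor_crossed_product_over:
  assumes R: "cring R" "finite I" and A: "\<And>i. i \<in> I \<Longrightarrow> crossed_product_over R (\<Gamma> i) (C i) (A i)"
  shows "crossed_product_over R (product_group I \<Gamma>) (tensor_acted R I C) (tensor_crossed R I A)"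
proof -
  let ?Z = "tensor_crossed R I A" and ?P = "product_group I \<Gamma>" and ?D = "tensor_acted R I C"
  have cr: "crossed_product R (\<Gamma> i) (A i)" and ac: "graded_acted_algebra R (\<Gamma> i) (C i)" if "i \<in> I" for i
    using crossed_product_over.axioms[OF A[OF that]] by auto
  have alg: "graded_algebra R (\<Gamma> i) (A i)" if "i \<in> I" for i using crossed_product.axioms(1)[OF cr[OF that]] .
  have algC: "graded_algebra R (\<Gamma> i) (C i)" if "i \<in> I" for i
    using graded_acted_algebra.axioms(1)[OF ac[OF that]] .
  have gr: "graded_module R (\<Gamma> i) (A i)" and al: "assoc_algebra R (A i)" if "i \<in> I" for i
    using graded_algebra.axioms[OF alg[OF that]] by auto
  have grC: "graded_module R (\<Gamma> i) (C i)" and alC: "assoc_algebra R (C i)" if "i \<in> I" for i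
    using graded_algebra.axioms[OF algC[OF that]] by auto
  have At: "tensor_graded R I A \<Gamma>"
    by (rule tensor_gradedI[OF R gr])
  have Ct: "tensor_graded R I C \<Gamma>"
    by (rule tensor_gradedI[OF R grC])
  interpret A: tensor_graded R I A \<Gamma> by (rule At)
  interpret C: tensor_graded R I C \<Gamma> by (rule Ct)
  note famA = A.tensor_family_axioms and famC = C.tensor_family_axioms
  interpret P: group ?P by (rule A.group_PG)
  interpret D: graded_acted_algebra R ?P ?D by (rule tensor_graded_acted_algebra[OF R ac])
  note bil = assoc_algebra.mult_bilin[OF al] and bilC = assoc_algebra.mult_bilin[OF alC]
  note tb = tensor_map2_bilin[OF famA famA famA bil]
  note tp = tensor_map2_pure[OF famA famA famA bil]
  have gZ: "graded_algebra R ?P ?Z" by (rule tensor_graded_algebra[OF R alg]) simp_all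
  have ring: "ring (A i)" if "i \<in> I" for i using assoc_algebra.axioms(2)[OF al[OF that]] .
  have one: "\<one>\<^bsub>A i\<^esub> \<in> carrier (A i)" if "i \<in> I" for i using ring.ring_simprules(6)[OF ring[OF that]] .
  have oneC: "\<one>\<^bsub>C i\<^esub> \<in> carrier (C i)" if "i \<in> I" for i
    using ring.ring_simprules(6)[OF assoc_algebra.axioms(2)[OF alC[OF that]]] .
  have ex: "\<exists>u. u \<in> homog (A i) (g i) \<inter> Units (A i) \<and>
      (\<forall>c\<in>carrier (C i). u \<otimes>\<^bsub>A i\<^esub> str (A i) c = str (A i) (act (C i) (g i) c) \<otimes>\<^bsub>A i\<^esub> u)"
    if "i \<in> I" "g \<in> carrier ?P" for i g
    using crossed_product_over.str_act_ex[OF A[OF that(1)], of "g i"] that by auto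
  \<comment> \<open>The inverse of the pure tensor is the pure tensor of the inverses.\<close>
  have unit: "A.pure u \<in> homog ?Z g \<inter> Units ?Z"
    if "g \<in> carrier ?P" and u: "\<And>i. i \<in> I \<Longrightarrow> u i \<in> homog (A i) (g i) \<inter> Units (A i)" for g u
  proof -
    have uc: "u i \<in> carrier (A i)" "inv\<^bsub>A i\<^esub> u i \<in> carrier (A i)" "u i \<otimes>\<^bsub>A i\<^esub> inv\<^bsub>A i\<^esub> u i = \<one>\<^bsub>A i\<^esub>"
      "inv\<^bsub>A i\<^esub> u i \<otimes>\<^bsub>A i\<^esub> u i = \<one>\<^bsub>A i\<^esub>" if "i \<in> I" for i
      using u[OF that] ring.is_monoid[OF ring[OF that]]
      by (auto simp: monoid.Units_closed monoid.Units_inv_closed monoid.Units_r_inv monoid.Units_l_inv)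
    have "A.pure u \<otimes>\<^bsub>?Z\<^esub> A.pure (\<lambda>i. inv\<^bsub>A i\<^esub> u i) = \<one>\<^bsub>?Z\<^esub>"
      "A.pure (\<lambda>i. inv\<^bsub>A i\<^esub> u i) \<otimes>\<^bsub>?Z\<^esub> A.pure u = \<one>\<^bsub>?Z\<^esub>"
      using uc by (simp_all add: tp cong: A.pure_cong)
    moreover have "A.pure u \<in> carrier ?Z" "A.pure (\<lambda>i. inv\<^bsub>A i\<^esub> u i) \<in> carrier ?Z"
      using uc by (simp_all add: A.pure_closed)
    ultimately have "A.pure u \<in> Units ?Z" unfolding Units_def by blast
    moreover have "A.pure u \<in> homog ?Z g" using u by (simp add: A.pure_homog)
    ultimately show ?thesis by blast
  qed
  have cZ: "crossed_product R ?P ?Z"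
  proof (intro crossed_product.intro crossed_product_axioms.intro gZ)
    fix g assume g: "g \<in> carrier ?P"
    have "\<exists>u. \<forall>i\<in>I. u i \<in> homog (A i) (g i) \<inter> Units (A i)"
      using ex[OF _ g] by (intro bchoice) blast
    then show "homog ?Z g \<inter> Units ?Z \<noteq> {}" using unit[OF g] by blast
  qed
  have sh: "str (A i) \<in> algebra_hom R (C i) (A i)" if "i \<in> I" for i
    using crossed_product_over.str_algebra_hom[OF A[OF that]] .
  note lin = tensor_map1_linmap[OF famC famA algebra_hom_linmap[OF sh]]
  note sp = tensor_map1_pure[OF famC famA algebra_hom_linmap[OF sh]]
  note zer = bilin_zero[OF tb A.module_tensor A.module_tensor A.module_tensor]
    linmap_zero[OF C.module_tensor A.module_tensor lin]
  note simps = bilin_simps[OF tb] zer linmap_closed[OF lin] linmap_add[OF lin] linmap_smult[OF lin]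
  show ?thesis
  proof (rule crossed_product_overI[OF cZ D.graded_acted_algebra_axioms])
    have "str ?Z (C.pure (\<lambda>i. \<one>\<^bsub>C i\<^esub>)) = A.pure (\<lambda>i. str (A i) \<one>\<^bsub>C i\<^esub>)" by (simp add: sp oneC)
    also have "\<dots> = A.pure (\<lambda>i. \<one>\<^bsub>A i\<^esub>)"
      by (rule A.pure_cong) (use sh in \<open>auto simp: algebra_hom_def ring_hom_def\<close>)
    finally have o: "str ?Z \<one>\<^bsub>?D\<^esub> = \<one>\<^bsub>?Z\<^esub>" by simp
    have m: "str ?Z (S \<otimes>\<^bsub>?D\<^esub> T) = str ?Z S \<otimes>\<^bsub>?Z\<^esub> str ?Z T" if "S \<in> carrier ?D" "T \<in> carrier ?D" for S T
      using that
      by (simp, intro tensor_map1_mult[OF famC famA algebra_hom_linmap[OF sh] bilC bil])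
        (use sh in \<open>auto simp: algebra_hom_def ring_hom_def\<close>)
    show "str ?Z \<in> algebra_hom R ?D ?Z"
      using o m linmap_closed[OF lin] linmap_add[OF lin] linmap_smult[OF lin]
      by (auto simp: algebra_hom_def ring_hom_def)
    show "str ?Z c \<otimes>\<^bsub>?Z\<^esub> b = b \<otimes>\<^bsub>?Z\<^esub> str ?Z c" if "c \<in> carrier ?D" "b \<in> homog ?Z \<one>\<^bsub>?P\<^esub>" for c b
    proof -
      have b: "b \<in> tensor_homog R I A \<one>\<^bsub>?P\<^esub>" using that by simp
      then have bc: "b \<in> carrier A.TM" using A.tensor_homog_carrier[OF P.one_closed] by blast
      have "c \<in> carrier C.TM" using that by simp
      then have "tensor_map2 R I A (\<lambda>i. mult (A i)) (tensor_map1 R I A (\<lambda>i. str (A i)) c) b =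
          tensor_map2 R I A (\<lambda>i. mult (A i)) b (tensor_map1 R I A (\<lambda>i. str (A i)) c)"
      proof (induction rule: C.carrier_induct)
        case (pure x)
        have xc: "x i \<in> carrier (C i)" if "i \<in> I" for i using pure that by auto
        have sx: "str (A i) (x i) \<in> carrier (A i)" if "i \<in> I" for i
          using linmap_closed[OF algebra_hom_linmap[OF sh[OF that]]] xc that by blast
        note psx = A.pure_closed[OF sx]
        show ?case using b P.one_closed
        proof (induction rule: A.homog_induct)
          case (pure y)
          have yc: "y i \<in> carrier (A i)" if "i \<in> I" for i using pure that by auto
          have "A.pure (\<lambda>i. str (A i) (x i) \<otimes>\<^bsub>A i\<^esub> y i) = A.pure (\<lambda>i. y i \<otimes>\<^bsub>A i\<^esub> str (A i) (x i))"
            using crossed_product_over.str_commute[OF A xc] pure(2) by (intro A.pure_cong) auto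
          then show ?case using xc yc sx by (simp add: sp tp)
        qed (simp_all add: sp xc psx simps)
      qed (simp_all add: bc simps)
      then show ?thesis by simp
    qed
    show "str ?Z c \<in> homog ?Z g" if "g \<in> carrier ?P" "c \<in> homog ?D g" for g c
      using that crossed_product_over.str_homog[OF A]
      by (simp del: carrier_product_group, intro tensor_map1_homog[OF Ct At algebra_hom_linmap[OF sh] _ that(1,1)])
        auto
    show "\<exists>u\<in>homog ?Z g \<inter> Units ?Z. \<forall>c\<in>carrier ?D. u \<otimes>\<^bsub>?Z\<^esub> str ?Z c = str ?Z (act ?D g c) \<otimes>\<^bsub>?Z\<^esub> u"
      if g: "g \<in> carrier ?P" for g
    proof -
      have "\<exists>u. \<forall>i\<in>I. u i \<in> homog (A i) (g i) \<inter> Units (A i) \<and>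
          (\<forall>c\<in>carrier (C i). u i \<otimes>\<^bsub>A i\<^esub> str (A i) c = str (A i) (act (C i) (g i) c) \<otimes>\<^bsub>A i\<^esub> u i)"
        using ex[OF _ g] by (intro bchoice) blast
      then obtain u where u: "\<And>i. i \<in> I \<Longrightarrow> u i \<in> homog (A i) (g i) \<inter> Units (A i)"
        and us: "\<And>i c. \<lbrakk>i \<in> I; c \<in> carrier (C i)\<rbrakk> \<Longrightarrow>
          u i \<otimes>\<^bsub>A i\<^esub> str (A i) c = str (A i) (act (C i) (g i) c) \<otimes>\<^bsub>A i\<^esub> u i" by blast
      have uc: "u i \<in> carrier (A i)" if "i \<in> I" for i
        using u[OF that] ring.is_monoid[OF ring[OF that]] by (auto simp: monoid.Units_closed)
      note puc = A.pure_closed[OF uc]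
      have ah: "act (C i) (g i) \<in> algebra_hom R (C i) (C i)" if "i \<in> I" for i
        using that g by (intro graded_acted_algebra.act_hom[OF ac]) auto
      note alin = tensor_map1_linmap[OF famC famC algebra_hom_linmap[OF ah]]
      have "tensor_map2 R I A (\<lambda>i. mult (A i)) (A.pure u) (tensor_map1 R I A (\<lambda>i. str (A i)) c) =
          tensor_map2 R I A (\<lambda>i. mult (A i))
            (tensor_map1 R I A (\<lambda>i. str (A i)) (tensor_map1 R I C (\<lambda>i. act (C i) (g i)) c)) (A.pure u)"
        if "c \<in> carrier C.TM" for c
        using that
      proof (induction rule: C.carrier_induct)
        case (pure x)
        have xc: "x i \<in> carrier (C i)" if "i \<in> I" for i using pure that by auto
        have ax: "act (C i) (g i) (x i) \<in> carrier (C i)" if "i \<in> I" for i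
          using linmap_closed[OF algebra_hom_linmap[OF ah[OF that]]] xc that by blast
        have sx: "str (A i) y \<in> carrier (A i)" if "i \<in> I" "y \<in> carrier (C i)" for i y
          using linmap_closed[OF algebra_hom_linmap[OF sh[OF that(1)]]] that by blast
        have "A.pure (\<lambda>i. u i \<otimes>\<^bsub>A i\<^esub> str (A i) (x i)) = A.pure (\<lambda>i. str (A i) (act (C i) (g i) (x i)) \<otimes>\<^bsub>A i\<^esub> u i)"
          by (rule A.pure_cong) (simp add: us xc)
        then show ?case
          using tensor_map1_pure[OF famC famC algebra_hom_linmap[OF ah] xc] by (simp add: sp tp xc ax sx uc)
      qed (simp_all add: puc simps linmap_zero[OF C.module_tensor C.module_tensor alin] linmap_add[OF alin]
          linmap_smult[OF alin] linmap_closed[OF alin])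
      then show ?thesis using unit[OF g u] by (intro bexI[of _ "A.pure u"]) auto
    qed
  qed
qed

section \<open>Tensor products of bimodules\<close>

context bimodule begin

text \<open>The axiom \<open>lact_smult\<close> lets scalars pass only from the algebra element.
  Writing r m = (r 1) m and a (r 1) = r a moves them from the module element as well, which
  completes bilinearity of the action.\<close>

lemma lact_smult_right:
  assumes "r \<in> carrier R" "a \<in> carrier A" "m \<in> carrier M"
  shows "lact M a (r \<odot>\<^bsub>M\<^esub> m) = r \<odot>\<^bsub>M\<^esub> lact M a m"
proof -
  have one: "\<one>\<^bsub>A\<^esub> \<in> carrier A" and r1: "a \<otimes>\<^bsub>A\<^esub> \<one>\<^bsub>A\<^esub> = a"
    using ring.ring_simprules(6)[OF assoc_algebra.axioms(2)[OF A.assoc_algebra_axioms]]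
      monoid.r_one[OF ring.is_monoid[OF assoc_algebra.axioms(2)[OF A.assoc_algebra_axioms]]] assms by auto
  have "r \<odot>\<^bsub>M\<^esub> m = lact M (r \<odot>\<^bsub>A\<^esub> \<one>\<^bsub>A\<^esub>) m" using assms one by (simp add: lact_smult lact_one)
  then have "lact M a (r \<odot>\<^bsub>M\<^esub> m) = lact M (a \<otimes>\<^bsub>A\<^esub> (r \<odot>\<^bsub>A\<^esub> \<one>\<^bsub>A\<^esub>)) m"
    using assms one by (simp add: lact_mult A.smult_closed)
  also have "\<dots> = r \<odot>\<^bsub>M\<^esub> lact M a m" using assms one r1 by (simp add: A.smult_mult_right lact_smult)
  finally show ?thesis .
qed

lemma ract_smult_left:
  assumes "r \<in> carrier R" "m \<in> carrier M" "b \<in> carrier B"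
  shows "ract M (r \<odot>\<^bsub>M\<^esub> m) b = r \<odot>\<^bsub>M\<^esub> ract M m b"
proof -
  have one: "\<one>\<^bsub>B\<^esub> \<in> carrier B" and l1: "\<one>\<^bsub>B\<^esub> \<otimes>\<^bsub>B\<^esub> b = b"
    using ring.ring_simprules(6)[OF assoc_algebra.axioms(2)[OF B.assoc_algebra_axioms]]
      monoid.l_one[OF ring.is_monoid[OF assoc_algebra.axioms(2)[OF B.assoc_algebra_axioms]]] assms by auto
  have "r \<odot>\<^bsub>M\<^esub> m = ract M m (r \<odot>\<^bsub>B\<^esub> \<one>\<^bsub>B\<^esub>)" using assms one by (simp add: ract_smult ract_one)
  then have "ract M (r \<odot>\<^bsub>M\<^esub> m) b = ract M m ((r \<odot>\<^bsub>B\<^esub> \<one>\<^bsub>B\<^esub>) \<otimes>\<^bsub>B\<^esub> b)"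
    using assms one by (simp add: ract_mult B.smult_closed)
  also have "\<dots> = r \<odot>\<^bsub>M\<^esub> ract M m b" using assms one l1 by (simp add: B.smult_mult_left ract_smult)
  finally show ?thesis .
qed

lemma lact_bilin: "bilin R A M M (lact M)"
  by (rule bilinI) (simp_all add: lact_closed lact_add_left lact_add_right lact_smult lact_smult_right)

lemma ract_bilin: "bilin R M B M (ract M)"
  by (rule bilinI) (simp_all add: ract_closed ract_add_left ract_add_right ract_smult ract_smult_left)

end

text \<open>Makes finite generation a question about pure tensors: the elements generated by a fixed
  finite set form an R-submodule. The action enters merely as a bilinear map \<open>l\<close>, so
  left and right actions are treated alike.\<close>

lemma linear_combinations_submodule:
  assumes A: "module R A" and M: "module R M" and l: "bilin R A M M l" and S: "finite S" "S \<subseteq> carrier M"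
  shows "submodule {finsum M (\<lambda>s. l (f s) s) S | f. f \<in> S \<rightarrow> carrier A} R M" (is "submodule ?H R M")
    and "\<lbrakk>a \<in> carrier A; s \<in> S\<rbrakk> \<Longrightarrow> l a s \<in> {finsum M (\<lambda>s. l (f s) s) S | f. f \<in> S \<rightarrow> carrier A}"
proof -
  interpret A: module R A by fact
  interpret M: module R M by fact
  note b = bilin_simps[OF l] and z = bilin_zero[OF l A M M]
  have Sc: "s \<in> carrier M" if "s \<in> S" for s using that S by auto
  have cl: "(\<lambda>s. l (f s) s) \<in> S \<rightarrow> carrier M" if "f \<in> S \<rightarrow> carrier A" for f
    using that S b by auto
  show "submodule ?H R M"
  proof (rule M.submoduleI_linear)
    show "?H \<subseteq> carrier M" using cl by (auto intro!: M.M.finsum_closed)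
    have "finsum M (\<lambda>s. l \<zero>\<^bsub>A\<^esub> s) S = \<zero>\<^bsub>M\<^esub>"
      using S z by (intro M.M.add.finprod_one_eqI) auto
    then show "\<zero>\<^bsub>M\<^esub> \<in> ?H" by (intro CollectI exI[of _ "\<lambda>_. \<zero>\<^bsub>A\<^esub>"]) auto
  next
    fix x y assume "x \<in> ?H" "y \<in> ?H"
    then obtain f g where f: "f \<in> S \<rightarrow> carrier A" "x = finsum M (\<lambda>s. l (f s) s) S"
      and g: "g \<in> S \<rightarrow> carrier A" "y = finsum M (\<lambda>s. l (g s) s) S" by blast
    have "finsum M (\<lambda>s. l (f s \<oplus>\<^bsub>A\<^esub> g s) s) S = finsum M (\<lambda>s. l (f s) s \<oplus>\<^bsub>M\<^esub> l (g s) s) S"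
      by (rule M.M.finsum_cong') (auto simp: b Sc Pi_mem[OF f(1)] Pi_mem[OF g(1)])
    also have "\<dots> = x \<oplus>\<^bsub>M\<^esub> y" unfolding f g by (rule M.M.finsum_addf[OF cl cl]) (use f g in auto)
    finally show "x \<oplus>\<^bsub>M\<^esub> y \<in> ?H"
      using f g by (intro CollectI exI[of _ "\<lambda>s. f s \<oplus>\<^bsub>A\<^esub> g s"]) auto
  next
    fix r x assume r: "r \<in> carrier R" and "x \<in> ?H"
    then obtain f where f: "f \<in> S \<rightarrow> carrier A" "x = finsum M (\<lambda>s. l (f s) s) S" by blast
    have "finsum M (\<lambda>s. l (r \<odot>\<^bsub>A\<^esub> f s) s) S = finsum M (\<lambda>s. r \<odot>\<^bsub>M\<^esub> l (f s) s) S"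
      by (rule M.M.finsum_cong') (auto simp: b r Sc Pi_mem[OF f(1)])
    also have "\<dots> = r \<odot>\<^bsub>M\<^esub> x" unfolding f by (rule M.finsum_smult_ldistr[OF S(1) r cl[OF f(1)], symmetric])
    finally show "r \<odot>\<^bsub>M\<^esub> x \<in> ?H" using f r by (intro CollectI exI[of _ "\<lambda>s. r \<odot>\<^bsub>A\<^esub> f s"]) auto
  qed
  show "l a s \<in> ?H" if "a \<in> carrier A" "s \<in> S"
  proof -
    have "finsum M (\<lambda>t. l (if s = t then a else \<zero>\<^bsub>A\<^esub>) t) S = finsum M (\<lambda>t. if s = t then l a t else \<zero>\<^bsub>M\<^esub>) S"
      by (rule M.M.finsum_cong') (use that S b z in auto)
    also have "\<dots> = l a s" using that S b by (intro M.M.finsum_singleton) auto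
    finally show ?thesis using that by (intro CollectI exI[of _ "\<lambda>t. if s = t then a else \<zero>\<^bsub>A\<^esub>"]) auto
  qed
qed

text \<open>Pure tensors of generators generate: write every factor as a combination of its
  generators, distribute, and collect the coefficients into a pure tensor of the algebra. The action
  \<open>L\<close> is a parameter because the right action has to be inserted with its arguments
  exchanged.\<close>

lemma tensor_fin_gen:
  assumes fams: "tensor_family R I A" "tensor_family R I M"
    and \<beta>: "\<And>i. i \<in> I \<Longrightarrow> bilin R (A i) (M i) (M i) (\<beta> i)"
    and L: "bilin R (tensor_module R I A) (tensor_module R I M) (tensor_module R I M) L"
    and Lp: "\<And>a m. \<lbrakk>\<And>i. i \<in> I \<Longrightarrow> a i \<in> carrier (A i); \<And>i. i \<in> I \<Longrightarrow> m i \<in> carrier (M i)\<rbrakk> \<Longrightarrow>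
      L (pure_tensor R I A a) (pure_tensor R I M m) = pure_tensor R I M (\<lambda>i. \<beta> i (a i) (m i))"
    and fg: "\<And>i. i \<in> I \<Longrightarrow> \<exists>S\<subseteq>carrier (M i). finite S \<and>
        (\<forall>m\<in>carrier (M i). \<exists>f\<in>S \<rightarrow> carrier (A i). m = finsum (M i) (\<lambda>s. \<beta> i (f s) s) S)"
  shows "\<exists>S\<subseteq>carrier (tensor_module R I M). finite S \<and>
    (\<forall>m\<in>carrier (tensor_module R I M). \<exists>f\<in>S \<rightarrow> carrier (tensor_module R I A).
      m = finsum (tensor_module R I M) (\<lambda>s. L (f s) s) S)"
proof -
  interpret A: tensor_family R I A by fact
  interpret M: tensor_family R I M by fact
  have "\<exists>S. \<forall>i\<in>I. S i \<subseteq> carrier (M i) \<and> finite (S i) \<and>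
      (\<forall>m\<in>carrier (M i). \<exists>f\<in>S i \<rightarrow> carrier (A i). m = finsum (M i) (\<lambda>s. \<beta> i (f s) s) (S i))"
    using fg by (intro bchoice) blast
  then obtain S where SS: "\<forall>i\<in>I. S i \<subseteq> carrier (M i) \<and> finite (S i) \<and>
      (\<forall>m\<in>carrier (M i). \<exists>f\<in>S i \<rightarrow> carrier (A i). m = finsum (M i) (\<lambda>s. \<beta> i (f s) s) (S i))"
    by (rule exE)
  have S: "\<And>i. i \<in> I \<Longrightarrow> S i \<subseteq> carrier (M i)" "\<And>i. i \<in> I \<Longrightarrow> finite (S i)"
    using SS by simp_all
  have gen: "\<And>i m. \<lbrakk>i \<in> I; m \<in> carrier (M i)\<rbrakk> \<Longrightarrow>
      \<exists>f\<in>S i \<rightarrow> carrier (A i). m = finsum (M i) (\<lambda>s. \<beta> i (f s) s) (S i)" using SS by simp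
  let ?S = "M.pure ` PiE I S"
  have Sc: "?S \<subseteq> carrier M.TM" using S(1) by (auto intro!: M.pure_closed)
  have Sf: "finite ?S" using S(2) by (intro finite_imageI finite_PiE A.finite_I)
  note H = linear_combinations_submodule[OF A.module_tensor M.module_tensor L Sf Sc]
  let ?H = "{finsum M.TM (\<lambda>s. L (f s) s) ?S | f. f \<in> ?S \<rightarrow> carrier A.TM}"
  have "T \<in> ?H" if "T \<in> carrier M.TM" for T
    using that
  proof (induction rule: M.carrier_induct)
    case (pure x)
    have xc: "x i \<in> carrier (M i)" if "i \<in> I" for i using pure that by auto
    have "\<exists>f. \<forall>i\<in>I. f i \<in> S i \<rightarrow> carrier (A i) \<and> x i = finsum (M i) (\<lambda>s. \<beta> i (f i s) s) (S i)"
      using gen xc by (intro bchoice) blast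
    then obtain f where f: "\<And>i s. \<lbrakk>i \<in> I; s \<in> S i\<rbrakk> \<Longrightarrow> f i s \<in> carrier (A i)"
      "\<And>i. i \<in> I \<Longrightarrow> x i = finsum (M i) (\<lambda>s. \<beta> i (f i s) s) (S i)" by blast
    have "M.pure x = M.pure (\<lambda>i. finsum (M i) (\<lambda>s. \<beta> i (f i s) s) (S i))"
      by (rule M.pure_cong[OF f(2)])
    also have "\<dots> = finsum M.TM (\<lambda>s. M.pure (\<lambda>i. \<beta> i (f i (s i)) (s i))) (PiE I S)"
      by (rule M.pure_finsum[OF S(2)]) (auto intro: bilin_closed[OF \<beta> f(1) subsetD[OF S(1)]])
    also have "\<dots> \<in> ?H"
    proof (rule M.TM.submodule_finsum[OF H(1)])
      show "finite (PiE I S)" using S(2) by (intro finite_PiE A.finite_I)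
      fix s assume s: "s \<in> PiE I S"
      have sc: "s i \<in> carrier (M i)" "f i (s i) \<in> carrier (A i)" if "i \<in> I" for i
        using f(1)[OF that PiE_mem[OF s that]] subsetD[OF S(1)[OF that] PiE_mem[OF s that]] by auto
      have "M.pure (\<lambda>i. \<beta> i (f i (s i)) (s i)) = L (A.pure (\<lambda>i. f i (s i))) (M.pure s)"
        by (rule Lp[symmetric]) (use sc in auto)
      also have "\<dots> \<in> ?H" by (rule H(2)) (use s sc in \<open>auto intro!: A.pure_closed\<close>)
      finally show "M.pure (\<lambda>i. \<beta> i (f i (s i)) (s i)) \<in> ?H" .
    qed
    finally show ?case .
  qed (use M.TM.submodule_zero[OF H(1)] M.TM.submoduleE(4,5)[OF H(1)] in simp_all)
  then show ?thesis using Sc Sf by (intro exI[of _ ?S]) blast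
qed

lemma tensor_bimodule:
  assumes fams: "tensor_family R I A" "tensor_family R I B" "tensor_family R I M"
    and bim: "\<And>i. i \<in> I \<Longrightarrow> bimodule R (A i) (B i) (M i)"
  shows "bimodule R (tensor_crossed R I A) (tensor_crossed R I B) (tensor_bimod R I M)"
proof -
  let ?A = "tensor_crossed R I A" and ?B = "tensor_crossed R I B" and ?M = "tensor_bimod R I M"
  interpret A: tensor_family R I A by fact
  interpret B: tensor_family R I B by fact
  interpret M: tensor_family R I M by fact
  have alA: "assoc_algebra R (A i)" and alB: "assoc_algebra R (B i)" if "i \<in> I" for i
    using bimodule.axioms[OF bim[OF that]] by auto
  have one: "\<one>\<^bsub>A i\<^esub> \<in> carrier (A i)" "\<one>\<^bsub>B i\<^esub> \<in> carrier (B i)" if "i \<in> I" for i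
    using ring.ring_simprules(6)[OF assoc_algebra.axioms(2)] alA alB that by auto
  note lb = bimodule.lact_bilin[OF bim] and rb = bimodule.ract_bilin[OF bim]
    and ab = assoc_algebra.mult_bilin[OF alA] and bb = assoc_algebra.mult_bilin[OF alB]
  note tl = tensor_map2_bilin[OF fams(1,3,3) lb] and tr = tensor_map2_bilin[OF fams(3,2,3) rb]
  have fin: "finsum ?M f K = finsum M.TM f K" for f K by (rule finsum_fields_cong) simp_all
  have mM: "module R ?M" by (rule module_fields_cong[OF M.module_tensor]) simp_all
  show ?thesis
  proof (intro bimodule.intro bimodule_axioms.intro mM)
    show "assoc_algebra R ?A" by (rule tensor_assoc_algebra[OF fams(1) alA]) simp_all
    show "assoc_algebra R ?B" by (rule tensor_assoc_algebra[OF fams(2) alB]) simp_all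
    show "lact ?M (a \<otimes>\<^bsub>?A\<^esub> a') m = lact ?M a (lact ?M a' m)"
      if "a \<in> carrier ?A" "a' \<in> carrier ?A" "m \<in> carrier ?M" for a a' m
      using that bimodule.lact_mult[OF bim]
      by (simp, intro tensor_map2_assoc[OF fams(1,1,3,1,3,3) ab lb lb lb]) simp_all
    show "ract ?M m (b \<otimes>\<^bsub>?B\<^esub> b') = ract ?M (ract ?M m b) b'"
      if "m \<in> carrier ?M" "b \<in> carrier ?B" "b' \<in> carrier ?B" for m b b'
      using that bimodule.ract_mult[OF bim]
      by (simp, intro tensor_map2_assoc[OF fams(3,2,2,3,2,3) rb rb bb rb, symmetric]) simp_all
    show "ract ?M (lact ?M a m) b = lact ?M a (ract ?M m b)"
      if "a \<in> carrier ?A" "m \<in> carrier ?M" "b \<in> carrier ?B" for a m b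
      using that bimodule.lact_ract[OF bim]
      by (simp, intro tensor_map2_assoc[OF fams(1,3,2,3,3,3) lb rb rb lb]) simp_all
    show "lact ?M \<one>\<^bsub>?A\<^esub> m = m" if "m \<in> carrier ?M" for m
      using that one bimodule.lact_one[OF bim]
      by (simp, intro tensor_map2_fixed_left[OF fams(1,3) lb]) simp_all
    show "ract ?M m \<one>\<^bsub>?B\<^esub> = m" if "m \<in> carrier ?M" for m
      using that one bimodule.ract_one[OF bim]
      by (simp, intro tensor_map2_fixed_right[OF fams(3,2) rb]) simp_all
    show "\<exists>S\<subseteq>carrier ?M. finite S \<and>
        (\<forall>m\<in>carrier ?M. \<exists>f\<in>S \<rightarrow> carrier ?A. m = finsum ?M (\<lambda>s. lact ?M (f s) s) S)"
      unfolding fin tensor_bimod_fields tensor_crossed_fields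
      by (rule tensor_fin_gen[OF fams(1,3) lb tl tensor_map2_pure[OF fams(1,3,3) lb] bimodule.left_fin_gen[OF bim]])
    have rb': "bilin R (B i) (M i) (M i) (\<lambda>b m. ract (M i) m b)" if "i \<in> I" for i
      using rb[OF that] by (simp add: bilin_def)
    show "\<exists>S\<subseteq>carrier ?M. finite S \<and>
        (\<forall>m\<in>carrier ?M. \<exists>f\<in>S \<rightarrow> carrier ?B. m = finsum ?M (\<lambda>s. ract ?M s (f s)) S)"
      unfolding fin tensor_bimod_fields tensor_crossed_fields
    proof (rule tensor_fin_gen[OF fams(2,3) rb', where L = "\<lambda>b m. tensor_map2 R I M (\<lambda>i. ract (M i)) m b"])
      show "bilin R B.TM M.TM M.TM (\<lambda>b m. tensor_map2 R I M (\<lambda>i. ract (M i)) m b)"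
        using tr by (simp add: bilin_def)
    qed (simp_all add: tensor_map2_pure[OF fams(3,2,3) rb] bimodule.right_fin_gen[OF bim])
  qed (simp_all add: bilin_simps[OF tl] bilin_simps[OF tr])
qed

text \<open>The two graded axioms are linear in each element involved, so they reduce to pure
  tensors of homogeneous or arbitrary elements of the factors. In \<open>over\<close> the degree of
  the module element twists the scalar; for a pure tensor of degree \<open>g\<close> this twist is
  coordinatewise, as is the action on the tensor product.\<close>

lemma tensor_graded_bimodule_over:
  assumes R: "cring R" "finite I"
    and gb: "\<And>i. i \<in> I \<Longrightarrow> graded_bimodule_over R (\<Gamma> i) (C i) (A i) (B i) (M i)"
  shows "graded_bimodule_over R (product_group I \<Gamma>) (tensor_acted R I C)
    (tensor_crossed R I A) (tensor_crossed R I B) (tensor_bimod R I M)"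
proof -
  let ?A = "tensor_crossed R I A" and ?B = "tensor_crossed R I B" and ?M = "tensor_bimod R I M"
    and ?P = "product_group I \<Gamma>" and ?D = "tensor_acted R I C"
  have grM: "graded_module R (\<Gamma> i) (M i)" and bim: "bimodule R (A i) (B i) (M i)"
    and cA: "crossed_product_over R (\<Gamma> i) (C i) (A i)" and cB: "crossed_product_over R (\<Gamma> i) (C i) (B i)"
    if "i \<in> I" for i
    using graded_bimodule_over.axioms[OF gb[OF that]] by auto
  have ac: "graded_acted_algebra R (\<Gamma> i) (C i)" and crA: "crossed_product R (\<Gamma> i) (A i)"
    and crB: "crossed_product R (\<Gamma> i) (B i)" if "i \<in> I" for i
    using crossed_product_over.axioms cA cB that by blast+
  have gA: "graded_module R (\<Gamma> i) (A i)" and gB: "graded_module R (\<Gamma> i) (B i)"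
    and gC: "graded_module R (\<Gamma> i) (C i)" if "i \<in> I" for i
    using crA crB ac that crossed_product.axioms(1) graded_acted_algebra.axioms(1) graded_algebra.axioms(1) by blast+
  note tA = tensor_gradedI[OF R gA] and tB = tensor_gradedI[OF R gB] and tM = tensor_gradedI[OF R grM]
    and tC = tensor_gradedI[OF R gC]
  interpret A: tensor_graded R I A \<Gamma> by (rule tA)
  interpret B: tensor_graded R I B \<Gamma> by (rule tB)
  interpret M: tensor_graded R I M \<Gamma> by (rule tM)
  interpret C: tensor_graded R I C \<Gamma> by (rule tC)
  interpret P: group ?P by (rule A.group_PG)
  note fA = A.tensor_family_axioms and fB = B.tensor_family_axioms and fM = M.tensor_family_axioms
    and fC = C.tensor_family_axioms
  note lb = bimodule.lact_bilin[OF bim] and rb = bimodule.ract_bilin[OF bim]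
  note tl = tensor_map2_bilin[OF fA fM fM lb] and tr = tensor_map2_bilin[OF fM fB fM rb]
  have sA: "str (A i) \<in> algebra_hom R (C i) (A i)" and sB: "str (B i) \<in> algebra_hom R (C i) (B i)" if "i \<in> I" for i
    using crossed_product_over.str_algebra_hom cA cB that by blast+
  note lA = tensor_map1_linmap[OF fC fA algebra_hom_linmap[OF sA]]
    and lB = tensor_map1_linmap[OF fC fB algebra_hom_linmap[OF sB]]
  show ?thesis
  proof (intro graded_bimodule_over.intro graded_bimodule_over_axioms.intro)
    show "graded_module R ?P ?M" by (rule M.tensor_graded_module) simp_all
    show "bimodule R ?A ?B ?M" by (rule tensor_bimodule[OF fA fB fM bim])
    show "crossed_product_over R ?P ?D ?A" by (rule tensor_crossed_product_over[OF R cA])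
    show "crossed_product_over R ?P ?D ?B" by (rule tensor_crossed_product_over[OF R cB])
  next
    fix g x h a m b
    assume g: "g \<in> carrier ?P" and x: "x \<in> carrier ?P" and h: "h \<in> carrier ?P"
      and a: "a \<in> homog ?A g" and m: "m \<in> homog ?M x" and b: "b \<in> homog ?B h"
    note gxh = P.m_closed[OF P.m_closed[OF g x] h]
    note sub = M.tensor_homog_submodule[OF gxh]
    have a': "a \<in> tensor_homog R I A g" and m': "m \<in> tensor_homog R I M x" and b': "b \<in> tensor_homog R I B h"
      using a m b by simp_all
    have mc: "m \<in> carrier M.TM" and bc: "b \<in> carrier B.TM"
      using m' b' M.tensor_homog_carrier[OF x] B.tensor_homog_carrier[OF h] by auto
    note sims = bilin_simps[OF tl] bilin_simps[OF tr]
      bilin_zero[OF tl A.module_tensor M.module_tensor M.module_tensor]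
      bilin_zero[OF tr M.module_tensor B.module_tensor M.module_tensor]
      M.TM.submodule_zero[OF sub] M.TM.submoduleE(4,5)[OF sub]
    have "tensor_map2 R I M (\<lambda>i. ract (M i)) (tensor_map2 R I M (\<lambda>i. lact (M i)) a m) b
        \<in> tensor_homog R I M (g \<otimes>\<^bsub>?P\<^esub> x \<otimes>\<^bsub>?P\<^esub> h)"
      using a' g
    proof (induction rule: A.homog_induct)
      case (pure u)
      note u = pure
      have uc: "u i \<in> carrier (A i)" if "i \<in> I" for i using u that by auto
      note puc = A.pure_closed[OF uc]
      show ?case using m' x
      proof (induction rule: M.homog_induct)
        case (pure v)
        note v = pure
        have vc: "v i \<in> carrier (M i)" if "i \<in> I" for i using v that by auto
        note pvc = M.pure_closed[OF vc]
        show ?case using b' h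
        proof (induction rule: B.homog_induct)
          case (pure w)
          have wc: "w i \<in> carrier (B i)" if "i \<in> I" for i using pure that by auto
          have lc: "lact (M i) (u i) (v i) \<in> carrier (M i)" if "i \<in> I" for i
            using bilin_closed[OF lb] that uc vc by auto
          have "ract (M i) (lact (M i) (u i) (v i)) (w i) \<in> homog (M i) ((g \<otimes>\<^bsub>?P\<^esub> x \<otimes>\<^bsub>?P\<^esub> h) i)" if "i \<in> I" for i
            using graded_bimodule_over.homog_act[OF gb[OF that] _ _ _ u(2)[OF that] v(2)[OF that] pure(2)[OF that]]
              g x h that by auto
          then show ?case
            using uc vc wc lc
            by (simp add: tensor_map2_pure[OF fA fM fM lb] tensor_map2_pure[OF fM fB fM rb] M.pure_homog
                del: mult_product_group)
        qed (simp_all add: sims puc pvc del: mult_product_group)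
      qed (simp_all add: sims puc bc del: mult_product_group)
    qed (simp_all add: sims mc bc del: mult_product_group)
    then show "ract ?M (lact ?M a m) b \<in> homog ?M (g \<otimes>\<^bsub>?P\<^esub> x \<otimes>\<^bsub>?P\<^esub> h)" by simp
  next
    fix g m c assume g: "g \<in> carrier ?P" and m: "m \<in> homog ?M g" and c: "c \<in> carrier ?D"
    have m': "m \<in> tensor_homog R I M g" and c': "c \<in> carrier C.TM" using m c by simp_all
    have mc: "m \<in> carrier M.TM" using m' M.tensor_homog_carrier[OF g] by auto
    have ah: "act (C i) (g i) \<in> algebra_hom R (C i) (C i)" if "i \<in> I" for i
      using that g by (intro graded_acted_algebra.act_hom[OF ac]) auto
    note alin = tensor_map1_linmap[OF fC fC algebra_hom_linmap[OF ah]]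
    note sims = bilin_simps[OF tl] bilin_simps[OF tr]
      bilin_zero[OF tl A.module_tensor M.module_tensor M.module_tensor]
      bilin_zero[OF tr M.module_tensor B.module_tensor M.module_tensor]
      linmap_zero[OF C.module_tensor A.module_tensor lA] linmap_closed[OF lA] linmap_add[OF lA] linmap_smult[OF lA]
      linmap_zero[OF C.module_tensor B.module_tensor lB] linmap_closed[OF lB] linmap_add[OF lB] linmap_smult[OF lB]
      linmap_zero[OF C.module_tensor C.module_tensor alin] linmap_closed[OF alin] linmap_add[OF alin] linmap_smult[OF alin]
    have "tensor_map2 R I M (\<lambda>i. ract (M i)) m (tensor_map1 R I B (\<lambda>i. str (B i)) c) =
        tensor_map2 R I M (\<lambda>i. lact (M i))
          (tensor_map1 R I A (\<lambda>i. str (A i)) (tensor_map1 R I C (\<lambda>i. act (C i) (g i)) c)) m"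
      using c'
    proof (induction rule: C.carrier_induct)
      case (pure x)
      have xc: "x i \<in> carrier (C i)" if "i \<in> I" for i using pure that by auto
      have ax: "act (C i) (g i) (x i) \<in> carrier (C i)" if "i \<in> I" for i
        using linmap_closed[OF algebra_hom_linmap[OF ah[OF that]]] xc that by blast
      have sx: "str (A i) y \<in> carrier (A i)" "str (B i) y \<in> carrier (B i)" if "i \<in> I" "y \<in> carrier (C i)" for i y
        using linmap_closed[OF algebra_hom_linmap[OF sA[OF that(1)]]]
          linmap_closed[OF algebra_hom_linmap[OF sB[OF that(1)]]] that by blast+
      note px = C.pure_closed[OF xc]
      show ?case using m' g
      proof (induction rule: M.homog_induct)
        case (pure y)
        have yc: "y i \<in> carrier (M i)" if "i \<in> I" for i using pure that by auto
        have "M.pure (\<lambda>i. ract (M i) (y i) (str (B i) (x i))) =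
            M.pure (\<lambda>i. lact (M i) (str (A i) (act (C i) (g i) (x i))) (y i))"
          using graded_bimodule_over.over[OF gb _ pure(2) xc] g by (intro M.pure_cong) auto
        then show ?case
          using tensor_map1_pure[OF fC fC algebra_hom_linmap[OF ah] xc] xc ax sx yc
          by (simp add: tensor_map1_pure[OF fC fA algebra_hom_linmap[OF sA]]
              tensor_map1_pure[OF fC fB algebra_hom_linmap[OF sB]]
              tensor_map2_pure[OF fA fM fM lb] tensor_map2_pure[OF fM fB fM rb])
      qed (simp_all add: sims px)
    qed (simp_all add: sims mc)
    then show "ract ?M m (str ?B c) = lact ?M (str ?A (act ?D g c)) m" by simp
  qed
qed

section \<open>Balanced tensor products\<close>

lemma bilin_finsum:
  assumes "bilin R M N P \<beta>" "module R M" "module R N" "module R P" "finite K"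
  shows "\<lbrakk>f \<in> K \<rightarrow> carrier M; n \<in> carrier N\<rbrakk> \<Longrightarrow> \<beta> (finsum M f K) n = finsum P (\<lambda>k. \<beta> (f k) n) K"
    and "\<lbrakk>h \<in> K \<rightarrow> carrier N; m \<in> carrier M\<rbrakk> \<Longrightarrow> \<beta> m (finsum N h K) = finsum P (\<lambda>k. \<beta> m (h k)) K"
  using linmap_finsum[OF assms(2,4) bilin_left[OF assms(1)] assms(5)]
    linmap_finsum[OF assms(3,4) bilin_right[OF assms(1)] assms(5)] by blast+

lemma bilin_compose:
  assumes "bilin R M N P \<beta>" "h \<in> linmap R P Q"
  shows "bilin R M N Q (\<lambda>m n. h (\<beta> m n))"
  using assms by (auto simp: bilin_def intro: linmap_compose)

lemma bilin_compose_left: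
  assumes "bilin R M N P \<beta>" "h \<in> linmap R L M"
  shows "bilin R L N P (\<lambda>l n. \<beta> (h l) n)"
  using assms by (auto simp: bilin_def intro: linmap_compose[where k = "\<lambda>m. \<beta> m n" for n] dest: linmap_closed)

lemma bilin_compose_right:
  assumes "bilin R M N P \<beta>" "h \<in> linmap R L N"
  shows "bilin R M L P (\<lambda>m l. \<beta> m (h l))"
  using assms by (auto simp: bilin_def intro: linmap_compose[where k = "\<beta> m" for m] dest: linmap_closed)

text \<open>Only the two actions of the middle algebra enter, as bilinear maps. The dual fits in
  before anything is known about its finite generation, so M \<otimes>_B \<open>Md\<close> and
  \<open>Md\<close> \<otimes>_A M are both instances.\<close>

locale balanced_tensor = cring R
  for R (structure) and \<Gamma> :: "('g, 'q) monoid_scheme" and B :: "('o, 'b, 'w) module_scheme"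
    and M :: "('o, 'g, 'a, 'b, 'm, 'y) bimod_scheme" and N :: "('o, 'g, 'b, 'd, 'n, 'z) bimod_scheme" +
  assumes mM: "module R M" and mN: "module R N"
    and rM: "bilin R M B M (ract M)" and lN: "bilin R B N N (lact N)"
begin

abbreviation "XB \<equiv> carrier M \<times> carrier N"
abbreviation "T \<equiv> bimodule_tensor R \<Gamma> B M N"
abbreviation "\<tau> \<equiv> presented_gen R XB (balanced_relations R B M N)"
abbreviation "homog_gens x \<equiv> {\<tau> (m, n) | g h m n. g \<in> carrier \<Gamma> \<and> h \<in> carrier \<Gamma> \<and> g \<otimes>\<^bsub>\<Gamma>\<^esub> h = x \<and>
          m \<in> homog M g \<and> n \<in> homog N h}"

sublocale M: module R M by (rule mM)
sublocale N: module R N by (rule mN)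

sublocale pres: presentation R XB "balanced_relations R B M N"
proof
  interpret F: module R "free_module R XB" by (rule module_free)
  note b = bilin_simps(1)[OF rM] bilin_simps(1)[OF lN]
  show "balanced_relations R B M N \<subseteq> carrier (free_module R XB)"
  proof
    fix s assume "s \<in> balanced_relations R B M N"
    then show "s \<in> carrier (free_module R XB)"
      unfolding balanced_relations_def Let_def
      by (elim UnE CollectE exE conjE) (simp_all add: free_gen_closed b F.M.minus_closed)
  qed
qed

lemma T_fields:
  "carrier T = carrier pres.P" "add T = add pres.P" "zero T = zero pres.P" "smult T = smult pres.P"
  by (simp_all add: bimodule_tensor_def Let_def)

lemma module_T: "module R T"
  by (rule module_fields_cong[OF pres.module_P]) (rule T_fields)+

sublocale T: module R T by (rule module_T)

lemma linmap_T: "linmap R T Q = linmap R pres.P Q" "linmap R Q T = linmap R Q pres.P"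
  by (simp_all add: linmap_def T_fields)

lemma homog_T: "homog T x = submodule_span R T (homog_gens x)"
proof -
  have "homog T x = submodule_span R pres.P (homog_gens x)" by (simp add: bimodule_tensor_def Let_def)
  then show ?thesis by (simp only: submodule_span_fields_cong[OF T_fields])
qed

lemma tau_closed: "\<lbrakk>m \<in> carrier M; n \<in> carrier N\<rbrakk> \<Longrightarrow> \<tau> (m, n) \<in> carrier T"
  by (simp add: T_fields pres.gen_closed)

lemma class_eqI:
  assumes "u \<in> carrier pres.F" "v \<in> carrier pres.F" "u \<ominus>\<^bsub>pres.F\<^esub> v \<in> balanced_relations R B M N"
  shows "pres.K +>\<^bsub>pres.F\<^esub> u = pres.K +>\<^bsub>pres.F\<^esub> v"
  using assms pres.F.quotient_eq_iff[OF pres.submodule_K] pres.F.submodule_span_incl by blast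

lemma tau_class: "\<tau> y = pres.K +>\<^bsub>pres.F\<^esub> free_gen R y"
  by (simp add: presented_gen_def)

lemma free_gen_pair_closed: "\<lbrakk>m \<in> carrier M; n \<in> carrier N\<rbrakk> \<Longrightarrow> free_gen R (m, n) \<in> carrier pres.F"
  by (simp add: free_gen_closed)

lemma relations_mem:
  "\<lbrakk>m \<in> carrier M; m' \<in> carrier M; n \<in> carrier N\<rbrakk> \<Longrightarrow> free_gen R (m \<oplus>\<^bsub>M\<^esub> m', n) \<ominus>\<^bsub>pres.F\<^esub>
    (free_gen R (m, n) \<oplus>\<^bsub>pres.F\<^esub> free_gen R (m', n)) \<in> balanced_relations R B M N"
  "\<lbrakk>m \<in> carrier M; n \<in> carrier N; n' \<in> carrier N\<rbrakk> \<Longrightarrow> free_gen R (m, n \<oplus>\<^bsub>N\<^esub> n') \<ominus>\<^bsub>pres.F\<^esub>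
    (free_gen R (m, n) \<oplus>\<^bsub>pres.F\<^esub> free_gen R (m, n')) \<in> balanced_relations R B M N"
  "\<lbrakk>r \<in> carrier R; m \<in> carrier M; n \<in> carrier N\<rbrakk> \<Longrightarrow> free_gen R (r \<odot>\<^bsub>M\<^esub> m, n) \<ominus>\<^bsub>pres.F\<^esub>
    (r \<odot>\<^bsub>pres.F\<^esub> free_gen R (m, n)) \<in> balanced_relations R B M N"
  "\<lbrakk>r \<in> carrier R; m \<in> carrier M; n \<in> carrier N\<rbrakk> \<Longrightarrow> free_gen R (m, r \<odot>\<^bsub>N\<^esub> n) \<ominus>\<^bsub>pres.F\<^esub>
    (r \<odot>\<^bsub>pres.F\<^esub> free_gen R (m, n)) \<in> balanced_relations R B M N"
  "\<lbrakk>m \<in> carrier M; b \<in> carrier B; n \<in> carrier N\<rbrakk> \<Longrightarrow> free_gen R (ract M m b, n) \<ominus>\<^bsub>pres.F\<^esub>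
    free_gen R (m, lact N b n) \<in> balanced_relations R B M N"
  unfolding balanced_relations_def Let_def by (intro UnI1 UnI2, blast)+

lemma tau_bilin: "bilin R M N T (\<lambda>m n. \<tau> (m, n))"
proof (rule bilinI)
  note ca = linmap_add[OF pres.class_linmap] and cs = linmap_smult[OF pres.class_linmap]
  show "\<tau> (m \<oplus>\<^bsub>M\<^esub> m', n) = \<tau> (m, n) \<oplus>\<^bsub>T\<^esub> \<tau> (m', n)"
    if "m \<in> carrier M" "m' \<in> carrier M" "n \<in> carrier N" for m m' n
    using class_eqI[OF _ _ relations_mem(1)[OF that]] ca[OF free_gen_pair_closed[OF that(1,3)] free_gen_pair_closed[OF that(2,3)]] that
    by (simp add: tau_class T_fields free_gen_pair_closed)
  show "\<tau> (m, n \<oplus>\<^bsub>N\<^esub> n') = \<tau> (m, n) \<oplus>\<^bsub>T\<^esub> \<tau> (m, n')"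
    if "m \<in> carrier M" "n \<in> carrier N" "n' \<in> carrier N" for m n n'
    using class_eqI[OF _ _ relations_mem(2)[OF that]] ca[OF free_gen_pair_closed[OF that(1,2)] free_gen_pair_closed[OF that(1,3)]] that
    by (simp add: tau_class T_fields free_gen_pair_closed)
  show "\<tau> (r \<odot>\<^bsub>M\<^esub> m, n) = r \<odot>\<^bsub>T\<^esub> \<tau> (m, n)"
    if "r \<in> carrier R" "m \<in> carrier M" "n \<in> carrier N" for r m n
    using class_eqI[OF _ _ relations_mem(3)[OF that]] cs[OF that(1) free_gen_pair_closed[OF that(2,3)]] that
    by (simp add: tau_class T_fields free_gen_pair_closed)
  show "\<tau> (m, r \<odot>\<^bsub>N\<^esub> n) = r \<odot>\<^bsub>T\<^esub> \<tau> (m, n)"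
    if "r \<in> carrier R" "m \<in> carrier M" "n \<in> carrier N" for r m n
    using class_eqI[OF _ _ relations_mem(4)[OF that]] cs[OF that(1) free_gen_pair_closed[OF that(2,3)]] that
    by (simp add: tau_class T_fields free_gen_pair_closed)
qed (rule tau_closed)

lemma tau_balanced:
  assumes "m \<in> carrier M" "b \<in> carrier B" "n \<in> carrier N"
  shows "\<tau> (ract M m b, n) = \<tau> (m, lact N b n)"
  unfolding tau_class using assms bilin_simps(1)[OF rM] bilin_simps(1)[OF lN]
  by (intro class_eqI free_gen_pair_closed relations_mem(5)) simp_all

lemma linmap_eqI:
  assumes "module R Q" "h \<in> linmap R T Q" "k \<in> linmap R T Q"
    and "\<And>m n. \<lbrakk>m \<in> carrier M; n \<in> carrier N\<rbrakk> \<Longrightarrow> h (\<tau> (m, n)) = k (\<tau> (m, n))" and "t \<in> carrier T"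
  shows "h t = k t"
  using assms by (intro pres.linmap_eqI[of Q h k t]) (auto simp: linmap_T T_fields)

text \<open>The universal property of the balanced tensor product: four families of relations
  express that \<beta> is bilinear and the fifth that it is balanced, so the free extension of
  \<beta> vanishes on all of them.\<close>

lemma
  assumes Q: "module R Q" and \<beta>: "bilin R M N Q \<beta>"
    and bal: "\<And>m b n. \<lbrakk>m \<in> carrier M; b \<in> carrier B; n \<in> carrier N\<rbrakk> \<Longrightarrow> \<beta> (ract M m b) n = \<beta> m (lact N b n)"
  shows balanced_lift_linmap: "presented_lift R Q (\<lambda>(m, n). \<beta> m n) \<in> linmap R T Q"
    and balanced_lift_tau: "\<lbrakk>m \<in> carrier M; n \<in> carrier N\<rbrakk> \<Longrightarrow>
      presented_lift R Q (\<lambda>(m, n). \<beta> m n) (\<tau> (m, n)) = \<beta> m n"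
proof -
  interpret Q: module R Q by fact
  let ?\<phi> = "\<lambda>(m, n). \<beta> m n"
  note b = bilin_simps[OF \<beta>] and cl = bilin_simps(1)[OF rM] bilin_simps(1)[OF lN]
  have \<phi>: "?\<phi> \<in> XB \<rightarrow> carrier Q" using b by auto
  note lin = free_ext_linmap[OF Q \<phi>]
  note diff = linmap_minus[OF pres.F.module_axioms Q lin]
  note e = free_ext_gen[OF Q \<phi>]
  have rel: "free_ext R Q ?\<phi> s = \<zero>\<^bsub>Q\<^esub>" if "s \<in> balanced_relations R B M N" for s
    using that unfolding balanced_relations_def Let_def
    by (elim UnE CollectE exE conjE)
      (simp_all add: diff linmap_add[OF lin] linmap_smult[OF lin] free_gen_pair_closed cl e b bal a_minus_def[of Q] Q.M.r_neg)
  show "presented_lift R Q ?\<phi> \<in> linmap R T Q"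
    unfolding linmap_T by (rule pres.presented_lift_linmap[OF Q \<phi> rel])
  show "presented_lift R Q ?\<phi> (\<tau> (m, n)) = \<beta> m n" if "m \<in> carrier M" "n \<in> carrier N"
    using pres.presented_lift_gen[OF Q \<phi> rel, of "(m, n)"] that by simp
qed

text \<open>The actions on \<open>T\<close> are defined by lifting into the presented module, while
  \<open>T\<close> is the larger record. The two lifts agree because only shared fields occur in
  them.\<close>

lemma presented_lift_T: "presented_lift R pres.P \<phi> = presented_lift R T \<phi>"
proof -
  have fin: "finsum T = finsum pres.P" by (intro ext finsum_fields_cong T_fields)
  show ?thesis by (rule ext) (simp only: presented_lift_def Let_def T_fields(4) fin)
qed

text \<open>\<open>h\<close> abbreviates the action of a single element \<open>a\<close>. As it
  commutes with the action of \<open>B\<close>, the map (m, n) |-> h m \<otimes> n is balanced and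
  descends to \<open>T\<close>.\<close>

lemma
  assumes "h \<in> linmap R M M"
    and "\<And>m b. \<lbrakk>m \<in> carrier M; b \<in> carrier B\<rbrakk> \<Longrightarrow> h (ract M m b) = ract M (h m) b" and "lact M a = h"
  shows lact_T_linmap: "lact T a \<in> linmap R T T"
    and lact_T_tau: "\<lbrakk>m \<in> carrier M; n \<in> carrier N\<rbrakk> \<Longrightarrow> lact T a (\<tau> (m, n)) = \<tau> (lact M a m, n)"
proof -
  have eq: "lact T a = presented_lift R T (\<lambda>(m, n). \<tau> (h m, n))"
    using assms(3) presented_lift_T by (simp add: bimodule_tensor_def Let_def)
  note b = bilin_compose_left[OF tau_bilin assms(1)]
  have bal: "\<tau> (h (ract M m b), n) = \<tau> (h m, lact N b n)"
    if "m \<in> carrier M" "b \<in> carrier B" "n \<in> carrier N" for m b n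
    using tau_balanced[of "h m" b n] that assms(2) linmap_closed[OF assms(1)] by simp
  show "lact T a \<in> linmap R T T" unfolding eq by (rule balanced_lift_linmap[OF module_T b bal])
  show "lact T a (\<tau> (m, n)) = \<tau> (lact M a m, n)" if "m \<in> carrier M" "n \<in> carrier N"
    using balanced_lift_tau[OF module_T b bal that] by (simp add: eq assms(3))
qed

lemma
  assumes "(\<lambda>n. ract N n d) \<in> linmap R N N"
    and "\<And>b n. \<lbrakk>b \<in> carrier B; n \<in> carrier N\<rbrakk> \<Longrightarrow> ract N (lact N b n) d = lact N b (ract N n d)"
  shows ract_T_linmap: "(\<lambda>t. ract T t d) \<in> linmap R T T"
    and ract_T_tau: "\<lbrakk>m \<in> carrier M; n \<in> carrier N\<rbrakk> \<Longrightarrow> ract T (\<tau> (m, n)) d = \<tau> (m, ract N n d)"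
proof -
  have eq: "(\<lambda>t. ract T t d) = presented_lift R T (\<lambda>(m, n). \<tau> (m, ract N n d))"
    using presented_lift_T by (simp add: bimodule_tensor_def Let_def)
  note b = bilin_compose_right[OF tau_bilin assms(1)]
  have bal: "\<tau> (ract M m b, ract N n d) = \<tau> (m, ract N (lact N b n) d)"
    if "m \<in> carrier M" "b \<in> carrier B" "n \<in> carrier N" for m b n
    using tau_balanced[of m b "ract N n d"] that assms(2) linmap_closed[OF assms(1)] by simp
  show "(\<lambda>t. ract T t d) \<in> linmap R T T" unfolding eq by (rule balanced_lift_linmap[OF module_T b bal])
  show "ract T (\<tau> (m, n)) d = \<tau> (m, ract N n d)" if "m \<in> carrier M" "n \<in> carrier N"
    using balanced_lift_tau[OF module_T b bal that] by (simp add: eq[THEN fun_cong])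
qed

end

section \<open>The dual of a graded bimodule\<close>

text \<open>Decompose 1 into components e_g. If a has degree g, then a is the sum of the a e_h, and
  a e_h has degree gh; comparing terms of degree g gives a e_1 = a. Summing this over the components
  a = e_g yields 1 e_1 = 1, so 1 = e_1 has degree one.\<close>

lemma (in graded_algebra) one_homog: "\<one>\<^bsub>A\<^esub> \<in> homog A \<one>\<^bsub>\<Gamma>\<^esub>"
proof -
  have rA: "ring A" using assoc_algebra_axioms by (rule assoc_algebra.axioms(2))
  note mon = ring.is_monoid[OF rA]
  have oc: "\<one>\<^bsub>A\<^esub> \<in> carrier A" using monoid.one_closed[OF mon] .
  let ?e = "\<lambda>g. proj \<Gamma> A g \<one>\<^bsub>A\<^esub>"
  have e: "?e g \<in> homog A g" "?e g \<in> carrier A" if "g \<in> carrier \<Gamma>" for g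
    using proj_homog[OF oc that] proj_carrier[OF that oc] by auto
  have ah: "a \<otimes>\<^bsub>A\<^esub> ?e \<one>\<^bsub>\<Gamma>\<^esub> = a" if g: "g \<in> carrier \<Gamma>" and a: "a \<in> homog A g" for g a
  proof -
    have ac: "a \<in> carrier A" using homog_carrier g a by blast
    \<comment> \<open>The products are indexed by their own degree: the one of degree h is a times
      the component of 1 in degree g^{-1} h. Left translation permutes the group, so these products
      still add up to a.\<close>
    have "proj \<Gamma> A g a = a \<otimes>\<^bsub>A\<^esub> ?e (inv\<^bsub>\<Gamma>\<^esub> g \<otimes>\<^bsub>\<Gamma>\<^esub> g)"
    proof (rule proj_unique[OF _ _ g, where f = "\<lambda>h. a \<otimes>\<^bsub>A\<^esub> ?e (inv\<^bsub>\<Gamma>\<^esub> g \<otimes>\<^bsub>\<Gamma>\<^esub> h)"])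
      fix h assume h: "h \<in> carrier \<Gamma>"
      have "g \<otimes>\<^bsub>\<Gamma>\<^esub> (inv\<^bsub>\<Gamma>\<^esub> g \<otimes>\<^bsub>\<Gamma>\<^esub> h) = h" using g h by (simp add: \<Gamma>.m_assoc[symmetric])
      then show "a \<otimes>\<^bsub>A\<^esub> ?e (inv\<^bsub>\<Gamma>\<^esub> g \<otimes>\<^bsub>\<Gamma>\<^esub> h) \<in> homog A h"
        using homog_mult[OF g _ a e(1)[of "inv\<^bsub>\<Gamma>\<^esub> g \<otimes>\<^bsub>\<Gamma>\<^esub> h"]] g h by simp
    next
      have inj: "inj_on (\<lambda>h. inv\<^bsub>\<Gamma>\<^esub> g \<otimes>\<^bsub>\<Gamma>\<^esub> h) (carrier \<Gamma>)" using g by (intro \<Gamma>.inj_on_cmult) simp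
      have surj: "(\<lambda>h. inv\<^bsub>\<Gamma>\<^esub> g \<otimes>\<^bsub>\<Gamma>\<^esub> h) ` carrier \<Gamma> = carrier \<Gamma>" using g by (intro \<Gamma>.surj_const_mult) simp
      have "finsum A (\<lambda>h. a \<otimes>\<^bsub>A\<^esub> ?e h) ((\<lambda>h. inv\<^bsub>\<Gamma>\<^esub> g \<otimes>\<^bsub>\<Gamma>\<^esub> h) ` carrier \<Gamma>) =
          finsum A (\<lambda>h. a \<otimes>\<^bsub>A\<^esub> ?e (inv\<^bsub>\<Gamma>\<^esub> g \<otimes>\<^bsub>\<Gamma>\<^esub> h)) (carrier \<Gamma>)"
        by (rule M.finsum_reindex[OF _ inj]) (simp add: surj e ac monoid.m_closed[OF mon])
      then have "finsum A (\<lambda>h. a \<otimes>\<^bsub>A\<^esub> ?e (inv\<^bsub>\<Gamma>\<^esub> g \<otimes>\<^bsub>\<Gamma>\<^esub> h)) (carrier \<Gamma>) =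
          finsum A (\<lambda>h. a \<otimes>\<^bsub>A\<^esub> ?e h) (carrier \<Gamma>)"
        by (simp only: surj)
      also have "\<dots> = a \<otimes>\<^bsub>A\<^esub> finsum A ?e (carrier \<Gamma>)"
        using linmap_finsum[OF module_axioms module_axioms bilin_right[OF mult_bilin ac] finite_\<Gamma>, of ?e] e
        by auto
      also have "\<dots> = a" using proj_sum[OF oc] monoid.r_one[OF mon ac] by simp
      finally show "finsum A (\<lambda>h. a \<otimes>\<^bsub>A\<^esub> ?e (inv\<^bsub>\<Gamma>\<^esub> g \<otimes>\<^bsub>\<Gamma>\<^esub> h)) (carrier \<Gamma>) = a" .
    qed
    then show ?thesis using proj_of_homog[OF g a g] g by simp
  qed
  have "\<one>\<^bsub>A\<^esub> \<otimes>\<^bsub>A\<^esub> ?e \<one>\<^bsub>\<Gamma>\<^esub> = \<one>\<^bsub>A\<^esub>"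
  proof -
    have "finsum A ?e (carrier \<Gamma>) \<otimes>\<^bsub>A\<^esub> ?e \<one>\<^bsub>\<Gamma>\<^esub> = finsum A (\<lambda>g. ?e g \<otimes>\<^bsub>A\<^esub> ?e \<one>\<^bsub>\<Gamma>\<^esub>) (carrier \<Gamma>)"
      using linmap_finsum[OF module_axioms module_axioms bilin_left[OF mult_bilin e(2)[OF \<Gamma>.one_closed]] finite_\<Gamma>, of ?e] e
      by auto
    also have "\<dots> = finsum A ?e (carrier \<Gamma>)"
      by (rule M.finsum_cong') (use ah e in auto)
    finally show ?thesis using proj_sum[OF oc] by simp
  qed
  then have "?e \<one>\<^bsub>\<Gamma>\<^esub> = \<one>\<^bsub>A\<^esub>" using monoid.l_one[OF mon e(2)[OF \<Gamma>.one_closed]] by simp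
  then show ?thesis using e(1)[OF \<Gamma>.one_closed] by simp
qed

lemma dual_fields:
  "carrier (dual_bimodule \<Gamma> A M) = {f \<in> carrier M \<rightarrow>\<^sub>E carrier A.
    (\<forall>x\<in>carrier M. \<forall>y\<in>carrier M. f (x \<oplus>\<^bsub>M\<^esub> y) = f x \<oplus>\<^bsub>A\<^esub> f y) \<and>
    (\<forall>a\<in>carrier A. \<forall>x\<in>carrier M. f (lact M a x) = a \<otimes>\<^bsub>A\<^esub> f x)}"
  "zero (dual_bimodule \<Gamma> A M) = (\<lambda>x\<in>carrier M. \<zero>\<^bsub>A\<^esub>)"
  "add (dual_bimodule \<Gamma> A M) f f' = (\<lambda>x\<in>carrier M. f x \<oplus>\<^bsub>A\<^esub> f' x)"
  "smult (dual_bimodule \<Gamma> A M) r f = (\<lambda>x\<in>carrier M. r \<odot>\<^bsub>A\<^esub> f x)"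
  "homog (dual_bimodule \<Gamma> A M) g = {f \<in> carrier (dual_bimodule \<Gamma> A M).
    \<forall>x\<in>carrier \<Gamma>. f ` homog M x \<subseteq> homog A (x \<otimes>\<^bsub>\<Gamma>\<^esub> g)}"
  "lact (dual_bimodule \<Gamma> A M) b f = (\<lambda>x\<in>carrier M. f (ract M x b))"
  "ract (dual_bimodule \<Gamma> A M) f a = (\<lambda>x\<in>carrier M. f x \<otimes>\<^bsub>A\<^esub> a)"
  by (simp_all add: dual_bimodule_def Let_def)

context graded_bimodule_over begin

abbreviation "Md \<equiv> dual_bimodule \<Gamma> A M"

lemma ringA: "ring A" and ringB: "ring B"
  using assoc_algebra.axioms(2) A.assoc_algebra_axioms B.assoc_algebra_axioms by auto

lemma A_simps:
  "\<one>\<^bsub>A\<^esub> \<in> carrier A" "\<lbrakk>a \<in> carrier A; b \<in> carrier A\<rbrakk> \<Longrightarrow> a \<otimes>\<^bsub>A\<^esub> b \<in> carrier A"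
  "\<lbrakk>a \<in> carrier A; b \<in> carrier A; c \<in> carrier A\<rbrakk> \<Longrightarrow> a \<otimes>\<^bsub>A\<^esub> b \<otimes>\<^bsub>A\<^esub> c = a \<otimes>\<^bsub>A\<^esub> (b \<otimes>\<^bsub>A\<^esub> c)"
  "a \<in> carrier A \<Longrightarrow> a \<otimes>\<^bsub>A\<^esub> \<one>\<^bsub>A\<^esub> = a" "a \<in> carrier A \<Longrightarrow> \<one>\<^bsub>A\<^esub> \<otimes>\<^bsub>A\<^esub> a = a"
  using ring.is_monoid[OF ringA] by (simp_all add: monoid.m_assoc monoid.one_closed monoid.m_closed monoid.r_one monoid.l_one)

lemma B_simps:
  "\<one>\<^bsub>B\<^esub> \<in> carrier B" "\<lbrakk>a \<in> carrier B; b \<in> carrier B\<rbrakk> \<Longrightarrow> a \<otimes>\<^bsub>B\<^esub> b \<in> carrier B"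
  "\<lbrakk>a \<in> carrier B; b \<in> carrier B; c \<in> carrier B\<rbrakk> \<Longrightarrow> a \<otimes>\<^bsub>B\<^esub> b \<otimes>\<^bsub>B\<^esub> c = a \<otimes>\<^bsub>B\<^esub> (b \<otimes>\<^bsub>B\<^esub> c)"
  "a \<in> carrier B \<Longrightarrow> a \<otimes>\<^bsub>B\<^esub> \<one>\<^bsub>B\<^esub> = a" "a \<in> carrier B \<Longrightarrow> \<one>\<^bsub>B\<^esub> \<otimes>\<^bsub>B\<^esub> a = a"
  using ring.is_monoid[OF ringB] by (simp_all add: monoid.m_assoc monoid.one_closed monoid.m_closed monoid.r_one monoid.l_one)

lemmas A_bilin = bilin_simps[OF A.mult_bilin]
text \<open>\<open>homog_act\<close> multiplies on both sides at once. Taking 1 on the right, which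
  has degree one by \<open>one_homog\<close>, isolates the left action; \<open>ract_homog\<close> is
  the mirror image.\<close>

lemma lact_homog:
  assumes "g \<in> carrier \<Gamma>" "x \<in> carrier \<Gamma>" "a \<in> homog A g" "m \<in> homog M x"
  shows "lact M a m \<in> homog M (g \<otimes>\<^bsub>\<Gamma>\<^esub> x)"
  using homog_act[OF assms(1,2) \<Gamma>.one_closed assms(3,4) B.one_homog] assms
    A.homog_carrier[OF assms(1,3)] homog_carrier[OF assms(2,4)]
  by (simp add: ract_one lact_closed)

lemma ract_homog:
  assumes "g \<in> carrier \<Gamma>" "x \<in> carrier \<Gamma>" "b \<in> homog B g" "m \<in> homog M x"
  shows "ract M m b \<in> homog M (x \<otimes>\<^bsub>\<Gamma>\<^esub> g)"
  using homog_act[OF \<Gamma>.one_closed assms(2,1) A.one_homog assms(4,3)] assms homog_carrier[OF assms(2,4)]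
  by (simp add: lact_one)

lemma dual_closed: "\<lbrakk>f \<in> carrier Md; x \<in> carrier M\<rbrakk> \<Longrightarrow> f x \<in> carrier A"
  and dual_add: "\<lbrakk>f \<in> carrier Md; x \<in> carrier M; y \<in> carrier M\<rbrakk> \<Longrightarrow> f (x \<oplus>\<^bsub>M\<^esub> y) = f x \<oplus>\<^bsub>A\<^esub> f y"
  and dual_lact: "\<lbrakk>f \<in> carrier Md; a \<in> carrier A; x \<in> carrier M\<rbrakk> \<Longrightarrow> f (lact M a x) = a \<otimes>\<^bsub>A\<^esub> f x"
  by (auto simp: dual_fields)

text \<open>Scalars act through \<open>A\<close>, since r x = (r 1) x, so linearity over
  \<open>A\<close> implies linearity over R. This is what allows functionals to be tensored over
  R.\<close>

lemma dual_linmap: "f \<in> carrier Md \<Longrightarrow> f \<in> linmap R M A"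
proof (rule linmapI)
  fix r x assume f: "f \<in> carrier Md" and r: "r \<in> carrier R" and x: "x \<in> carrier M"
  have "r \<odot>\<^bsub>M\<^esub> x = lact M (r \<odot>\<^bsub>A\<^esub> \<one>\<^bsub>A\<^esub>) x" using r x A_simps by (simp add: lact_smult lact_one)
  then show "f (r \<odot>\<^bsub>M\<^esub> x) = r \<odot>\<^bsub>A\<^esub> f x"
    using f r x A_simps dual_closed by (simp add: dual_lact A_bilin)
qed (simp_all add: dual_closed dual_add)

lemma dualI:
  assumes "\<And>x. x \<in> carrier M \<Longrightarrow> h x \<in> carrier A"
    and "\<And>x y. \<lbrakk>x \<in> carrier M; y \<in> carrier M\<rbrakk> \<Longrightarrow> h (x \<oplus>\<^bsub>M\<^esub> y) = h x \<oplus>\<^bsub>A\<^esub> h y"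
    and "\<And>a x. \<lbrakk>a \<in> carrier A; x \<in> carrier M\<rbrakk> \<Longrightarrow> h (lact M a x) = a \<otimes>\<^bsub>A\<^esub> h x"
  shows "(\<lambda>x\<in>carrier M. h x) \<in> carrier Md"
  using assms by (simp add: dual_fields lact_closed)

lemma dual_ext:
  assumes "f \<in> carrier Md" "f' \<in> carrier Md" "\<And>x. x \<in> carrier M \<Longrightarrow> f x = f' x"
  shows "f = f'"
  using assms by (auto simp: dual_fields intro: PiE_ext)

lemma dual_ops_closed:
  "\<zero>\<^bsub>Md\<^esub> \<in> carrier Md"
  "\<lbrakk>f \<in> carrier Md; f' \<in> carrier Md\<rbrakk> \<Longrightarrow> f \<oplus>\<^bsub>Md\<^esub> f' \<in> carrier Md"
  "\<lbrakk>r \<in> carrier R; f \<in> carrier Md\<rbrakk> \<Longrightarrow> r \<odot>\<^bsub>Md\<^esub> f \<in> carrier Md"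
  "\<lbrakk>b \<in> carrier B; f \<in> carrier Md\<rbrakk> \<Longrightarrow> lact Md b f \<in> carrier Md"
  "\<lbrakk>f \<in> carrier Md; a \<in> carrier A\<rbrakk> \<Longrightarrow> ract Md f a \<in> carrier Md"
proof -
  note s = dual_closed dual_add dual_lact A_simps A_bilin
    bilin_zero[OF A.mult_bilin A.module_axioms A.module_axioms A.module_axioms]
  show "\<zero>\<^bsub>Md\<^esub> \<in> carrier Md" unfolding dual_fields(2) by (rule dualI) (simp_all add: s)
  show "f \<oplus>\<^bsub>Md\<^esub> f' \<in> carrier Md" if "f \<in> carrier Md" "f' \<in> carrier Md"
    unfolding dual_fields(3) using that by (intro dualI) (simp_all add: s A.M.a_ac)
  show "r \<odot>\<^bsub>Md\<^esub> f \<in> carrier Md" if "r \<in> carrier R" "f \<in> carrier Md"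
    unfolding dual_fields(4) using that by (intro dualI) (simp_all add: s A.smult_r_distr)
  show "lact Md b f \<in> carrier Md" if "b \<in> carrier B" "f \<in> carrier Md"
    unfolding dual_fields(6) using that by (intro dualI) (simp_all add: s ract_closed ract_add_left lact_ract)
  show "ract Md f a \<in> carrier Md" if "f \<in> carrier Md" "a \<in> carrier A"
    unfolding dual_fields(7) using that by (intro dualI) (simp_all add: s)
qed

lemma dual_apply:
  "x \<in> carrier M \<Longrightarrow> \<zero>\<^bsub>Md\<^esub> x = \<zero>\<^bsub>A\<^esub>" "x \<in> carrier M \<Longrightarrow> (f \<oplus>\<^bsub>Md\<^esub> f') x = f x \<oplus>\<^bsub>A\<^esub> f' x"
  "x \<in> carrier M \<Longrightarrow> (r \<odot>\<^bsub>Md\<^esub> f) x = r \<odot>\<^bsub>A\<^esub> f x"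
  "x \<in> carrier M \<Longrightarrow> (lact Md b f) x = f (ract M x b)" "x \<in> carrier M \<Longrightarrow> (ract Md f a) x = f x \<otimes>\<^bsub>A\<^esub> a"
  by (simp_all add: dual_fields)

lemma module_dual: "module R Md"
proof (rule moduleI)
  show "abelian_group Md"
  proof (rule abelian_groupI)
    fix f assume f: "f \<in> carrier Md"
    have "(\<ominus>\<^bsub>R\<^esub> \<one>\<^bsub>R\<^esub>) \<odot>\<^bsub>Md\<^esub> f \<oplus>\<^bsub>Md\<^esub> f = \<zero>\<^bsub>Md\<^esub>"
      using f by (intro dual_ext) (simp_all add: dual_ops_closed dual_apply dual_closed A.smult_l_minus A.M.l_neg)
    then show "\<exists>g\<in>carrier Md. g \<oplus>\<^bsub>Md\<^esub> f = \<zero>\<^bsub>Md\<^esub>"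
      using f dual_ops_closed(3)[OF _ f, of "\<ominus>\<^bsub>R\<^esub> \<one>\<^bsub>R\<^esub>"] by auto
  qed (auto intro!: dual_ext simp: dual_ops_closed dual_apply dual_closed A.M.a_ac)
qed (auto intro!: dual_ext simp: dual_ops_closed dual_apply dual_closed A.smult_l_distr A.smult_r_distr A.smult_assoc1
    R.is_cring)

sublocale Md: module R Md by (rule module_dual)

lemma dual_lact_bilin: "bilin R B Md Md (lact Md)"
  by (rule bilinI)
    (auto intro!: dual_ext simp: dual_ops_closed dual_apply dual_closed dual_add ract_closed ract_add_right ract_smult
      linmap_smult[OF dual_linmap])

lemma dual_ract_bilin: "bilin R Md A Md (ract Md)"
  by (rule bilinI)
    (auto intro!: dual_ext simp: dual_ops_closed dual_apply dual_closed A_bilin)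

lemma dual_eval_bilin: "bilin R M Md A (\<lambda>x f. f x)"
  by (rule bilinI) (simp_all add: dual_closed dual_add dual_apply linmap_smult[OF dual_linmap])

lemma dual_lact_ract:
  "\<lbrakk>b \<in> carrier B; f \<in> carrier Md; a \<in> carrier A\<rbrakk> \<Longrightarrow> ract Md (lact Md b f) a = lact Md b (ract Md f a)"
  by (rule dual_ext) (simp_all add: dual_ops_closed dual_apply ract_closed)

lemma dual_homog_carrier: "f \<in> homog Md g \<Longrightarrow> f \<in> carrier Md"
  by (simp add: dual_fields)

lemma dual_homogD: "\<lbrakk>f \<in> homog Md g; h \<in> carrier \<Gamma>; x \<in> homog M h\<rbrakk> \<Longrightarrow> f x \<in> homog A (h \<otimes>\<^bsub>\<Gamma>\<^esub> g)"
  unfolding dual_fields(5) by blast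

lemma dual_homogI:
  "\<lbrakk>f \<in> carrier Md; \<And>h x. \<lbrakk>h \<in> carrier \<Gamma>; x \<in> homog M h\<rbrakk> \<Longrightarrow> f x \<in> homog A (h \<otimes>\<^bsub>\<Gamma>\<^esub> g)\<rbrakk> \<Longrightarrow> f \<in> homog Md g"
  by (auto simp: dual_fields(5))

text \<open>\<open>T1.T\<close> is M \<otimes>_B \<open>Md\<close> and, in the next declaration,
  \<open>T2.T\<close> is \<open>Md\<close> \<otimes>_A M: the two tensor products in the definition
  of a graded Morita equivalence.\<close>

sublocale T1: balanced_tensor R \<Gamma> B M Md
  by (intro balanced_tensor.intro balanced_tensor_axioms.intro R.is_cring module_axioms module_dual ract_bilin dual_lact_bilin)

sublocale T2: balanced_tensor R \<Gamma> A Md M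
  by (intro balanced_tensor.intro balanced_tensor_axioms.intro R.is_cring module_axioms module_dual lact_bilin dual_ract_bilin)

lemma T1_acts:
  assumes "a \<in> carrier A"
  shows "lact T1.T a \<in> linmap R T1.T T1.T" "(\<lambda>t. ract T1.T t a) \<in> linmap R T1.T T1.T"
    and "\<lbrakk>x \<in> carrier M; f \<in> carrier Md\<rbrakk> \<Longrightarrow> lact T1.T a (T1.\<tau> (x, f)) = T1.\<tau> (lact M a x, f)"
    and "\<lbrakk>x \<in> carrier M; f \<in> carrier Md\<rbrakk> \<Longrightarrow> ract T1.T (T1.\<tau> (x, f)) a = T1.\<tau> (x, ract Md f a)"
  using T1.lact_T_linmap[OF bilin_right[OF lact_bilin assms] _ refl]
    T1.lact_T_tau[OF bilin_right[OF lact_bilin assms] _ refl]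
    T1.ract_T_linmap[OF bilin_left[OF dual_ract_bilin assms]]
    T1.ract_T_tau[OF bilin_left[OF dual_ract_bilin assms]] assms
  by (simp_all add: lact_ract dual_lact_ract)

lemma T2_acts:
  assumes "b \<in> carrier B"
  shows "lact T2.T b \<in> linmap R T2.T T2.T" "(\<lambda>t. ract T2.T t b) \<in> linmap R T2.T T2.T"
    and "\<lbrakk>f \<in> carrier Md; x \<in> carrier M\<rbrakk> \<Longrightarrow> lact T2.T b (T2.\<tau> (f, x)) = T2.\<tau> (lact Md b f, x)"
    and "\<lbrakk>f \<in> carrier Md; x \<in> carrier M\<rbrakk> \<Longrightarrow> ract T2.T (T2.\<tau> (f, x)) b = T2.\<tau> (f, ract M x b)"
  using T2.lact_T_linmap[OF bilin_right[OF dual_lact_bilin assms] _ refl]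
    T2.lact_T_tau[OF bilin_right[OF dual_lact_bilin assms] _ refl]
    T2.ract_T_linmap[OF bilin_left[OF ract_bilin assms]]
    T2.ract_T_tau[OF bilin_left[OF ract_bilin assms]] assms
  by (simp_all add: lact_ract dual_lact_ract)

lemma T1_gens: "T1.homog_gens x \<subseteq> carrier T1.T" and T2_gens: "T2.homog_gens x \<subseteq> carrier T2.T"
  by (auto intro!: T1.tau_closed T2.tau_closed intro: homog_carrier dual_homog_carrier)

lemma T1_homogI:
  "\<lbrakk>g \<in> carrier \<Gamma>; h \<in> carrier \<Gamma>; g \<otimes>\<^bsub>\<Gamma>\<^esub> h = u; x \<in> homog M g; f \<in> homog Md h\<rbrakk> \<Longrightarrow> T1.\<tau> (x, f) \<in> homog T1.T u"
  unfolding T1.homog_T by (intro T1.T.submodule_span_incl) blast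

lemma T2_homogI:
  "\<lbrakk>g \<in> carrier \<Gamma>; h \<in> carrier \<Gamma>; g \<otimes>\<^bsub>\<Gamma>\<^esub> h = u; f \<in> homog Md g; x \<in> homog M h\<rbrakk> \<Longrightarrow> T2.\<tau> (f, x) \<in> homog T2.T u"
  unfolding T2.homog_T by (intro T2.T.submodule_span_incl) blast

lemma T1_homog_submodule: "submodule (homog T1.T u) R T1.T"
  and T2_homog_submodule: "submodule (homog T2.T u) R T2.T"
  unfolding T1.homog_T T2.homog_T
  by (rule T1.T.submodule_span_submodule[OF T1_gens] T2.T.submodule_span_submodule[OF T2_gens])+

text \<open>The homogeneous generators of degree one are closed under scalars, as a scalar can be
  absorbed by the factor in M. The two degrees of a generator multiply to 1 and are therefore
  inverse to each other, which is the degree pattern of Morita data.\<close>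

lemma T1_homog_finsum:
  assumes "t \<in> homog T1.T \<one>\<^bsub>\<Gamma>\<^esub>"
  obtains k :: nat and d n f where "\<And>i. i < k \<Longrightarrow> d i \<in> carrier \<Gamma>" "\<And>i. i < k \<Longrightarrow> n i \<in> homog M (inv\<^bsub>\<Gamma>\<^esub> d i)"
    "\<And>i. i < k \<Longrightarrow> f i \<in> homog Md (d i)" "t = finsum T1.T (\<lambda>i. T1.\<tau> (n i, f i)) {..<k}"
proof -
  have "r \<odot>\<^bsub>T1.T\<^esub> s \<in> T1.homog_gens \<one>\<^bsub>\<Gamma>\<^esub>" if "r \<in> carrier R" "s \<in> T1.homog_gens \<one>\<^bsub>\<Gamma>\<^esub>" for r s
  proof -
    obtain g h x f where s: "s = T1.\<tau> (x, f)" "g \<in> carrier \<Gamma>" "h \<in> carrier \<Gamma>" "g \<otimes>\<^bsub>\<Gamma>\<^esub> h = \<one>\<^bsub>\<Gamma>\<^esub>"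
      "x \<in> homog M g" "f \<in> homog Md h" using \<open>s \<in> T1.homog_gens \<one>\<^bsub>\<Gamma>\<^esub>\<close> by blast
    have "r \<odot>\<^bsub>T1.T\<^esub> s = T1.\<tau> (r \<odot>\<^bsub>M\<^esub> x, f)" unfolding s
      using bilin_simps(4)[OF T1.tau_bilin] that s homog_carrier dual_homog_carrier by simp
    moreover have "r \<odot>\<^bsub>M\<^esub> x \<in> homog M g" using submoduleE(4)[OF homog_submodule] s that by blast
    ultimately show ?thesis using s by blast
  qed
  then obtain k :: nat and s where s: "\<And>i. i < k \<Longrightarrow> s i \<in> T1.homog_gens \<one>\<^bsub>\<Gamma>\<^esub>" "t = finsum T1.T s {..<k}"
    using T1.T.submodule_span_finsum[OF assms[unfolded T1.homog_T] T1_gens] by blast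
  \<comment> \<open>The degree, the element of M and the functional are packed into one triple, so
    that a single choice over the indices provides all three families.\<close>
  have ex: "\<exists>q. s i = T1.\<tau> (fst (snd q), snd (snd q)) \<and> fst q \<in> carrier \<Gamma> \<and> fst (snd q) \<in> homog M (inv\<^bsub>\<Gamma>\<^esub> fst q) \<and> snd (snd q) \<in> homog Md (fst q)"
    if ik: "i < k" for i
  proof -
    obtain g h x f where *: "s i = T1.\<tau> (x, f)" "g \<in> carrier \<Gamma>" "h \<in> carrier \<Gamma>" "g \<otimes>\<^bsub>\<Gamma>\<^esub> h = \<one>\<^bsub>\<Gamma>\<^esub>"
      "x \<in> homog M g" "f \<in> homog Md h" using s(1)[OF ik] by blast
    have "g = inv\<^bsub>\<Gamma>\<^esub> h" using *(2-4) by (simp add: \<Gamma>.inv_equality)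
    then show ?thesis using * by (intro exI[of _ "(h, x, f)"]) auto
  qed
  have "\<exists>q. \<forall>i\<in>{..<k}. s i = T1.\<tau> (fst (snd (q i)), snd (snd (q i))) \<and> fst (q i) \<in> carrier \<Gamma> \<and> fst (snd (q i)) \<in> homog M (inv\<^bsub>\<Gamma>\<^esub> fst (q i)) \<and> snd (snd (q i)) \<in> homog Md (fst (q i))"
    by (intro bchoice ballI ex) simp
  then obtain q where q: "\<forall>i\<in>{..<k}. s i = T1.\<tau> (fst (snd (q i)), snd (snd (q i))) \<and> fst (q i) \<in> carrier \<Gamma> \<and> fst (snd (q i)) \<in> homog M (inv\<^bsub>\<Gamma>\<^esub> fst (q i)) \<and> snd (snd (q i)) \<in> homog Md (fst (q i))"
    by (rule exE)
  let ?d = "\<lambda>i. fst (q i)" and ?n = "\<lambda>i. fst (snd (q i))" and ?f = "\<lambda>i. snd (snd (q i))"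
  have q': "s i = T1.\<tau> (?n i, ?f i)" "?d i \<in> carrier \<Gamma>" "?n i \<in> homog M (inv\<^bsub>\<Gamma>\<^esub> ?d i)" "?f i \<in> homog Md (?d i)"
    if "i < k" for i using q that by simp_all
  have cl: "T1.\<tau> (?n i, ?f i) \<in> carrier T1.T" if "i < k" for i
    by (rule T1.tau_closed[OF homog_carrier[OF \<Gamma>.inv_closed[OF q'(2)[OF that]] q'(3)[OF that]] dual_homog_carrier[OF q'(4)[OF that]]])
  have "t = finsum T1.T (\<lambda>i. T1.\<tau> (?n i, ?f i)) {..<k}"
    unfolding s(2) by (rule T1.T.M.finsum_cong'[OF refl]) (use q'(1) cl in auto)
  then show ?thesis using that[of k ?d ?n ?f] q'(2-4) by blast
qed

lemma T2_homog_finsum: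
  assumes "t \<in> homog T2.T \<one>\<^bsub>\<Gamma>\<^esub>"
  obtains k :: nat and d n f where "\<And>i. i < k \<Longrightarrow> d i \<in> carrier \<Gamma>" "\<And>i. i < k \<Longrightarrow> n i \<in> homog M (inv\<^bsub>\<Gamma>\<^esub> d i)"
    "\<And>i. i < k \<Longrightarrow> f i \<in> homog Md (d i)" "t = finsum T2.T (\<lambda>i. T2.\<tau> (f i, n i)) {..<k}"
proof -
  have "r \<odot>\<^bsub>T2.T\<^esub> s \<in> T2.homog_gens \<one>\<^bsub>\<Gamma>\<^esub>" if "r \<in> carrier R" "s \<in> T2.homog_gens \<one>\<^bsub>\<Gamma>\<^esub>" for r s
  proof -
    obtain g h x f where s: "s = T2.\<tau> (f, x)" "g \<in> carrier \<Gamma>" "h \<in> carrier \<Gamma>" "g \<otimes>\<^bsub>\<Gamma>\<^esub> h = \<one>\<^bsub>\<Gamma>\<^esub>"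
      "x \<in> homog M h" "f \<in> homog Md g" using \<open>s \<in> T2.homog_gens \<one>\<^bsub>\<Gamma>\<^esub>\<close> by blast
    have "r \<odot>\<^bsub>T2.T\<^esub> s = T2.\<tau> (f, r \<odot>\<^bsub>M\<^esub> x)" unfolding s
      using bilin_simps(5)[OF T2.tau_bilin] that s homog_carrier dual_homog_carrier by simp
    moreover have "r \<odot>\<^bsub>M\<^esub> x \<in> homog M h" using submoduleE(4)[OF homog_submodule] s that by blast
    ultimately show ?thesis using s by blast
  qed
  then obtain k :: nat and s where s: "\<And>i. i < k \<Longrightarrow> s i \<in> T2.homog_gens \<one>\<^bsub>\<Gamma>\<^esub>" "t = finsum T2.T s {..<k}"
    using T2.T.submodule_span_finsum[OF assms[unfolded T2.homog_T] T2_gens] by blast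
  have ex: "\<exists>q. s i = T2.\<tau> (snd (snd q), fst (snd q)) \<and> fst q \<in> carrier \<Gamma> \<and> fst (snd q) \<in> homog M (inv\<^bsub>\<Gamma>\<^esub> fst q) \<and> snd (snd q) \<in> homog Md (fst q)"
    if ik: "i < k" for i
  proof -
    obtain g h x f where *: "s i = T2.\<tau> (f, x)" "g \<in> carrier \<Gamma>" "h \<in> carrier \<Gamma>" "g \<otimes>\<^bsub>\<Gamma>\<^esub> h = \<one>\<^bsub>\<Gamma>\<^esub>"
      "x \<in> homog M h" "f \<in> homog Md g" using s(1)[OF ik] by blast
    \<comment> \<open>Here the functional is the left factor, of degree \<open>g\<close>. Its
      partner has to be of degree inverse to \<open>g\<close>, so the product being 1 is needed in
      the opposite order.\<close>
    have "h \<otimes>\<^bsub>\<Gamma>\<^esub> g = \<one>\<^bsub>\<Gamma>\<^esub>" using *(2-4) by (simp add: \<Gamma>.inv_comm)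
    then have "h = inv\<^bsub>\<Gamma>\<^esub> g" using *(2-3) by (simp add: \<Gamma>.inv_equality)
    then show ?thesis using * by (intro exI[of _ "(g, x, f)"]) auto
  qed
  have "\<exists>q. \<forall>i\<in>{..<k}. s i = T2.\<tau> (snd (snd (q i)), fst (snd (q i))) \<and> fst (q i) \<in> carrier \<Gamma> \<and> fst (snd (q i)) \<in> homog M (inv\<^bsub>\<Gamma>\<^esub> fst (q i)) \<and> snd (snd (q i)) \<in> homog Md (fst (q i))"
    by (intro bchoice ballI ex) simp
  then obtain q where q: "\<forall>i\<in>{..<k}. s i = T2.\<tau> (snd (snd (q i)), fst (snd (q i))) \<and> fst (q i) \<in> carrier \<Gamma> \<and> fst (snd (q i)) \<in> homog M (inv\<^bsub>\<Gamma>\<^esub> fst (q i)) \<and> snd (snd (q i)) \<in> homog Md (fst (q i))"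
    by (rule exE)
  let ?d = "\<lambda>i. fst (q i)" and ?n = "\<lambda>i. fst (snd (q i))" and ?f = "\<lambda>i. snd (snd (q i))"
  have q': "s i = T2.\<tau> (?f i, ?n i)" "?d i \<in> carrier \<Gamma>" "?n i \<in> homog M (inv\<^bsub>\<Gamma>\<^esub> ?d i)" "?f i \<in> homog Md (?d i)"
    if "i < k" for i using q that by simp_all
  have cl: "T2.\<tau> (?f i, ?n i) \<in> carrier T2.T" if "i < k" for i
    by (rule T2.tau_closed[OF dual_homog_carrier[OF q'(4)[OF that]] homog_carrier[OF \<Gamma>.inv_closed[OF q'(2)[OF that]] q'(3)[OF that]]])
  have "t = finsum T2.T (\<lambda>i. T2.\<tau> (?f i, ?n i)) {..<k}"
    unfolding s(2) by (rule T2.T.M.finsum_cong'[OF refl]) (use q'(1) cl in auto)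
  then show ?thesis using that[of k ?d ?n ?f] q'(2-4) by blast
qed

end

section \<open>Sums of linear maps, and a criterion for graded bimodule isomorphisms\<close>

lemma linmap_finsum_maps:
  assumes "module R M" "module R N" "finite K" "\<And>k. k \<in> K \<Longrightarrow> h k \<in> linmap R M N"
  shows "(\<lambda>x. finsum N (\<lambda>k. h k x) K) \<in> linmap R M N"
  using assms(3,4)
proof (induction K rule: finite_induct)
  case empty
  interpret N: module R N by fact
  show ?case by (rule linmapI) simp_all
next
  case (insert k K)
  interpret N: module R N by fact
  have "(\<lambda>x. h k x \<oplus>\<^bsub>N\<^esub> finsum N (\<lambda>k. h k x) K) \<in> linmap R M N"
    using insert by (intro linmap_plus_maps[OF assms(1,2)]) auto
  then show ?case
  proof (rule linmap_cong[OF assms(1)])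
    fix x assume "x \<in> carrier M"
    then show "finsum N (\<lambda>k. h k x) (insert k K) = h k x \<oplus>\<^bsub>N\<^esub> finsum N (\<lambda>k. h k x) K"
      using insert linmap_closed by (intro N.M.finsum_insert) fastforce+
  qed
qed

text \<open>The inverse of a bijection inherits compatibility with all operations from
  \<open>h\<close>; only preservation of degrees has to be supplied. Closure of the carriers and of
  the components is asked for explicitly because \<open>M\<close> and \<open>N\<close> are bare
  records here.\<close>

lemma graded_bimodule_isoI:
  assumes h: "h \<in> graded_bimodule_hom R \<Gamma> A B M N" and k: "\<And>y. y \<in> carrier N \<Longrightarrow> k y \<in> carrier M"
    and kh: "\<And>x. x \<in> carrier M \<Longrightarrow> k (h x) = x" and hk: "\<And>y. y \<in> carrier N \<Longrightarrow> h (k y) = y"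
    and khom: "\<And>g y. \<lbrakk>g \<in> carrier \<Gamma>; y \<in> homog N g\<rbrakk> \<Longrightarrow> y \<in> carrier N \<and> k y \<in> homog M g"
    and cl: "\<And>x y. \<lbrakk>x \<in> carrier M; y \<in> carrier M\<rbrakk> \<Longrightarrow> x \<oplus>\<^bsub>M\<^esub> y \<in> carrier M"
      "\<And>r x. \<lbrakk>r \<in> carrier R; x \<in> carrier M\<rbrakk> \<Longrightarrow> r \<odot>\<^bsub>M\<^esub> x \<in> carrier M"
      "\<And>a x. \<lbrakk>a \<in> carrier A; x \<in> carrier M\<rbrakk> \<Longrightarrow> lact M a x \<in> carrier M"
      "\<And>x b. \<lbrakk>b \<in> carrier B; x \<in> carrier M\<rbrakk> \<Longrightarrow> ract M x b \<in> carrier M"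
  shows "graded_bimodule_iso R \<Gamma> A B M N"
proof -
  have H: "h x \<in> carrier N" "\<lbrakk>x \<in> carrier M; y \<in> carrier M\<rbrakk> \<Longrightarrow> h (x \<oplus>\<^bsub>M\<^esub> y) = h x \<oplus>\<^bsub>N\<^esub> h y"
    "r \<in> carrier R \<Longrightarrow> h (r \<odot>\<^bsub>M\<^esub> x) = r \<odot>\<^bsub>N\<^esub> h x" "a \<in> carrier A \<Longrightarrow> h (lact M a x) = lact N a (h x)"
    "b \<in> carrier B \<Longrightarrow> h (ract M x b) = ract N (h x) b" if "x \<in> carrier M" for x y r a b
    using h that by (auto simp: graded_bimodule_hom_def)
  have bij: "bij_betw h (carrier M) (carrier N)"
    by (rule bij_betw_byWitness[where f' = k]) (use kh hk H(1) k in auto)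
  let ?i = "inv_into (carrier M) h"
  have inj: "inj_on h (carrier M)" using bij by (rule bij_betw_imp_inj_on)
  have ik: "?i y = k y" if "y \<in> carrier N" for y
    using inv_into_f_f[OF inj k[OF that]] hk[OF that] by simp
  have kadd: "k (x \<oplus>\<^bsub>N\<^esub> y) = k x \<oplus>\<^bsub>M\<^esub> k y" and addc: "x \<oplus>\<^bsub>N\<^esub> y \<in> carrier N"
    if "x \<in> carrier N" "y \<in> carrier N" for x y
    using kh[OF cl(1)[OF k[OF that(1)] k[OF that(2)]]] H(1)[OF cl(1)[OF k[OF that(1)] k[OF that(2)]]]
      H(2)[OF k[OF that(1)] k[OF that(1)] k[OF that(2)]] hk that by auto
  have ksm: "k (r \<odot>\<^bsub>N\<^esub> y) = r \<odot>\<^bsub>M\<^esub> k y" and smc: "r \<odot>\<^bsub>N\<^esub> y \<in> carrier N" if "r \<in> carrier R" "y \<in> carrier N" for r y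
    using kh[OF cl(2)[OF that(1) k[OF that(2)]]] H(1)[OF cl(2)[OF that(1) k[OF that(2)]]]
      H(3)[OF k[OF that(2)] that(1)] hk that by auto
  have kla: "k (lact N a y) = lact M a (k y)" and lac: "lact N a y \<in> carrier N" if "a \<in> carrier A" "y \<in> carrier N" for a y
    using kh[OF cl(3)[OF that(1) k[OF that(2)]]] H(1)[OF cl(3)[OF that(1) k[OF that(2)]]]
      H(4)[OF k[OF that(2)] that(1)] hk that by auto
  have kra: "k (ract N y b) = ract M (k y) b" and rac: "ract N y b \<in> carrier N" if "b \<in> carrier B" "y \<in> carrier N" for b y
    using kh[OF cl(4)[OF that(1) k[OF that(2)]]] H(1)[OF cl(4)[OF that(1) k[OF that(2)]]]
      H(5)[OF k[OF that(2)] that(1)] hk that by auto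
  have "?i \<in> graded_bimodule_hom R \<Gamma> A B N M"
    using khom by (auto simp: graded_bimodule_hom_def ik k kadd addc ksm smc kla lac kra rac)
  then show ?thesis using h bij by (auto simp: graded_bimodule_iso_def)
qed

section \<open>Elementwise description of graded Morita equivalences\<close>

text \<open>
  The maps \<open>p j\<close> are right \<open>B\<close>-linear functionals with \<open>f j x \<cdot> y = x \<cdot> p j y\<close>. In this form the condition
  \<open>B \<cong> End\<^sub>A(M)\<^sup>o\<^sup>p\<close> becomes a finite system of identities, and such systems survive tensor products.
\<close>

locale morita_data = graded_bimodule_over R \<Gamma> D A B M
  for R (structure) and \<Gamma> (structure)
    and D :: "('o, 'g, 'c, 'w) acted_scheme" (structure)
    and A :: "('o, 'g, 'c, 'a, 'x) crossed_scheme" (structure)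
    and B :: "('o, 'g, 'c, 'b, 'y) crossed_scheme" (structure)
    and M :: "('o, 'g, 'a, 'b, 'm, 'z) bimod_scheme" (structure) +
  fixes J :: "'j set" and d :: "'j \<Rightarrow> 'g" and m :: "'j \<Rightarrow> 'm" and f :: "'j \<Rightarrow> 'm \<Rightarrow> 'a" and p :: "'j \<Rightarrow> 'm \<Rightarrow> 'b"
    and K :: "'k set" and e :: "'k \<Rightarrow> 'g" and n :: "'k \<Rightarrow> 'm" and q :: "'k \<Rightarrow> 'm \<Rightarrow> 'a"
  assumes finite_J: "finite J" and finite_K: "finite K"
    and d: "j \<in> J \<Longrightarrow> d j \<in> carrier \<Gamma>" and m: "j \<in> J \<Longrightarrow> m j \<in> homog M (inv\<^bsub>\<Gamma>\<^esub> d j)"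
    and f: "j \<in> J \<Longrightarrow> f j \<in> homog (dual_bimodule \<Gamma> A M) (d j)"
    and p: "j \<in> J \<Longrightarrow> p j \<in> linmap R M B"
    and p_ract: "\<lbrakk>j \<in> J; x \<in> carrier M; b \<in> carrier B\<rbrakk> \<Longrightarrow> p j (ract M x b) = p j x \<otimes>\<^bsub>B\<^esub> b"
    and p_homog: "\<lbrakk>j \<in> J; g \<in> carrier \<Gamma>; x \<in> homog M g\<rbrakk> \<Longrightarrow> p j x \<in> homog B (d j \<otimes>\<^bsub>\<Gamma>\<^esub> g)"
    and f_p: "\<lbrakk>j \<in> J; x \<in> carrier M; y \<in> carrier M\<rbrakk> \<Longrightarrow> lact M (f j x) y = ract M x (p j y)"
    and sum_p: "finsum B (\<lambda>j. p j (m j)) J = \<one>\<^bsub>B\<^esub>"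
    and e: "k \<in> K \<Longrightarrow> e k \<in> carrier \<Gamma>" and n: "k \<in> K \<Longrightarrow> n k \<in> homog M (inv\<^bsub>\<Gamma>\<^esub> e k)"
    and q: "k \<in> K \<Longrightarrow> q k \<in> homog (dual_bimodule \<Gamma> A M) (e k)"
    and sum_q: "finsum A (\<lambda>k. q k (n k)) K = \<one>\<^bsub>A\<^esub>"
begin

lemma f_dual: "j \<in> J \<Longrightarrow> f j \<in> carrier Md" and q_dual: "k \<in> K \<Longrightarrow> q k \<in> carrier Md"
  using f q dual_homog_carrier by blast+

lemma m_carrier: "j \<in> J \<Longrightarrow> m j \<in> carrier M" and n_carrier: "k \<in> K \<Longrightarrow> n k \<in> carrier M"
  using m n d e homog_carrier \<Gamma>.inv_closed by blast+

lemma p_closed: "\<lbrakk>j \<in> J; x \<in> carrier M\<rbrakk> \<Longrightarrow> p j x \<in> carrier B"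
  using linmap_closed[OF p] by blast

lemmas lact_sum = bilin_finsum[OF lact_bilin A.module_axioms module_axioms module_axioms]
lemmas ract_sum = bilin_finsum[OF ract_bilin module_axioms B.module_axioms module_axioms]
lemmas A_sum = bilin_finsum[OF A.mult_bilin A.module_axioms A.module_axioms A.module_axioms]
lemmas B_sum = bilin_finsum[OF B.mult_bilin B.module_axioms B.module_axioms B.module_axioms]

text \<open>Each term f_j(x) m_j equals x p_j(m_j), and the p_j(m_j) add up to 1.\<close>

lemma dual_basis: "x \<in> carrier M \<Longrightarrow> finsum M (\<lambda>j. lact M (f j x) (m j)) J = x"
proof -
  assume x: "x \<in> carrier M"
  have "finsum M (\<lambda>j. lact M (f j x) (m j)) J = finsum M (\<lambda>j. ract M x (p j (m j))) J"
    by (rule M.finsum_cong') (auto simp: f_p x m_carrier p_closed ract_closed)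
  also have "\<dots> = ract M x (finsum B (\<lambda>j. p j (m j)) J)"
    by (rule ract_sum(2)[symmetric, OF finite_J _ x]) (auto simp: p_closed m_carrier)
  finally show ?thesis using x by (simp add: sum_p ract_one)
qed

text \<open>An element b can be recovered from its action on the m_j, because b is the sum of
  p_j(m_j) b = p_j(m_j b).\<close>

lemma faithful:
  assumes "b \<in> carrier B" "b' \<in> carrier B" "\<And>x. x \<in> carrier M \<Longrightarrow> ract M x b = ract M x b'"
  shows "b = b'"
proof -
  have expand: "c = finsum B (\<lambda>j. p j (ract M (m j) c)) J" if c: "c \<in> carrier B" for c
  proof -
    have "c = finsum B (\<lambda>j. p j (m j)) J \<otimes>\<^bsub>B\<^esub> c" using c by (simp add: sum_p B_simps)
    also have "\<dots> = finsum B (\<lambda>j. p j (m j) \<otimes>\<^bsub>B\<^esub> c) J"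
      by (rule B_sum(1)[OF finite_J _ c]) (auto simp: p_closed m_carrier)
    also have "\<dots> = finsum B (\<lambda>j. p j (ract M (m j) c)) J"
      by (rule B.M.finsum_cong') (auto simp: p_ract m_carrier c p_closed ract_closed)
    finally show ?thesis .
  qed
  have "finsum B (\<lambda>j. p j (ract M (m j) b)) J = finsum B (\<lambda>j. p j (ract M (m j) b')) J"
    by (rule B.M.finsum_cong') (auto simp: assms m_carrier p_closed ract_closed)
  then show ?thesis using expand[OF assms(1)] expand[OF assms(2)] by simp
qed

text \<open>The second pairing of the Morita context: the element of \<open>B\<close> whose right
  action is x |-> h(x) y. The formula is forced: an element b is the sum of the p_j(m_j b), and here
  m_j b has to be h(m_j) y.\<close>

definition pairing :: "('m \<Rightarrow> 'a) \<Rightarrow> 'm \<Rightarrow> 'b" where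
  "pairing h y = finsum B (\<lambda>j. p j (lact M (h (m j)) y)) J"

lemma pairing_closed: "\<lbrakk>h \<in> carrier Md; y \<in> carrier M\<rbrakk> \<Longrightarrow> pairing h y \<in> carrier B"
  unfolding pairing_def by (intro B.M.finsum_closed) (auto intro!: p_closed lact_closed dual_closed m_carrier)

text \<open>x p_j(h(m_j) y) = f_j(x) h(m_j) y = h(f_j(x) m_j) y by \<open>f_p\<close> and linearity
  of \<open>h\<close>; summing over j and using the dual basis gives h(x) y.\<close>

lemma ract_pairing:
  assumes h: "h \<in> carrier Md" and y: "y \<in> carrier M" and x: "x \<in> carrier M"
  shows "ract M x (pairing h y) = lact M (h x) y"
proof -
  have c: "h (m j) \<in> carrier A" "f j x \<in> carrier A" if "j \<in> J" for j
    using that h x f_dual m_carrier dual_closed by auto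
  have "ract M x (pairing h y) = finsum M (\<lambda>j. ract M x (p j (lact M (h (m j)) y))) J"
    unfolding pairing_def by (rule ract_sum(2)[OF finite_J _ x]) (auto intro!: p_closed lact_closed c y)
  also have "\<dots> = finsum M (\<lambda>j. lact M (h (lact M (f j x) (m j))) y) J"
    by (rule M.finsum_cong')
      (auto simp: f_p[symmetric] x y c lact_closed lact_mult[symmetric] dual_lact[OF h] m_carrier A_simps)
  also have "\<dots> = lact M (finsum A (\<lambda>j. h (lact M (f j x) (m j))) J) y"
    by (rule lact_sum(1)[symmetric, OF finite_J _ y]) (auto intro!: dual_closed h lact_closed c m_carrier)
  also have "finsum A (\<lambda>j. h (lact M (f j x) (m j))) J = h (finsum M (\<lambda>j. lact M (f j x) (m j)) J)"
    by (rule linmap_finsum[symmetric, OF module_axioms A.module_axioms dual_linmap[OF h] finite_J])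
      (auto intro!: lact_closed c m_carrier)
  finally show ?thesis using dual_basis[OF x] by simp
qed

text \<open>By faithfulness the pairing is characterised by its action on M. Bilinearity,
  balancedness and linearity over \<open>B\<close> then become identities between actions, and the
  defining sum can be forgotten.\<close>

lemma pairing_eqI:
  assumes "h \<in> carrier Md" "y \<in> carrier M" "b \<in> carrier B"
    and "\<And>x. x \<in> carrier M \<Longrightarrow> ract M x b = lact M (h x) y"
  shows "pairing h y = b"
  using assms by (intro faithful) (auto simp: pairing_closed ract_pairing)

lemma pairing_bilin: "bilin R Md M B pairing"
proof (rule bilinI)
  show "pairing h y \<in> carrier B" if "h \<in> carrier Md" "y \<in> carrier M" for h y
    by (rule pairing_closed[OF that])
qed (auto intro!: pairing_eqI
      simp: dual_ops_closed dual_apply dual_closed pairing_closed ract_pairing ract_add_right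
        lact_add_left lact_add_right ract_smult lact_smult lact_smult_right)

lemma pairing_balanced:
  assumes "h \<in> carrier Md" "a \<in> carrier A" "y \<in> carrier M"
  shows "pairing (ract Md h a) y = pairing h (lact M a y)"
  using assms
  by (intro pairing_eqI) (auto simp: dual_ops_closed dual_apply dual_closed pairing_closed ract_pairing lact_closed lact_mult)

lemma pairing_lact:
  assumes "h \<in> carrier Md" "b \<in> carrier B" "y \<in> carrier M"
  shows "pairing (lact Md b h) y = b \<otimes>\<^bsub>B\<^esub> pairing h y"
  using assms
  by (intro pairing_eqI) (auto simp: dual_ops_closed dual_apply dual_closed pairing_closed ract_pairing ract_closed ract_mult B_simps)

lemma pairing_ract:
  assumes "h \<in> carrier Md" "b \<in> carrier B" "y \<in> carrier M"
  shows "pairing h (ract M y b) = pairing h y \<otimes>\<^bsub>B\<^esub> b"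
  using assms
  by (intro pairing_eqI) (auto simp: dual_closed pairing_closed ract_pairing ract_closed ract_mult B_simps lact_ract)

lemma pairing_f: "\<lbrakk>j \<in> J; y \<in> carrier M\<rbrakk> \<Longrightarrow> pairing (f j) y = p j y"
  by (intro pairing_eqI) (auto simp: f_dual f_p p_closed)

text \<open>For \<open>h\<close> of degree u and \<open>y\<close> of degree v, h(m_j) y has degree
  d_j^{-1} u v, and p_j multiplies it by d_j on the left. Every summand therefore has degree u
  v.\<close>

lemma pairing_homog:
  assumes "u \<in> carrier \<Gamma>" "v \<in> carrier \<Gamma>" "h \<in> homog Md u" "y \<in> homog M v"
  shows "pairing h y \<in> homog B (u \<otimes>\<^bsub>\<Gamma>\<^esub> v)"
  unfolding pairing_def
proof (rule B.submodule_finsum[OF B.homog_submodule finite_J])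
  show "u \<otimes>\<^bsub>\<Gamma>\<^esub> v \<in> carrier \<Gamma>" using assms by simp
  fix j assume j: "j \<in> J"
  have "h (m j) \<in> homog A (inv\<^bsub>\<Gamma>\<^esub> d j \<otimes>\<^bsub>\<Gamma>\<^esub> u)" using dual_homogD[OF assms(3) _ m[OF j]] d[OF j] by simp
  then have "lact M (h (m j)) y \<in> homog M (inv\<^bsub>\<Gamma>\<^esub> d j \<otimes>\<^bsub>\<Gamma>\<^esub> u \<otimes>\<^bsub>\<Gamma>\<^esub> v)"
    using lact_homog assms d[OF j] by simp
  then have "p j (lact M (h (m j)) y) \<in> homog B (d j \<otimes>\<^bsub>\<Gamma>\<^esub> (inv\<^bsub>\<Gamma>\<^esub> d j \<otimes>\<^bsub>\<Gamma>\<^esub> u \<otimes>\<^bsub>\<Gamma>\<^esub> v))"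
    using p_homog[OF j] assms d[OF j] by simp
  moreover have "d j \<otimes>\<^bsub>\<Gamma>\<^esub> (inv\<^bsub>\<Gamma>\<^esub> d j \<otimes>\<^bsub>\<Gamma>\<^esub> u \<otimes>\<^bsub>\<Gamma>\<^esub> v) = u \<otimes>\<^bsub>\<Gamma>\<^esub> v"
    using d[OF j] assms by (simp add: \<Gamma>.m_assoc[symmetric])
  ultimately show "p j (lact M (h (m j)) y) \<in> homog B (u \<otimes>\<^bsub>\<Gamma>\<^esub> v)" by simp
qed

text \<open>That evaluation inverts the proposed inverse from the left is the relation on the
  q_k(n_k). The other composite is the identity because h(x) n_k can be rewritten as a right
  multiple of x and its scalar moved across the tensor sign.\<close>

lemma T1_iso: "graded_bimodule_iso R \<Gamma> A A T1.T (regular_bimodule A)"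
proof -
  let ?ev = "presented_lift R A (\<lambda>(x, h). h x)"
  let ?s = "\<lambda>a. finsum T1.T (\<lambda>k. T1.\<tau> (lact M a (n k), q k)) K"
  have bal: "h (ract M x b) = lact Md b h x" if "x \<in> carrier M" "b \<in> carrier B" "h \<in> carrier Md" for x b h
    using that by (simp add: dual_apply)
  have lin: "?ev \<in> linmap R T1.T A" by (rule T1.balanced_lift_linmap[OF A.module_axioms dual_eval_bilin bal])
  have ev: "?ev (T1.\<tau> (x, h)) = h x" if "x \<in> carrier M" "h \<in> carrier Md" for x h
    by (rule T1.balanced_lift_tau[OF A.module_axioms dual_eval_bilin bal that])
  have tcl: "T1.\<tau> (lact M a (n k), q k) \<in> carrier T1.T" if "a \<in> carrier A" "k \<in> K" for a k
    using that by (intro T1.tau_closed lact_closed n_carrier q_dual)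
  have scl: "?s a \<in> carrier T1.T" if "a \<in> carrier A" for a
    using tcl[OF that] by (intro T1.T.M.finsum_closed) auto
  have ev_s: "?ev (?s a) = a" if a: "a \<in> carrier A" for a
  proof -
    have "?ev (?s a) = finsum A (\<lambda>k. ?ev (T1.\<tau> (lact M a (n k), q k))) K"
      by (rule linmap_finsum[OF T1.module_T A.module_axioms lin finite_K]) (use tcl[OF a] in auto)
    also have "\<dots> = finsum A (\<lambda>k. a \<otimes>\<^bsub>A\<^esub> q k (n k)) K"
      by (rule A.M.finsum_cong')
        (auto simp: ev lact_closed n_carrier q_dual a dual_lact A_simps dual_closed)
    also have "\<dots> = a \<otimes>\<^bsub>A\<^esub> finsum A (\<lambda>k. q k (n k)) K"
      by (rule A_sum(2)[symmetric, OF finite_K _ a]) (auto simp: n_carrier q_dual dual_closed)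
    finally show ?thesis using a by (simp add: sum_q A_simps)
  qed
  have slin: "?s \<in> linmap R A T1.T"
    by (rule linmap_finsum_maps[OF A.module_axioms T1.module_T finite_K
          linmap_compose[OF bilin_left[OF lact_bilin n_carrier] bilin_left[OF T1.tau_bilin q_dual]]])
  have s_ev: "?s (?ev t) = t" if t: "t \<in> carrier T1.T" for t
  proof (rule T1.linmap_eqI[OF T1.module_T linmap_compose[OF lin slin] _ _ t])
    show "(\<lambda>t. t) \<in> linmap R T1.T T1.T" by (rule linmapI) simp_all
    fix x h assume x: "x \<in> carrier M" and h: "h \<in> carrier Md"
    have hn: "pairing h (n k) \<in> carrier B" if "k \<in> K" for k using pairing_closed[OF h n_carrier[OF that]] .
    have lq: "lact Md (pairing h (n k)) (q k) \<in> carrier Md" if "k \<in> K" for k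
      using dual_ops_closed(4)[OF hn[OF that] q_dual[OF that]] .
    have "?s (?ev (T1.\<tau> (x, h))) = finsum T1.T (\<lambda>k. T1.\<tau> (lact M (h x) (n k), q k)) K"
      by (simp add: ev x h)
    \<comment> \<open>h(x) n_k = x b with b the pairing of h and n_k, and b passes to the functional
      q_k by balancedness. The first factor is then x in every term, and the sum moves into the
      second factor.\<close>
    also have "\<dots> = finsum T1.T (\<lambda>k. T1.\<tau> (x, lact Md (pairing h (n k)) (q k))) K"
      by (rule T1.T.M.finsum_cong'[OF refl])
        (auto simp: ract_pairing[OF h n_carrier x, symmetric] T1.tau_balanced[OF x hn q_dual] T1.tau_closed x lq)
    also have "\<dots> = T1.\<tau> (x, finsum Md (\<lambda>k. lact Md (pairing h (n k)) (q k)) K)"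
      by (rule bilin_finsum(2)[symmetric, OF T1.tau_bilin module_axioms module_dual T1.module_T finite_K _ x])
        (use lq in auto)
    \<comment> \<open>At z the k-th term is q_k(z b) with z b = h(z) n_k, hence h(z) q_k(n_k); these
      add up to h(z).\<close>
    also have "finsum Md (\<lambda>k. lact Md (pairing h (n k)) (q k)) K = h"
    proof (rule dual_ext[OF _ h])
      show "finsum Md (\<lambda>k. lact Md (pairing h (n k)) (q k)) K \<in> carrier Md"
        using lq by (intro Md.M.finsum_closed) auto
      fix z assume z: "z \<in> carrier M"
      have hz: "h z \<in> carrier A" using dual_closed[OF h z] .
      have "(finsum Md (\<lambda>k. lact Md (pairing h (n k)) (q k)) K) z =
          finsum A (\<lambda>k. (lact Md (pairing h (n k)) (q k)) z) K"
        by (rule linmap_finsum[OF module_dual A.module_axioms bilin_right[OF dual_eval_bilin z] finite_K])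
          (use lq in auto)
      also have "\<dots> = finsum A (\<lambda>k. h z \<otimes>\<^bsub>A\<^esub> q k (n k)) K"
        by (rule A.M.finsum_cong')
          (auto simp: dual_apply z ract_pairing[OF h n_carrier z] dual_lact q_dual hz n_carrier A_simps dual_closed)
      also have "\<dots> = h z \<otimes>\<^bsub>A\<^esub> finsum A (\<lambda>k. q k (n k)) K"
        by (rule A_sum(2)[symmetric, OF finite_K _ hz]) (auto simp: n_carrier q_dual dual_closed)
      finally show "(finsum Md (\<lambda>k. lact Md (pairing h (n k)) (q k)) K) z = h z"
        using hz by (simp add: sum_q A_simps)
    qed
    finally show "?s (?ev (T1.\<tau> (x, h))) = T1.\<tau> (x, h)" .
  qed
  have evl: "?ev (lact T1.T a t) = a \<otimes>\<^bsub>A\<^esub> ?ev t" if "a \<in> carrier A" "t \<in> carrier T1.T" for a t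
    by (rule T1.linmap_eqI[OF A.module_axioms linmap_compose[OF T1_acts(1)[OF that(1)] lin]
          linmap_compose[OF lin bilin_right[OF A.mult_bilin that(1)]] _ that(2)])
      (use that in \<open>simp add: T1_acts ev lact_closed dual_lact\<close>)
  have evr: "?ev (ract T1.T t a) = ?ev t \<otimes>\<^bsub>A\<^esub> a" if "a \<in> carrier A" "t \<in> carrier T1.T" for a t
    by (rule T1.linmap_eqI[OF A.module_axioms linmap_compose[OF T1_acts(2)[OF that(1)] lin]
          linmap_compose[OF lin bilin_left[OF A.mult_bilin that(1)]] _ that(2)])
      (use that in \<open>simp add: T1_acts ev dual_ops_closed dual_apply\<close>)
  have evh: "?ev t \<in> homog A u" if u: "u \<in> carrier \<Gamma>" and t: "t \<in> homog T1.T u" for u t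
  proof (rule linmap_span[OF T1.module_T A.module_axioms lin A.homog_submodule[OF u] T1_gens _ t[unfolded T1.homog_T]])
    fix s assume "s \<in> T1.homog_gens u"
    then obtain g h x k where s: "s = T1.\<tau> (x, k)" "g \<in> carrier \<Gamma>" "h \<in> carrier \<Gamma>" "g \<otimes>\<^bsub>\<Gamma>\<^esub> h = u"
      "x \<in> homog M g" "k \<in> homog Md h" by blast
    then show "?ev s \<in> homog A u"
      using dual_homogD[OF s(6,2,5)] ev[OF homog_carrier[OF s(2,5)] dual_homog_carrier[OF s(6)]] by simp
  qed
  show ?thesis
  proof (rule graded_bimodule_isoI[where k = ?s])
    show "?ev \<in> graded_bimodule_hom R \<Gamma> A A T1.T (regular_bimodule A)"
      using evh by (auto simp: graded_bimodule_hom_def regular_bimodule_def linmap_closed[OF lin] linmap_add[OF lin]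
          linmap_smult[OF lin] evl evr)
    fix g a assume g: "g \<in> carrier \<Gamma>" and a: "a \<in> homog (regular_bimodule A) g"
    then have a: "a \<in> homog A g" by (simp add: regular_bimodule_def)
    have "?s a \<in> homog T1.T g"
    proof (rule T1.T.submodule_finsum[OF T1_homog_submodule finite_K])
      fix k assume k: "k \<in> K"
      show "T1.\<tau> (lact M a (n k), q k) \<in> homog T1.T g"
        using g e[OF k] lact_homog[OF g _ a n[OF k]] q[OF k]
        by (intro T1_homogI[where g = "g \<otimes>\<^bsub>\<Gamma>\<^esub> inv\<^bsub>\<Gamma>\<^esub> e k" and h = "e k"]) (simp_all add: \<Gamma>.m_assoc)
    qed
    then show "a \<in> carrier (regular_bimodule A) \<and> ?s a \<in> homog T1.T g"
      using A.homog_carrier[OF g a] by (simp add: regular_bimodule_def)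
  qed (simp_all add: regular_bimodule_def scl s_ev ev_s linmap_closed[OF T1_acts(1)] linmap_closed[OF T1_acts(2)])
qed

text \<open>One composite is the identity by the relation on the p_j(m_j), the other by the dual
  basis, after the pairing with h and y has been traded for the scalar f_j(y) in
  \<open>A\<close>.\<close>

lemma T2_iso: "graded_bimodule_iso R \<Gamma> B B T2.T (regular_bimodule B)"
proof -
  let ?c = "presented_lift R B (\<lambda>(h, x). pairing h x)"
  let ?s = "\<lambda>b. finsum T2.T (\<lambda>j. T2.\<tau> (lact Md b (f j), m j)) J"
  have lin: "?c \<in> linmap R T2.T B"
    by (rule T2.balanced_lift_linmap[OF B.module_axioms pairing_bilin pairing_balanced])
  have cv: "?c (T2.\<tau> (h, x)) = pairing h x" if "h \<in> carrier Md" "x \<in> carrier M" for h x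
    by (rule T2.balanced_lift_tau[OF B.module_axioms pairing_bilin pairing_balanced that])
  have tcl: "T2.\<tau> (lact Md b (f j), m j) \<in> carrier T2.T" if "b \<in> carrier B" "j \<in> J" for b j
    using that by (intro T2.tau_closed dual_ops_closed m_carrier f_dual)
  have scl: "?s b \<in> carrier T2.T" if "b \<in> carrier B" for b
    using tcl[OF that] by (intro T2.T.M.finsum_closed) auto
  have c_s: "?c (?s b) = b" if b: "b \<in> carrier B" for b
  proof -
    have "?c (?s b) = finsum B (\<lambda>j. ?c (T2.\<tau> (lact Md b (f j), m j))) J"
      by (rule linmap_finsum[OF T2.module_T B.module_axioms lin finite_J]) (use tcl[OF b] in auto)
    also have "\<dots> = finsum B (\<lambda>j. b \<otimes>\<^bsub>B\<^esub> p j (m j)) J"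
      by (rule B.M.finsum_cong')
        (auto simp: cv dual_ops_closed m_carrier f_dual b pairing_lact pairing_f B_simps p_closed)
    also have "\<dots> = b \<otimes>\<^bsub>B\<^esub> finsum B (\<lambda>j. p j (m j)) J"
      by (rule B_sum(2)[symmetric, OF finite_J _ b]) (auto simp: m_carrier p_closed)
    finally show ?thesis using b by (simp add: sum_p B_simps)
  qed
  have slin: "?s \<in> linmap R B T2.T"
    by (rule linmap_finsum_maps[OF B.module_axioms T2.module_T finite_J
          linmap_compose[OF bilin_left[OF dual_lact_bilin f_dual] bilin_left[OF T2.tau_bilin m_carrier]]])
  have s_c: "?s (?c t) = t" if t: "t \<in> carrier T2.T" for t
  proof (rule T2.linmap_eqI[OF T2.module_T linmap_compose[OF lin slin] _ _ t])
    show "(\<lambda>t. t) \<in> linmap R T2.T T2.T" by (rule linmapI) simp_all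
    fix h y assume h: "h \<in> carrier Md" and y: "y \<in> carrier M"
    have fy: "f j y \<in> carrier A" if "j \<in> J" for j using dual_closed[OF f_dual[OF that] y] .
    \<comment> \<open>With b the pairing of h and y, both sides send z to f_j(z b) = f_j(h(z) y) =
      h(z) f_j(y). The scalar f_j(y) then crosses the tensor sign, where it meets m_j.\<close>
    have eq: "lact Md (pairing h y) (f j) = ract Md h (f j y)" if j: "j \<in> J" for j
      using h y j fy[OF j] f_dual[OF j]
      by (intro dual_ext) (simp_all add: dual_ops_closed pairing_closed dual_apply ract_pairing dual_lact dual_closed)
    have "?s (?c (T2.\<tau> (h, y))) = finsum T2.T (\<lambda>j. T2.\<tau> (lact Md (pairing h y) (f j), m j)) J"
      by (simp add: cv y h)
    also have "\<dots> = finsum T2.T (\<lambda>j. T2.\<tau> (h, lact M (f j y) (m j))) J"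
      by (rule T2.T.M.finsum_cong'[OF refl])
        (auto simp: eq T2.tau_balanced[OF h fy m_carrier] T2.tau_closed h lact_closed fy m_carrier)
    also have "\<dots> = T2.\<tau> (h, finsum M (\<lambda>j. lact M (f j y) (m j)) J)"
      by (rule bilin_finsum(2)[symmetric, OF T2.tau_bilin module_dual module_axioms T2.module_T finite_J _ h])
        (auto simp: lact_closed fy m_carrier)
    finally show "?s (?c (T2.\<tau> (h, y))) = T2.\<tau> (h, y)" by (simp add: dual_basis[OF y])
  qed
  have cl: "?c (lact T2.T b t) = b \<otimes>\<^bsub>B\<^esub> ?c t" if "b \<in> carrier B" "t \<in> carrier T2.T" for b t
    by (rule T2.linmap_eqI[OF B.module_axioms linmap_compose[OF T2_acts(1)[OF that(1)] lin]
          linmap_compose[OF lin bilin_right[OF B.mult_bilin that(1)]] _ that(2)])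
      (use that in \<open>simp add: T2_acts cv dual_ops_closed pairing_lact\<close>)
  have cr: "?c (ract T2.T t b) = ?c t \<otimes>\<^bsub>B\<^esub> b" if "b \<in> carrier B" "t \<in> carrier T2.T" for b t
    by (rule T2.linmap_eqI[OF B.module_axioms linmap_compose[OF T2_acts(2)[OF that(1)] lin]
          linmap_compose[OF lin bilin_left[OF B.mult_bilin that(1)]] _ that(2)])
      (use that in \<open>simp add: T2_acts cv ract_closed pairing_ract\<close>)
  have ch: "?c t \<in> homog B u" if u: "u \<in> carrier \<Gamma>" and t: "t \<in> homog T2.T u" for u t
  proof (rule linmap_span[OF T2.module_T B.module_axioms lin B.homog_submodule[OF u] T2_gens _ t[unfolded T2.homog_T]])
    fix s assume "s \<in> T2.homog_gens u"
    then obtain g h x k where s: "s = T2.\<tau> (k, x)" "g \<in> carrier \<Gamma>" "h \<in> carrier \<Gamma>" "g \<otimes>\<^bsub>\<Gamma>\<^esub> h = u"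
      "x \<in> homog M h" "k \<in> homog Md g" by blast
    then show "?c s \<in> homog B u"
      using pairing_homog[OF s(2,3,6,5)] cv[OF dual_homog_carrier[OF s(6)] homog_carrier[OF s(3,5)]] by simp
  qed
  show ?thesis
  proof (rule graded_bimodule_isoI[where k = ?s])
    show "?c \<in> graded_bimodule_hom R \<Gamma> B B T2.T (regular_bimodule B)"
      using ch by (auto simp: graded_bimodule_hom_def regular_bimodule_def linmap_closed[OF lin] linmap_add[OF lin]
          linmap_smult[OF lin] cl cr)
    fix g b assume g: "g \<in> carrier \<Gamma>" and b: "b \<in> homog (regular_bimodule B) g"
    then have b: "b \<in> homog B g" by (simp add: regular_bimodule_def)
    have bc: "b \<in> carrier B" by (rule B.homog_carrier[OF g b])
    have "?s b \<in> homog T2.T g"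
    proof (rule T2.T.submodule_finsum[OF T2_homog_submodule finite_J])
      fix j assume j: "j \<in> J"
      \<comment> \<open>The functional b f_j sends x to f_j(x b). For x of degree h the argument x b
        has degree h g, so the value has degree h g d_j.\<close>
      have "lact Md b (f j) \<in> homog Md (g \<otimes>\<^bsub>\<Gamma>\<^esub> d j)"
      proof (rule dual_homogI)
        fix h x assume h: "h \<in> carrier \<Gamma>" and x: "x \<in> homog M h"
        then show "lact Md b (f j) x \<in> homog A (h \<otimes>\<^bsub>\<Gamma>\<^esub> (g \<otimes>\<^bsub>\<Gamma>\<^esub> d j))"
          using dual_homogD[OF f[OF j] _ ract_homog[OF g h b x]] g d[OF j] homog_carrier[OF h x]
          by (simp add: dual_apply \<Gamma>.m_assoc)
      qed (rule dual_ops_closed(4)[OF bc f_dual[OF j]])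
      then show "T2.\<tau> (lact Md b (f j), m j) \<in> homog T2.T g"
        using g d[OF j] m[OF j]
        by (intro T2_homogI[where g = "g \<otimes>\<^bsub>\<Gamma>\<^esub> d j" and h = "inv\<^bsub>\<Gamma>\<^esub> d j"]) (simp_all add: \<Gamma>.m_assoc)
    qed
    then show "b \<in> carrier (regular_bimodule B) \<and> ?s b \<in> homog T2.T g"
      using bc by (simp add: regular_bimodule_def)
  qed (simp_all add: regular_bimodule_def scl s_c c_s linmap_closed[OF T2_acts(1)] linmap_closed[OF T2_acts(2)])
qed

theorem induces: "induces_graded_Morita_equivalence R \<Gamma> D A B M"
  unfolding induces_graded_Morita_equivalence_def
  using graded_bimodule_over_axioms T1_iso T2_iso by blast

end

lemma graded_bimodule_homD:
  assumes "h \<in> graded_bimodule_hom R \<Gamma> A B M N"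
  shows "h \<in> linmap R M N"
    and "\<lbrakk>a \<in> carrier A; x \<in> carrier M\<rbrakk> \<Longrightarrow> h (lact M a x) = lact N a (h x)"
    and "\<lbrakk>b \<in> carrier B; x \<in> carrier M\<rbrakk> \<Longrightarrow> h (ract M x b) = ract N (h x) b"
    and "\<lbrakk>g \<in> carrier \<Gamma>; x \<in> homog M g\<rbrakk> \<Longrightarrow> h x \<in> homog N g"
  using assms unfolding graded_bimodule_hom_def linmap_def by (auto, blast)

lemma regular_bimodule_fields [simp]:
  "carrier (regular_bimodule A) = carrier A" "add (regular_bimodule A) = add A" "zero (regular_bimodule A) = zero A"
  "smult (regular_bimodule A) = smult A" "homog (regular_bimodule A) = homog A"
  "lact (regular_bimodule A) = mult A" "ract (regular_bimodule A) = mult A"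
  by (simp_all add: regular_bimodule_def)

context graded_bimodule_over begin

text \<open>
  Write \<open>[x, h]\<close> and \<open>\<langle>h, y\<rangle>\<close> for the images of \<open>x \<otimes> h\<close> and \<open>h \<otimes> y\<close> under the two given isomorphisms, and
  \<open>1 = \<Sum> \<langle>f i, m i\<rangle> = \<Sum> [n i, q i]\<close>. The isomorphisms need not be compatible: \<open>[x, h] y\<close> and \<open>x \<langle>h, y\<rangle>\<close>
  differ by the bimodule automorphism \<open>\<theta> x = \<Sum> [x, f i] m i\<close>, whose inverse is \<open>\<eta> x = \<Sum> n i \<langle>q i, x\<rangle>\<close>.
\<close>

lemma morita_data_exists:
  assumes iso1: "graded_bimodule_iso R \<Gamma> A A T1.T (regular_bimodule A)"
    and iso2: "graded_bimodule_iso R \<Gamma> B B T2.T (regular_bimodule B)"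
  shows "\<exists>(J :: nat set) d m f p (K :: nat set) e n q. morita_data R \<Gamma> D A B M J d m f p K e n q"
proof -
  obtain \<phi> where \<phi>: "\<phi> \<in> graded_bimodule_hom R \<Gamma> A A T1.T (regular_bimodule A)"
    "bij_betw \<phi> (carrier T1.T) (carrier A)"
    "inv_into (carrier T1.T) \<phi> \<in> graded_bimodule_hom R \<Gamma> A A (regular_bimodule A) T1.T"
    using iso1 by (auto simp: graded_bimodule_iso_def)
  obtain \<psi> where \<psi>: "\<psi> \<in> graded_bimodule_hom R \<Gamma> B B T2.T (regular_bimodule B)"
    "bij_betw \<psi> (carrier T2.T) (carrier B)"
    "inv_into (carrier T2.T) \<psi> \<in> graded_bimodule_hom R \<Gamma> B B (regular_bimodule B) T2.T"
    using iso2 by (auto simp: graded_bimodule_iso_def)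
  have \<phi>lin: "\<phi> \<in> linmap R T1.T A" and \<psi>lin: "\<psi> \<in> linmap R T2.T B"
    using graded_bimodule_homD(1)[OF \<phi>(1)] graded_bimodule_homD(1)[OF \<psi>(1)] by (simp_all add: linmap_def)
  note \<phi>D = graded_bimodule_homD(2-4)[OF \<phi>(1), simplified] and \<psi>D = graded_bimodule_homD(2-4)[OF \<psi>(1), simplified]
  have \<phi>inj: "t = t'" if "\<phi> t = \<phi> t'" "t \<in> carrier T1.T" "t' \<in> carrier T1.T" for t t'
    using \<phi>(2) that by (auto simp: bij_betw_def dest: inj_onD)
  have \<psi>inj: "t = t'" if "\<psi> t = \<psi> t'" "t \<in> carrier T2.T" "t' \<in> carrier T2.T" for t t'
    using \<psi>(2) that by (auto simp: bij_betw_def dest: inj_onD)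
  \<comment> \<open>Preimages of the two units. Both have degree one, because 1 does and the inverse
    isomorphisms preserve degrees; so both split into homogeneous pure tensors of opposite
    degrees.\<close>
  define t1 where "t1 = inv_into (carrier T1.T) \<phi> \<one>\<^bsub>A\<^esub>"
  define t2 where "t2 = inv_into (carrier T2.T) \<psi> \<one>\<^bsub>B\<^esub>"
  have t1h: "t1 \<in> homog T1.T \<one>\<^bsub>\<Gamma>\<^esub>" unfolding t1_def
    using graded_bimodule_homD(4)[OF \<phi>(3), of "\<one>\<^bsub>\<Gamma>\<^esub>" "\<one>\<^bsub>A\<^esub>"] A.one_homog by simp
  have t2h: "t2 \<in> homog T2.T \<one>\<^bsub>\<Gamma>\<^esub>" unfolding t2_def
    using graded_bimodule_homD(4)[OF \<psi>(3), of "\<one>\<^bsub>\<Gamma>\<^esub>" "\<one>\<^bsub>B\<^esub>"] B.one_homog by simp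
  have t1: "t1 \<in> carrier T1.T" "\<phi> t1 = \<one>\<^bsub>A\<^esub>"
    using \<phi>(2) A_simps(1) unfolding t1_def by (auto simp: bij_betw_def inv_into_into f_inv_into_f)
  have t2: "t2 \<in> carrier T2.T" "\<psi> t2 = \<one>\<^bsub>B\<^esub>"
    using \<psi>(2) B_simps(1) unfolding t2_def by (auto simp: bij_betw_def inv_into_into f_inv_into_f)
  obtain k1 :: nat and e n q where nq: "\<And>i. i < k1 \<Longrightarrow> e i \<in> carrier \<Gamma>" "\<And>i. i < k1 \<Longrightarrow> n i \<in> homog M (inv\<^bsub>\<Gamma>\<^esub> e i)"
    "\<And>i. i < k1 \<Longrightarrow> q i \<in> homog Md (e i)" "t1 = finsum T1.T (\<lambda>i. T1.\<tau> (n i, q i)) {..<k1}"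
    using T1_homog_finsum[OF t1h] by blast
  obtain k2 :: nat and d m f where mf: "\<And>i. i < k2 \<Longrightarrow> d i \<in> carrier \<Gamma>" "\<And>i. i < k2 \<Longrightarrow> m i \<in> homog M (inv\<^bsub>\<Gamma>\<^esub> d i)"
    "\<And>i. i < k2 \<Longrightarrow> f i \<in> homog Md (d i)" "t2 = finsum T2.T (\<lambda>i. T2.\<tau> (f i, m i)) {..<k2}"
    using T2_homog_finsum[OF t2h] by blast
  have nc: "n i \<in> carrier M" "q i \<in> carrier Md" if "i < k1" for i
    using nq(1-3)[OF that] homog_carrier dual_homog_carrier \<Gamma>.inv_closed by blast+
  have mc: "m i \<in> carrier M" "f i \<in> carrier Md" if "i < k2" for i
    using mf(1-3)[OF that] homog_carrier dual_homog_carrier \<Gamma>.inv_closed by blast+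
  \<comment> \<open>\<open>br x h\<close> is [x, h]; \<open>pr h x\<close>, defined next, is the
    bracket of h and x with values in \<open>B\<close>.\<close>
  define br where "br x h = \<phi> (T1.\<tau> (x, h))" for x h
  define pr where "pr h x = \<psi> (T2.\<tau> (h, x))" for h x
  have br: "bilin R M Md A br" unfolding br_def by (rule bilin_compose[OF T1.tau_bilin \<phi>lin])
  have pr: "bilin R Md M B pr" unfolding pr_def by (rule bilin_compose[OF T2.tau_bilin \<psi>lin])
  note brc = bilin_closed[OF br] and prc = bilin_closed[OF pr]
  have br_l: "br (lact M a x) h = a \<otimes>\<^bsub>A\<^esub> br x h" and br_r: "br x (ract Md h a) = br x h \<otimes>\<^bsub>A\<^esub> a"
    if "a \<in> carrier A" "x \<in> carrier M" "h \<in> carrier Md" for a x h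
    using \<phi>D(1,2)[OF that(1) T1.tau_closed[OF that(2,3)]] T1_acts(3,4)[OF that] by (simp_all add: br_def)
  have pr_l: "pr (lact Md b h) x = b \<otimes>\<^bsub>B\<^esub> pr h x" and pr_r: "pr h (ract M x b) = pr h x \<otimes>\<^bsub>B\<^esub> b"
    if "b \<in> carrier B" "h \<in> carrier Md" "x \<in> carrier M" for b x h
    using \<psi>D(1,2)[OF that(1) T2.tau_closed[OF that(2,3)]] T2_acts(3,4)[OF that] by (simp_all add: pr_def)
  have br_b: "br (ract M x b) h = br x (lact Md b h)" if "x \<in> carrier M" "b \<in> carrier B" "h \<in> carrier Md" for b x h
    using T1.tau_balanced[OF that] by (simp add: br_def)
  have pr_b: "pr (ract Md h a) x = pr h (lact M a x)" if "h \<in> carrier Md" "a \<in> carrier A" "x \<in> carrier M" for a x h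
    using T2.tau_balanced[OF that] by (simp add: pr_def)
  have br_h: "br x h \<in> homog A (u \<otimes>\<^bsub>\<Gamma>\<^esub> v)"
    if "u \<in> carrier \<Gamma>" "v \<in> carrier \<Gamma>" "x \<in> homog M u" "h \<in> homog Md v" for x h u v
    using \<phi>D(3)[OF _ T1_homogI[OF that(1,2) refl that(3,4)]] that by (simp add: br_def)
  have pr_h: "pr h x \<in> homog B (u \<otimes>\<^bsub>\<Gamma>\<^esub> v)"
    if "u \<in> carrier \<Gamma>" "v \<in> carrier \<Gamma>" "h \<in> homog Md u" "x \<in> homog M v" for x h u v
    using \<psi>D(3)[OF _ T2_homogI[OF that(1,2) refl that(3,4)]] that by (simp add: pr_def)
  have sum_br: "finsum A (\<lambda>i. br (n i) (q i)) {..<k1} = \<one>\<^bsub>A\<^esub>"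
    using linmap_finsum[OF T1.module_T A.module_axioms \<phi>lin, of "{..<k1}" "\<lambda>i. T1.\<tau> (n i, q i)"] nc t1(2)
    by (simp add: br_def nq(4) T1.tau_closed Pi_iff)
  have sum_pr: "finsum B (\<lambda>i. pr (f i) (m i)) {..<k2} = \<one>\<^bsub>B\<^esub>"
    using linmap_finsum[OF T2.module_T B.module_axioms \<psi>lin, of "{..<k2}" "\<lambda>i. T2.\<tau> (f i, m i)"] mc t2(2)
    by (simp add: pr_def mf(4) T2.tau_closed Pi_iff)
  define \<theta> where "\<theta> x = finsum M (\<lambda>i. lact M (br x (f i)) (m i)) {..<k2}" for x
  define \<eta> where "\<eta> x = finsum M (\<lambda>i. ract M (n i) (pr (q i) x)) {..<k1}" for x
  have \<theta>lin: "\<theta> \<in> linmap R M M" unfolding \<theta>_def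
    by (rule linmap_finsum_maps[OF module_axioms module_axioms])
      (auto intro!: linmap_compose[OF bilin_left[OF br] bilin_left[OF lact_bilin]] mc)
  have \<eta>lin: "\<eta> \<in> linmap R M M" unfolding \<eta>_def
    by (rule linmap_finsum_maps[OF module_axioms module_axioms])
      (auto intro!: linmap_compose[OF bilin_right[OF pr] bilin_right[OF ract_bilin]] nc)
  note \<theta>c = linmap_closed[OF \<theta>lin] and \<eta>c = linmap_closed[OF \<eta>lin]
  \<comment> \<open>Let b be \<open>pr h y\<close>. Linearity over \<open>B\<close> and injectivity
    of \<psi> force b t2 = h \<otimes> y. Applying the linear map h \<otimes> y |-> [x, h] y to both
    sides gives [x, h] y on the right and, moving b from the f_i to x, \<theta>(x b) on the
    left.\<close>
  have \<theta>pr: "\<theta> (ract M x (pr h y)) = lact M (br x h) y"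
    if x: "x \<in> carrier M" and h: "h \<in> carrier Md" and y: "y \<in> carrier M" for x h y
  proof -
    let ?L = "presented_lift R M (\<lambda>(h, y). lact M (br x h) y)"
    have b: "bilin R Md M M (\<lambda>h y. lact M (br x h) y)"
      by (rule bilin_compose_left[OF lact_bilin bilin_right[OF br x]])
    have bal: "lact M (br x (ract Md h a)) y = lact M (br x h) (lact M a y)"
      if "h \<in> carrier Md" "a \<in> carrier A" "y \<in> carrier M" for h a y
      using that x by (simp add: br_r brc lact_mult)
    have L: "?L \<in> linmap R T2.T M" by (rule T2.balanced_lift_linmap[OF module_axioms b bal])
    have Lt: "?L (T2.\<tau> (h, y)) = lact M (br x h) y" if "h \<in> carrier Md" "y \<in> carrier M" for h y
      by (rule T2.balanced_lift_tau[OF module_axioms b bal that])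
    have c: "pr h y \<in> carrier B" by (rule prc[OF h y])
    have "lact T2.T (pr h y) t2 = T2.\<tau> (h, y)"
    proof (rule \<psi>inj)
      show "\<psi> (lact T2.T (pr h y) t2) = \<psi> (T2.\<tau> (h, y))"
        using \<psi>D(1)[OF c t2(1)] c by (simp add: t2(2) B_simps pr_def)
    qed (use linmap_closed[OF T2_acts(1)[OF c] t2(1)] T2.tau_closed[OF h y] in auto)
    moreover have "lact T2.T (pr h y) t2 = finsum T2.T (\<lambda>i. T2.\<tau> (lact Md (pr h y) (f i), m i)) {..<k2}"
    proof -
      have "lact T2.T (pr h y) t2 = finsum T2.T (\<lambda>i. lact T2.T (pr h y) (T2.\<tau> (f i, m i))) {..<k2}"
        unfolding mf(4)
        by (rule linmap_finsum[OF T2.module_T T2.module_T T2_acts(1)[OF c]]) (auto intro!: T2.tau_closed mc)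
      also have "\<dots> = finsum T2.T (\<lambda>i. T2.\<tau> (lact Md (pr h y) (f i), m i)) {..<k2}"
        by (rule T2.T.M.finsum_cong'[OF refl])
          (auto simp: T2_acts(3)[OF c] mc intro!: T2.tau_closed dual_ops_closed c mc)
      finally show ?thesis .
    qed
    ultimately have "lact M (br x h) y = ?L (finsum T2.T (\<lambda>i. T2.\<tau> (lact Md (pr h y) (f i), m i)) {..<k2})"
      using Lt[OF h y] by simp
    also have "\<dots> = finsum M (\<lambda>i. ?L (T2.\<tau> (lact Md (pr h y) (f i), m i))) {..<k2}"
      by (rule linmap_finsum[OF T2.module_T module_axioms L]) (auto intro!: T2.tau_closed dual_ops_closed c mc)
    also have "\<dots> = finsum M (\<lambda>i. lact M (br (ract M x (pr h y)) (f i)) (m i)) {..<k2}"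
      by (rule M.finsum_cong')
        (auto simp: Lt dual_ops_closed c mc br_b[OF x c] intro!: lact_closed brc ract_closed x c mc)
    finally show ?thesis by (simp add: \<theta>_def)
  qed
  \<comment> \<open>The mirror image: with a = [x, h], injectivity of \<phi> gives t1 a = x
    \<otimes> h. The linear map x \<otimes> h |-> x (\<open>pr h y\<close>) turns the left side into
    \<eta>(a y), because a moves from the q_i to y.\<close>
  have \<eta>br: "\<eta> (lact M (br x h) y) = ract M x (pr h y)"
    if x: "x \<in> carrier M" and h: "h \<in> carrier Md" and y: "y \<in> carrier M" for x h y
  proof -
    let ?L = "presented_lift R M (\<lambda>(x, h). ract M x (pr h y))"
    have b: "bilin R M Md M (\<lambda>x h. ract M x (pr h y))"
      by (rule bilin_compose_right[OF ract_bilin bilin_left[OF pr y]])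
    have bal: "ract M (ract M x b) (pr h y) = ract M x (pr (lact Md b h) y)"
      if "x \<in> carrier M" "b \<in> carrier B" "h \<in> carrier Md" for x b h
      using that y by (simp add: pr_l prc ract_mult)
    have L: "?L \<in> linmap R T1.T M" by (rule T1.balanced_lift_linmap[OF module_axioms b bal])
    have Lt: "?L (T1.\<tau> (x, h)) = ract M x (pr h y)" if "x \<in> carrier M" "h \<in> carrier Md" for x h
      by (rule T1.balanced_lift_tau[OF module_axioms b bal that])
    have c: "br x h \<in> carrier A" by (rule brc[OF x h])
    have "ract T1.T t1 (br x h) = T1.\<tau> (x, h)"
    proof (rule \<phi>inj)
      show "\<phi> (ract T1.T t1 (br x h)) = \<phi> (T1.\<tau> (x, h))"
        using \<phi>D(2)[OF c t1(1)] c by (simp add: t1(2) A_simps br_def)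
    qed (use linmap_closed[OF T1_acts(2)[OF c] t1(1)] T1.tau_closed[OF x h] in auto)
    moreover have "ract T1.T t1 (br x h) = finsum T1.T (\<lambda>i. T1.\<tau> (n i, ract Md (q i) (br x h))) {..<k1}"
    proof -
      have "ract T1.T t1 (br x h) = finsum T1.T (\<lambda>i. ract T1.T (T1.\<tau> (n i, q i)) (br x h)) {..<k1}"
        unfolding nq(4)
        by (rule linmap_finsum[OF T1.module_T T1.module_T T1_acts(2)[OF c]]) (auto intro!: T1.tau_closed nc)
      also have "\<dots> = finsum T1.T (\<lambda>i. T1.\<tau> (n i, ract Md (q i) (br x h))) {..<k1}"
        by (rule T1.T.M.finsum_cong'[OF refl])
          (auto simp: T1_acts(4)[OF c] nc intro!: T1.tau_closed dual_ops_closed c nc)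
      finally show ?thesis .
    qed
    ultimately have "ract M x (pr h y) = ?L (finsum T1.T (\<lambda>i. T1.\<tau> (n i, ract Md (q i) (br x h))) {..<k1})"
      using Lt[OF x h] by simp
    also have "\<dots> = finsum M (\<lambda>i. ?L (T1.\<tau> (n i, ract Md (q i) (br x h)))) {..<k1}"
      by (rule linmap_finsum[OF T1.module_T module_axioms L]) (auto intro!: T1.tau_closed dual_ops_closed c nc)
    also have "\<dots> = finsum M (\<lambda>i. ract M (n i) (pr (q i) (lact M (br x h) y))) {..<k1}"
      by (rule M.finsum_cong')
        (auto simp: Lt dual_ops_closed c nc pr_b[OF _ c y] intro!: ract_closed prc lact_closed y c nc)
    finally show ?thesis by (simp add: \<eta>_def)
  qed
  have \<eta>\<theta>: "\<eta> (\<theta> x) = x" if x: "x \<in> carrier M" for x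
  proof -
    have "\<eta> (\<theta> x) = finsum M (\<lambda>i. \<eta> (lact M (br x (f i)) (m i))) {..<k2}"
      unfolding \<theta>_def
      by (rule linmap_finsum[OF module_axioms module_axioms \<eta>lin]) (auto intro!: lact_closed brc x mc)
    also have "\<dots> = finsum M (\<lambda>i. ract M x (pr (f i) (m i))) {..<k2}"
      by (rule M.finsum_cong') (auto simp: \<eta>br x mc intro!: ract_closed prc x mc)
    also have "\<dots> = ract M x (finsum B (\<lambda>i. pr (f i) (m i)) {..<k2})"
      by (rule bilin_finsum(2)[symmetric, OF ract_bilin module_axioms B.module_axioms module_axioms _ _ x])
        (auto intro!: prc mc)
    finally show ?thesis using x by (simp add: sum_pr ract_one)
  qed
  have \<theta>\<eta>: "\<theta> (\<eta> x) = x" if x: "x \<in> carrier M" for x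
  proof -
    have "\<theta> (\<eta> x) = finsum M (\<lambda>i. \<theta> (ract M (n i) (pr (q i) x))) {..<k1}"
      unfolding \<eta>_def
      by (rule linmap_finsum[OF module_axioms module_axioms \<theta>lin]) (auto intro!: ract_closed prc x nc)
    also have "\<dots> = finsum M (\<lambda>i. lact M (br (n i) (q i)) x) {..<k1}"
      by (rule M.finsum_cong') (auto simp: \<theta>pr x nc intro!: lact_closed brc x nc)
    also have "\<dots> = lact M (finsum A (\<lambda>i. br (n i) (q i)) {..<k1}) x"
      by (rule bilin_finsum(1)[symmetric, OF lact_bilin A.module_axioms module_axioms module_axioms _ _ x])
        (auto intro!: brc nc)
    finally show ?thesis using x by (simp add: sum_br lact_one)
  qed
  have \<theta>l: "\<theta> (lact M a x) = lact M a (\<theta> x)" if a: "a \<in> carrier A" and x: "x \<in> carrier M" for a x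
  proof -
    have "\<theta> (lact M a x) = finsum M (\<lambda>i. lact M a (lact M (br x (f i)) (m i))) {..<k2}"
      unfolding \<theta>_def
      by (rule M.finsum_cong')
        (auto simp: br_l a x mc brc lact_mult intro!: lact_closed brc a x mc)
    also have "\<dots> = lact M a (\<theta> x)"
      unfolding \<theta>_def
      by (rule bilin_finsum(2)[symmetric, OF lact_bilin A.module_axioms module_axioms module_axioms _ _ a])
        (auto intro!: lact_closed brc x mc)
    finally show ?thesis .
  qed
  have \<eta>r: "\<eta> (ract M x b) = ract M (\<eta> x) b" if b: "b \<in> carrier B" and x: "x \<in> carrier M" for b x
  proof -
    have "\<eta> (ract M x b) = finsum M (\<lambda>i. ract M (ract M (n i) (pr (q i) x)) b) {..<k1}"
      unfolding \<eta>_def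
      by (rule M.finsum_cong')
        (auto simp: pr_r b x nc prc ract_mult intro!: ract_closed prc b x nc)
    also have "\<dots> = ract M (\<eta> x) b"
      unfolding \<eta>_def
      by (rule bilin_finsum(1)[symmetric, OF ract_bilin module_axioms B.module_axioms module_axioms _ _ b])
        (auto intro!: ract_closed prc x nc)
    finally show ?thesis .
  qed
  \<comment> \<open>From the defining sums only left linearity of \<theta> and right linearity of
    \<eta> can be read off. As the two maps are mutually inverse, each passes its linearity to the
    other.\<close>
  have \<theta>r: "\<theta> (ract M x b) = ract M (\<theta> x) b" if b: "b \<in> carrier B" and x: "x \<in> carrier M" for b x
    using \<theta>\<eta>[OF ract_closed[OF \<theta>c[OF x] b]] \<eta>r[OF b \<theta>c[OF x]] \<eta>\<theta>[OF x] by simp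
  have \<eta>l: "\<eta> (lact M a x) = lact M a (\<eta> x)" if a: "a \<in> carrier A" and x: "x \<in> carrier M" for a x
    using \<eta>\<theta>[OF lact_closed[OF a \<eta>c[OF x]]] \<theta>l[OF a \<eta>c[OF x]] \<theta>\<eta>[OF x] by simp
  have \<theta>h: "\<theta> x \<in> homog M u" if u: "u \<in> carrier \<Gamma>" and x: "x \<in> homog M u" for u x
    unfolding \<theta>_def
  proof (rule submodule_finsum[OF homog_submodule[OF u]])
    fix i assume "i \<in> {..<k2}"
    then have i: "i < k2" by simp
    have "lact M (br x (f i)) (m i) \<in> homog M (u \<otimes>\<^bsub>\<Gamma>\<^esub> d i \<otimes>\<^bsub>\<Gamma>\<^esub> inv\<^bsub>\<Gamma>\<^esub> d i)"
      using u mf(1)[OF i] by (intro lact_homog br_h x mf(2,3) i) auto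
    then show "lact M (br x (f i)) (m i) \<in> homog M u" using u mf(1)[OF i] by (simp add: \<Gamma>.m_assoc)
  qed simp
  have \<eta>h: "\<eta> x \<in> homog M u" if u: "u \<in> carrier \<Gamma>" and x: "x \<in> homog M u" for u x
    unfolding \<eta>_def
  proof (rule submodule_finsum[OF homog_submodule[OF u]])
    fix i assume "i \<in> {..<k1}"
    then have i: "i < k1" by simp
    have "ract M (n i) (pr (q i) x) \<in> homog M (inv\<^bsub>\<Gamma>\<^esub> e i \<otimes>\<^bsub>\<Gamma>\<^esub> (e i \<otimes>\<^bsub>\<Gamma>\<^esub> u))"
      using u nq(1)[OF i] by (intro ract_homog pr_h x nq(2,3) i) auto
    then show "ract M (n i) (pr (q i) x) \<in> homog M u" using u nq(1)[OF i] by (simp add: \<Gamma>.m_assoc[symmetric])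
  qed simp
  have br_dual: "(\<lambda>x\<in>carrier M. br x h) \<in> homog Md v" if v: "v \<in> carrier \<Gamma>" and h: "h \<in> homog Md v" for h v
  proof (rule dual_homogI)
    have hc: "h \<in> carrier Md" by (rule dual_homog_carrier[OF h])
    show "(\<lambda>x\<in>carrier M. br x h) \<in> carrier Md"
      by (rule dualI) (auto simp: brc hc bilin_simps[OF br] br_l)
    fix u x assume u: "u \<in> carrier \<Gamma>" and x: "x \<in> homog M u"
    show "(\<lambda>x\<in>carrier M. br x h) x \<in> homog A (u \<otimes>\<^bsub>\<Gamma>\<^esub> v)"
      using br_h[OF u v x h] homog_carrier[OF u x] by simp
  qed
  \<comment> \<open>The brackets are corrected on the \<open>B\<close> side: p_j becomes
    \<open>pr (f j)\<close> composed with \<theta>, and m_j becomes \<eta>(m_j). As \<theta> and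
    \<eta> cancel, the sum of the p_j(m_j) is unchanged. The functionals are the brackets with f_j
    and q_k, not f_j and q_k themselves.\<close>
  have "morita_data R \<Gamma> D A B M {..<k2} d (\<lambda>j. \<eta> (m j)) (\<lambda>j. \<lambda>x\<in>carrier M. br x (f j)) (\<lambda>j y. pr (f j) (\<theta> y))
    {..<k1} e n (\<lambda>k. \<lambda>x\<in>carrier M. br x (q k))"
  proof (intro morita_data.intro morita_data_axioms.intro graded_bimodule_over_axioms)
    fix j assume "j \<in> {..<k2}"
    then have j: "j < k2" by simp
    show "d j \<in> carrier \<Gamma>" by (rule mf(1)[OF j])
    show "\<eta> (m j) \<in> homog M (inv\<^bsub>\<Gamma>\<^esub> d j)" using mf(1,2)[OF j] by (intro \<eta>h) auto
    show "(\<lambda>x\<in>carrier M. br x (f j)) \<in> homog Md (d j)" by (rule br_dual[OF mf(1,3)[OF j]])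
    show "(\<lambda>y. pr (f j) (\<theta> y)) \<in> linmap R M B"
      by (rule linmap_compose[OF \<theta>lin bilin_right[OF pr mc(2)[OF j]]])
    show "pr (f j) (\<theta> (ract M x b)) = pr (f j) (\<theta> x) \<otimes>\<^bsub>B\<^esub> b" if "x \<in> carrier M" "b \<in> carrier B" for x b
      using that by (simp add: \<theta>r pr_r mc j \<theta>c)
    show "pr (f j) (\<theta> x) \<in> homog B (d j \<otimes>\<^bsub>\<Gamma>\<^esub> g)" if "g \<in> carrier \<Gamma>" "x \<in> homog M g" for g x
      by (rule pr_h[OF mf(1)[OF j] that(1) mf(3)[OF j] \<theta>h[OF that]])
    show "lact M ((\<lambda>x\<in>carrier M. br x (f j)) x) y = ract M x (pr (f j) (\<theta> y))"
      if x: "x \<in> carrier M" and y: "y \<in> carrier M" for x y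
    proof -
      have bc: "br x (f j) \<in> carrier A" using brc x mc j by auto
      \<comment> \<open>The correction pays off here: \<open>\<eta>br\<close> with \<theta> y in
        place of y exhibits the right multiple as an image under \<eta>, and left linearity of
        \<eta> then cancels \<theta>.\<close>
      have "ract M x (pr (f j) (\<theta> y)) = \<eta> (lact M (br x (f j)) (\<theta> y))"
        using \<eta>br[OF x mc(2)[OF j] \<theta>c[OF y]] by simp
      also have "\<dots> = lact M (br x (f j)) y" using \<eta>l[OF bc \<theta>c[OF y]] \<eta>\<theta>[OF y] by simp
      finally show ?thesis using x by simp
    qed
  next
    have "finsum B (\<lambda>j. pr (f j) (\<theta> (\<eta> (m j)))) {..<k2} = finsum B (\<lambda>j. pr (f j) (m j)) {..<k2}"
      by (rule B.M.finsum_cong') (auto simp: \<theta>\<eta> mc prc)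
    then show "finsum B (\<lambda>j. pr (f j) (\<theta> (\<eta> (m j)))) {..<k2} = \<one>\<^bsub>B\<^esub>" using sum_pr by simp
  next
    have "finsum A (\<lambda>k. (\<lambda>x\<in>carrier M. br x (q k)) (n k)) {..<k1} = finsum A (\<lambda>k. br (n k) (q k)) {..<k1}"
      by (rule A.M.finsum_cong') (auto simp: nc brc)
    then show "finsum A (\<lambda>k. (\<lambda>x\<in>carrier M. br x (q k)) (n k)) {..<k1} = \<one>\<^bsub>A\<^esub>" using sum_br by simp
  next
    fix k assume "k \<in> {..<k1}"
    then have k: "k < k1" by simp
    show "e k \<in> carrier \<Gamma>" "n k \<in> homog M (inv\<^bsub>\<Gamma>\<^esub> e k)" using nq(1,2)[OF k] by auto
    show "(\<lambda>x\<in>carrier M. br x (q k)) \<in> homog Md (e k)" by (rule br_dual[OF nq(1,3)[OF k]])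
  qed simp_all
  then show ?thesis by blast
qed

end

section \<open>Tensor products of graded Morita equivalences\<close>

text \<open>The index sets are sets of choice functions, since a tensor of sums over the
  \<open>J i\<close> expands into a sum over \<open>PiE I J\<close>. The functionals on M are
  restricted to the carrier because elements of the dual are extensional; the maps into
  \<open>B\<close> carry no such convention.\<close>

lemma tensor_morita_data:
  assumes R: "cring R" "finite I"
    and md: "\<And>i. i \<in> I \<Longrightarrow> morita_data R (\<Gamma> i) (C i) (A i) (B i) (M i)
      (J i) (d i) (m i) (f i) (p i) (K i) (e i) (n i) (q i)"
  shows "morita_data R (product_group I \<Gamma>) (tensor_acted R I C) (tensor_crossed R I A) (tensor_crossed R I B)
    (tensor_bimod R I M)
    (PiE I J) (\<lambda>j. \<lambda>i\<in>I. d i (j i)) (\<lambda>j. pure_tensor R I M (\<lambda>i. m i (j i)))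
    (\<lambda>j. \<lambda>x\<in>carrier (tensor_module R I M). tensor_map1 R I A (\<lambda>i. f i (j i)) x)
    (\<lambda>j. tensor_map1 R I B (\<lambda>i. p i (j i)))
    (PiE I K) (\<lambda>k. \<lambda>i\<in>I. e i (k i)) (\<lambda>k. pure_tensor R I M (\<lambda>i. n i (k i)))
    (\<lambda>k. \<lambda>x\<in>carrier (tensor_module R I M). tensor_map1 R I A (\<lambda>i. q i (k i)) x)"
proof -
  let ?A = "tensor_crossed R I A" and ?B = "tensor_crossed R I B" and ?M = "tensor_bimod R I M"
    and ?P = "product_group I \<Gamma>" and ?D = "tensor_acted R I C"
  have gb: "graded_bimodule_over R (\<Gamma> i) (C i) (A i) (B i) (M i)" if "i \<in> I" for i
    using morita_data.axioms(1)[OF md[OF that]] .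
  have grM: "graded_module R (\<Gamma> i) (M i)" and bim: "bimodule R (A i) (B i) (M i)"
    and cA: "crossed_product_over R (\<Gamma> i) (C i) (A i)" and cB: "crossed_product_over R (\<Gamma> i) (C i) (B i)"
    if "i \<in> I" for i
    using graded_bimodule_over.axioms[OF gb[OF that]] by auto
  have gA: "graded_module R (\<Gamma> i) (A i)" and gB: "graded_module R (\<Gamma> i) (B i)"
    and alA: "assoc_algebra R (A i)" and alB: "assoc_algebra R (B i)" if "i \<in> I" for i
    using crossed_product_over.axioms(1) crossed_product.axioms(1) graded_algebra.axioms cA cB that by blast+
  note tA = tensor_gradedI[OF R gA] and tB = tensor_gradedI[OF R gB] and tM = tensor_gradedI[OF R grM]
  interpret tA: tensor_graded R I A \<Gamma> by (rule tA)
  interpret tB: tensor_graded R I B \<Gamma> by (rule tB)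
  interpret tM: tensor_graded R I M \<Gamma> by (rule tM)
  interpret G: graded_bimodule_over R ?P ?D ?A ?B ?M by (rule tensor_graded_bimodule_over[OF R gb])
  note fA = tA.tensor_family_axioms and fB = tB.tensor_family_axioms and fM = tM.tensor_family_axioms
  note lb = bimodule.lact_bilin[OF bim] and rb = bimodule.ract_bilin[OF bim]
    and ab = assoc_algebra.mult_bilin[OF alA] and bb = assoc_algebra.mult_bilin[OF alB]
  note tl = tensor_map2_bilin[OF fA fM fM lb] and tr = tensor_map2_bilin[OF fM fB fM rb]
    and ta = tensor_map2_bilin[OF fA fA fA ab] and tb = tensor_map2_bilin[OF fB fB fB bb]
  note pl = tensor_map2_pure[OF fA fM fM lb] and pr = tensor_map2_pure[OF fM fB fM rb]
    and pa = tensor_map2_pure[OF fA fA fA ab] and pb = tensor_map2_pure[OF fB fB fB bb]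
  note zl = bilin_zero[OF tl tA.module_tensor tM.module_tensor tM.module_tensor]
    and zr = bilin_zero[OF tr tM.module_tensor tB.module_tensor tM.module_tensor]
    and za = bilin_zero[OF ta tA.module_tensor tA.module_tensor tA.module_tensor]
    and zb = bilin_zero[OF tb tB.module_tensor tB.module_tensor tB.module_tensor]
  have inv_P: "inv\<^bsub>?P\<^esub> (\<lambda>i\<in>I. x i) = (\<lambda>i\<in>I. inv\<^bsub>\<Gamma> i\<^esub> x i)" if "\<And>i. i \<in> I \<Longrightarrow> x i \<in> carrier (\<Gamma> i)" for x
  proof -
    have "(\<lambda>i\<in>I. x i) \<in> (\<Pi>\<^sub>E i\<in>I. carrier (\<Gamma> i))" using that by simp
    from inv_product_group[OF this graded_module.axioms(2)[OF grM]]
    have "inv\<^bsub>?P\<^esub> (\<lambda>i\<in>I. x i) = (\<lambda>i\<in>I. inv\<^bsub>\<Gamma> i\<^esub> (\<lambda>i\<in>I. x i) i)" by simp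
    also have "\<dots> = (\<lambda>i\<in>I. inv\<^bsub>\<Gamma> i\<^esub> x i)" by (rule restrict_ext) simp
    finally show ?thesis .
  qed
  \<comment> \<open>Linearity over the tensor algebra is bilinear in scalar and argument, so pure
    tensors decide, where it holds factor by factor. The degree of the tensored functional is the
    family of the degrees.\<close>
  have dual: "(\<lambda>x\<in>carrier tM.TM. tensor_map1 R I A h x) \<in> homog G.Md (\<lambda>i\<in>I. v i)"
    if v: "\<And>i. i \<in> I \<Longrightarrow> v i \<in> carrier (\<Gamma> i)"
      and h: "\<And>i. i \<in> I \<Longrightarrow> h i \<in> homog (dual_bimodule (\<Gamma> i) (A i) (M i)) (v i)" for h v
  proof -
    have hd: "h i \<in> carrier (dual_bimodule (\<Gamma> i) (A i) (M i))" if "i \<in> I" for i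
      using graded_bimodule_over.dual_homog_carrier[OF gb h] that by blast
    have hl: "h i \<in> linmap R (M i) (A i)" if "i \<in> I" for i
      using graded_bimodule_over.dual_linmap[OF gb hd] that by blast
    note lin = tensor_map1_linmap[OF fM fA hl] and ph = tensor_map1_pure[OF fM fA hl]
    have hc: "h i x \<in> carrier (A i)" if "i \<in> I" "x \<in> carrier (M i)" for i x
      using linmap_closed[OF hl] that by blast
    have lact: "tensor_map1 R I A h (tensor_map2 R I M (\<lambda>i. lact (M i)) a x) =
        tensor_map2 R I A (\<lambda>i. mult (A i)) a (tensor_map1 R I A h x)"
      if a: "a \<in> carrier tA.TM" and x: "x \<in> carrier tM.TM" for a x
    proof -
      note sims = bilin_simps[OF tl] bilin_simps[OF ta] zl za linmap_closed[OF lin] linmap_add[OF lin]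
        linmap_smult[OF lin] linmap_zero[OF tM.module_tensor tA.module_tensor lin]
      show ?thesis using a
      proof (induction rule: tA.carrier_induct)
        case (pure u)
        have uc: "u i \<in> carrier (A i)" if "i \<in> I" for i using pure that by auto
        note puc = tA.pure_closed[OF uc]
        show ?case using x
        proof (induction rule: tM.carrier_induct)
          case (pure y)
          have yc: "y i \<in> carrier (M i)" if "i \<in> I" for i using pure that by auto
          have lc: "lact (M i) (u i) (y i) \<in> carrier (M i)" if "i \<in> I" for i
            using bilin_closed[OF lb] uc yc that by auto
          have "tA.pure (\<lambda>i. h i (lact (M i) (u i) (y i))) = tA.pure (\<lambda>i. u i \<otimes>\<^bsub>A i\<^esub> h i (y i))"
            by (rule tA.pure_cong) (rule graded_bimodule_over.dual_lact[OF gb hd uc yc])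
          then show ?case by (simp add: pl pa ph uc yc lc hc)
        qed (simp_all add: puc sims)
      qed (simp_all add: x sims)
    qed
    show ?thesis
    proof (rule G.dual_homogI)
      have "(\<lambda>x\<in>carrier ?M. tensor_map1 R I A h x) \<in> carrier G.Md"
        by (rule G.dualI) (simp_all add: linmap_closed[OF lin] linmap_add[OF lin] lact)
      then show "(\<lambda>x\<in>carrier tM.TM. tensor_map1 R I A h x) \<in> carrier G.Md" by simp
      fix u x assume u: "u \<in> carrier ?P" and x: "x \<in> homog ?M u"
      have uc: "u i \<in> carrier (\<Gamma> i)" if "i \<in> I" for i using u that by auto
      have "tensor_map1 R I A h x \<in> tensor_homog R I A (u \<otimes>\<^bsub>?P\<^esub> (\<lambda>i\<in>I. v i))"
      proof (rule tensor_map1_homog[OF tM tA hl _ u])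
        show "u \<otimes>\<^bsub>?P\<^esub> (\<lambda>i\<in>I. v i) \<in> carrier ?P"
          using u v by (intro G.\<Gamma>.m_closed) simp_all
        show "h i y \<in> homog (A i) ((u \<otimes>\<^bsub>?P\<^esub> (\<lambda>i\<in>I. v i)) i)" if "i \<in> I" "y \<in> homog (M i) (u i)" for i y
          using graded_bimodule_over.dual_homogD[OF gb h uc that(2)] that(1) by simp
        show "x \<in> tensor_homog R I M u" using x by simp
      qed
      then show "(\<lambda>x\<in>carrier tM.TM. tensor_map1 R I A h x) x \<in> homog ?A (u \<otimes>\<^bsub>?P\<^esub> (\<lambda>i\<in>I. v i))"
        using tM.tensor_homog_carrier[OF u] x by simp
    qed
  qed
  have fin: "finsum ?A h L = finsum tA.TM h L" "finsum ?B h' L = finsum tB.TM h' L" for h h' L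
    by (rule finsum_fields_cong; simp)+
  show ?thesis
  proof (intro morita_data.intro morita_data_axioms.intro G.graded_bimodule_over_axioms)
    show "finite (PiE I J)" "finite (PiE I K)"
      using R(2) morita_data.finite_J[OF md] morita_data.finite_K[OF md] by (auto intro!: finite_PiE)
  next
    fix j assume j: "j \<in> PiE I J"
    have ji: "j i \<in> J i" if "i \<in> I" for i using j that by auto
    have di: "d i (j i) \<in> carrier (\<Gamma> i)" if "i \<in> I" for i using morita_data.d[OF md ji] that by blast
    have fi: "f i (j i) \<in> homog (dual_bimodule (\<Gamma> i) (A i) (M i)) (d i (j i))" if "i \<in> I" for i
      using morita_data.f[OF md ji] that by blast
    have fl: "f i (j i) \<in> linmap R (M i) (A i)" if "i \<in> I" for i
      using graded_bimodule_over.dual_linmap[OF gb graded_bimodule_over.dual_homog_carrier[OF gb fi]] that by blast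
    have pi: "p i (j i) \<in> linmap R (M i) (B i)" if "i \<in> I" for i using morita_data.p[OF md ji] that by blast
    note flin = tensor_map1_linmap[OF fM fA fl] and fp = tensor_map1_pure[OF fM fA fl]
    note plin = tensor_map1_linmap[OF fM fB pi] and pp = tensor_map1_pure[OF fM fB pi]
    show "(\<lambda>i\<in>I. d i (j i)) \<in> carrier ?P" using di by simp
    show "tM.pure (\<lambda>i. m i (j i)) \<in> homog ?M (inv\<^bsub>?P\<^esub> (\<lambda>i\<in>I. d i (j i)))"
    proof -
      have "inv\<^bsub>?P\<^esub> (\<lambda>i\<in>I. d i (j i)) = (\<lambda>i\<in>I. inv\<^bsub>\<Gamma> i\<^esub> d i (j i))" by (rule inv_P[OF di])
      then show ?thesis using morita_data.m[OF md ji] by (simp add: tM.pure_homog del: inv_product_group)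
    qed
    show "(\<lambda>x\<in>carrier tM.TM. tensor_map1 R I A (\<lambda>i. f i (j i)) x) \<in> homog G.Md (\<lambda>i\<in>I. d i (j i))"
      by (rule dual[OF di fi])
    show "tensor_map1 R I B (\<lambda>i. p i (j i)) \<in> linmap R ?M ?B" using plin by (simp add: linmap_def)
    show "tensor_map1 R I B (\<lambda>i. p i (j i)) (ract ?M x b) = tensor_map1 R I B (\<lambda>i. p i (j i)) x \<otimes>\<^bsub>?B\<^esub> b"
      if "x \<in> carrier ?M" "b \<in> carrier ?B" for x b
    proof -
      have x: "x \<in> carrier tM.TM" and b: "b \<in> carrier tB.TM" using that by simp_all
      note sims = bilin_simps[OF tr] bilin_simps[OF tb] zr zb linmap_closed[OF plin] linmap_add[OF plin]
        linmap_smult[OF plin] linmap_zero[OF tM.module_tensor tB.module_tensor plin]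
      have "tensor_map1 R I B (\<lambda>i. p i (j i)) (tensor_map2 R I M (\<lambda>i. ract (M i)) x b) =
          tensor_map2 R I B (\<lambda>i. mult (B i)) (tensor_map1 R I B (\<lambda>i. p i (j i)) x) b"
        using x
      proof (induction rule: tM.carrier_induct)
        case (pure u)
        have uc: "u i \<in> carrier (M i)" if "i \<in> I" for i using pure that by auto
        note puc = tM.pure_closed[OF uc]
        show ?case using b
        proof (induction rule: tB.carrier_induct)
          case (pure y)
          have yc: "y i \<in> carrier (B i)" if "i \<in> I" for i using pure that by auto
          have rc: "ract (M i) (u i) (y i) \<in> carrier (M i)" "p i (j i) (u i) \<in> carrier (B i)" if "i \<in> I" for i
            using bilin_closed[OF rb] linmap_closed[OF pi] uc yc that by auto
          have "tB.pure (\<lambda>i. p i (j i) (ract (M i) (u i) (y i))) = tB.pure (\<lambda>i. p i (j i) (u i) \<otimes>\<^bsub>B i\<^esub> y i)"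
            by (rule tB.pure_cong) (rule morita_data.p_ract[OF md ji uc yc])
          then show ?case by (simp add: pr pb pp uc yc rc)
        qed (simp_all add: puc sims)
      qed (simp_all add: b sims)
      then show ?thesis by simp
    qed
    show "tensor_map1 R I B (\<lambda>i. p i (j i)) x \<in> homog ?B ((\<lambda>i\<in>I. d i (j i)) \<otimes>\<^bsub>?P\<^esub> g)"
      if g: "g \<in> carrier ?P" and x: "x \<in> homog ?M g" for g x
    proof -
      have gc: "g i \<in> carrier (\<Gamma> i)" if "i \<in> I" for i using g that by auto
      have "tensor_map1 R I B (\<lambda>i. p i (j i)) x \<in> tensor_homog R I B ((\<lambda>i\<in>I. d i (j i)) \<otimes>\<^bsub>?P\<^esub> g)"
      proof (rule tensor_map1_homog[OF tM tB pi _ g])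
        show "(\<lambda>i\<in>I. d i (j i)) \<otimes>\<^bsub>?P\<^esub> g \<in> carrier ?P" using g di by (intro G.\<Gamma>.m_closed) simp_all
        show "p i (j i) y \<in> homog (B i) (((\<lambda>i\<in>I. d i (j i)) \<otimes>\<^bsub>?P\<^esub> g) i)" if "i \<in> I" "y \<in> homog (M i) (g i)" for i y
          using morita_data.p_homog[OF md ji gc that(2)] that(1) by simp
        show "x \<in> tensor_homog R I M g" using x by simp
      qed
      then show ?thesis by simp
    qed
    show "lact ?M ((\<lambda>x\<in>carrier tM.TM. tensor_map1 R I A (\<lambda>i. f i (j i)) x) x) y =
        ract ?M x (tensor_map1 R I B (\<lambda>i. p i (j i)) y)"
      if "x \<in> carrier ?M" "y \<in> carrier ?M" for x y
    proof -
      have x: "x \<in> carrier tM.TM" and y: "y \<in> carrier tM.TM" using that by simp_all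
      note sims = bilin_simps[OF tr] bilin_simps[OF tl] zr zl linmap_closed[OF plin] linmap_add[OF plin]
        linmap_smult[OF plin] linmap_zero[OF tM.module_tensor tB.module_tensor plin]
        linmap_closed[OF flin] linmap_add[OF flin]
        linmap_smult[OF flin] linmap_zero[OF tM.module_tensor tA.module_tensor flin]
      have "tensor_map2 R I M (\<lambda>i. lact (M i)) (tensor_map1 R I A (\<lambda>i. f i (j i)) x) y =
          tensor_map2 R I M (\<lambda>i. ract (M i)) x (tensor_map1 R I B (\<lambda>i. p i (j i)) y)"
        using x
      proof (induction rule: tM.carrier_induct)
        case (pure u)
        have uc: "u i \<in> carrier (M i)" if "i \<in> I" for i using pure that by auto
        note puc = tM.pure_closed[OF uc]
        show ?case using y
        proof (induction rule: tM.carrier_induct)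
          case (pure v)
          have vc: "v i \<in> carrier (M i)" if "i \<in> I" for i using pure that by auto
          have rc: "f i (j i) (u i) \<in> carrier (A i)" "p i (j i) (v i) \<in> carrier (B i)" if "i \<in> I" for i
            using linmap_closed[OF fl] linmap_closed[OF pi] uc vc that by auto
          have "tM.pure (\<lambda>i. lact (M i) (f i (j i) (u i)) (v i)) = tM.pure (\<lambda>i. ract (M i) (u i) (p i (j i) (v i)))"
            by (rule tM.pure_cong) (rule morita_data.f_p[OF md ji uc vc])
          then show ?case by (simp add: pr pl fp pp uc vc rc)
        qed (simp_all add: puc sims)
      qed (simp_all add: y sims)
      then show ?thesis using x by simp
    qed
  next
    have mc: "m i j \<in> carrier (M i)" and pc: "p i j (m i j) \<in> carrier (B i)" if "i \<in> I" "j \<in> J i" for i j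
      using morita_data.m_carrier[OF md] linmap_closed[OF morita_data.p[OF md]] that by blast+
    \<comment> \<open>Evaluating on pure tensors leaves a sum over choice functions of tensors of
      the p_j(m_j). Reading the distributive law backwards makes it the tensor of the unit sums of
      the factors.\<close>
    have "finsum tB.TM (\<lambda>j. tensor_map1 R I B (\<lambda>i. p i (j i)) (tM.pure (\<lambda>i. m i (j i)))) (PiE I J) =
        finsum tB.TM (\<lambda>j. tB.pure (\<lambda>i. p i (j i) (m i (j i)))) (PiE I J)"
    proof (rule tB.TM.M.finsum_cong'[OF refl])
      fix j assume j: "j \<in> PiE I J"
      then have ji: "j i \<in> J i" if "i \<in> I" for i using that by auto
      show "tensor_map1 R I B (\<lambda>i. p i (j i)) (tM.pure (\<lambda>i. m i (j i))) = tB.pure (\<lambda>i. p i (j i) (m i (j i)))"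
        using ji mc by (intro tensor_map1_pure[OF fM fB morita_data.p[OF md]]) auto
    qed (use pc in \<open>auto intro!: tB.pure_closed\<close>)
    also have "\<dots> = tB.pure (\<lambda>i. finsum (B i) (\<lambda>j. p i j (m i j)) (J i))"
      by (rule tB.pure_finsum[symmetric]) (use morita_data.finite_J[OF md] pc in auto)
    also have "\<dots> = tB.pure (\<lambda>i. \<one>\<^bsub>B i\<^esub>)"
      by (rule tB.pure_cong) (rule morita_data.sum_p[OF md])
    finally show "finsum ?B (\<lambda>j. tensor_map1 R I B (\<lambda>i. p i (j i)) (tM.pure (\<lambda>i. m i (j i)))) (PiE I J) = \<one>\<^bsub>?B\<^esub>"
      by (simp add: fin)
  next
    fix k assume k: "k \<in> PiE I K"
    have ki: "k i \<in> K i" if "i \<in> I" for i using k that by auto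
    have ei: "e i (k i) \<in> carrier (\<Gamma> i)" if "i \<in> I" for i using morita_data.e[OF md ki] that by blast
    have qi: "q i (k i) \<in> homog (dual_bimodule (\<Gamma> i) (A i) (M i)) (e i (k i))" if "i \<in> I" for i
      using morita_data.q[OF md ki] that by blast
    show "(\<lambda>i\<in>I. e i (k i)) \<in> carrier ?P" using ei by simp
    show "tM.pure (\<lambda>i. n i (k i)) \<in> homog ?M (inv\<^bsub>?P\<^esub> (\<lambda>i\<in>I. e i (k i)))"
    proof -
      have "inv\<^bsub>?P\<^esub> (\<lambda>i\<in>I. e i (k i)) = (\<lambda>i\<in>I. inv\<^bsub>\<Gamma> i\<^esub> e i (k i))" by (rule inv_P[OF ei])
      then show ?thesis using morita_data.n[OF md ki] by (simp add: tM.pure_homog del: inv_product_group)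
    qed
    show "(\<lambda>x\<in>carrier tM.TM. tensor_map1 R I A (\<lambda>i. q i (k i)) x) \<in> homog G.Md (\<lambda>i\<in>I. e i (k i))"
      by (rule dual[OF ei qi])
  next
    have nc: "n i k \<in> carrier (M i)" and ql: "q i k \<in> linmap R (M i) (A i)" if "i \<in> I" "k \<in> K i" for i k
      using morita_data.n_carrier[OF md] graded_bimodule_over.dual_linmap[OF gb morita_data.q_dual[OF md]] that
      by blast+
    have qc: "q i k (n i k) \<in> carrier (A i)" if "i \<in> I" "k \<in> K i" for i k
      using linmap_closed[OF ql nc] that by blast
    have "finsum tA.TM (\<lambda>k. (\<lambda>x\<in>carrier tM.TM. tensor_map1 R I A (\<lambda>i. q i (k i)) x) (tM.pure (\<lambda>i. n i (k i)))) (PiE I K) =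
        finsum tA.TM (\<lambda>k. tA.pure (\<lambda>i. q i (k i) (n i (k i)))) (PiE I K)"
    proof (rule tA.TM.M.finsum_cong'[OF refl])
      fix k assume k: "k \<in> PiE I K"
      then have ki: "k i \<in> K i" if "i \<in> I" for i using that by auto
      have "tensor_map1 R I A (\<lambda>i. q i (k i)) (tM.pure (\<lambda>i. n i (k i))) = tA.pure (\<lambda>i. q i (k i) (n i (k i)))"
        using ki nc ql by (intro tensor_map1_pure[OF fM fA]) auto
      moreover have "tM.pure (\<lambda>i. n i (k i)) \<in> carrier tM.TM" using ki nc by (intro tM.pure_closed) auto
      ultimately show "(\<lambda>x\<in>carrier tM.TM. tensor_map1 R I A (\<lambda>i. q i (k i)) x) (tM.pure (\<lambda>i. n i (k i))) =
          tA.pure (\<lambda>i. q i (k i) (n i (k i)))" by simp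
    qed (use qc in \<open>auto intro!: tA.pure_closed\<close>)
    also have "\<dots> = tA.pure (\<lambda>i. finsum (A i) (\<lambda>k. q i k (n i k)) (K i))"
      by (rule tA.pure_finsum[symmetric]) (use morita_data.finite_K[OF md] qc in auto)
    also have "\<dots> = tA.pure (\<lambda>i. \<one>\<^bsub>A i\<^esub>)"
      by (rule tA.pure_cong) (rule morita_data.sum_q[OF md])
    finally show "finsum ?A (\<lambda>k. (\<lambda>x\<in>carrier tM.TM. tensor_map1 R I A (\<lambda>i. q i (k i)) x) (tM.pure (\<lambda>i. n i (k i))))
        (PiE I K) = \<one>\<^bsub>?A\<^esub>"
      by (simp add: fin)
  qed
qed

text \<open>\<open>morita_data_exists\<close> provides index sets of natural numbers, so the data of
  all factors have the same types and can be chosen as one family. Each item of data is packed into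
  a tuple for this choice and unpacked by projections afterwards.\<close>

lemma tensor_induces_graded_Morita_equivalence:
  assumes R: "cring R" "finite I"
    and ind: "\<And>i. i \<in> I \<Longrightarrow> induces_graded_Morita_equivalence R (\<Gamma> i) (C i) (A i) (B i) (M i)"
  shows "induces_graded_Morita_equivalence R (product_group I \<Gamma>) (tensor_acted R I C) (tensor_crossed R I A)
    (tensor_crossed R I B) (tensor_bimod R I M)"
proof -
  have "\<exists>z. case z of (J :: nat set, d, m, f, p, K :: nat set, e, n, q) \<Rightarrow>
      morita_data R (\<Gamma> i) (C i) (A i) (B i) (M i) J d m f p K e n q" if "i \<in> I" for i
    using ind[OF that] graded_bimodule_over.morita_data_exists[of R "\<Gamma> i" "C i" "A i" "B i" "M i"]
    unfolding induces_graded_Morita_equivalence_def by fastforce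
  then obtain z where z: "\<And>i. i \<in> I \<Longrightarrow> case z i of (J :: nat set, d, m, f, p, K :: nat set, e, n, q) \<Rightarrow>
      morita_data R (\<Gamma> i) (C i) (A i) (B i) (M i) J d m f p K e n q" by metis
  have "morita_data R (\<Gamma> i) (C i) (A i) (B i) (M i) (fst (z i)) (fst (snd (z i))) (fst (snd (snd (z i))))
      (fst (snd (snd (snd (z i))))) (fst (snd (snd (snd (snd (z i)))))) (fst (snd (snd (snd (snd (snd (z i)))))))
      (fst (snd (snd (snd (snd (snd (snd (z i)))))))) (fst (snd (snd (snd (snd (snd (snd (snd (z i)))))))))
      (snd (snd (snd (snd (snd (snd (snd (snd (z i)))))))))" if "i \<in> I" for i
    using z[OF that] by (simp add: case_prod_beta)
  from morita_data.induces[OF tensor_morita_data[OF R this]] show ?thesis .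
qed

section \<open>The tensor product theorem\<close>

theorem proposition3p3:
  fixes R :: "'o ring"
    and n :: nat
    and G :: "nat \<Rightarrow> 'g monoid"
    and N :: "nat \<Rightarrow> 'g set"
    and C :: "nat \<Rightarrow> ('o, 'g set, 'c) acted"
    and A :: "nat \<Rightarrow> ('o, 'g set, 'c, 'a) crossed"
    and A' :: "nat \<Rightarrow> ('o, 'g set, 'c, 'b) crossed"
    and M :: "nat \<Rightarrow> ('o, 'g set, 'a, 'b, 'm) bimod"
  assumes "cring R" and "\<one>\<^bsub>R\<^esub> \<noteq> \<zero>\<^bsub>R\<^esub>" and "n \<ge> 1"
    and "\<And>i. i \<in> {1..n} \<Longrightarrow> group (G i)"
    and "\<And>i. i \<in> {1..n} \<Longrightarrow> finite (carrier (G i))"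
    and "\<And>i. i \<in> {1..n} \<Longrightarrow> N i \<lhd> G i"
    and "\<And>i. i \<in> {1..n} \<Longrightarrow> graded_acted_algebra R (G i Mod N i) (C i)"
    and "\<And>i. i \<in> {1..n} \<Longrightarrow> crossed_product_over R (G i Mod N i) (C i) (A i)"
    and "\<And>i. i \<in> {1..n} \<Longrightarrow> crossed_product_over R (G i Mod N i) (C i) (A' i)"
    and "\<And>i. i \<in> {1..n} \<Longrightarrow> \<one>\<^bsub>C i\<^esub> \<noteq> \<zero>\<^bsub>C i\<^esub>"
    and "\<And>i. i \<in> {1..n} \<Longrightarrow> \<one>\<^bsub>A i\<^esub> \<noteq> \<zero>\<^bsub>A i\<^esub>"
    and "\<And>i. i \<in> {1..n} \<Longrightarrow> \<one>\<^bsub>A' i\<^esub> \<noteq> \<zero>\<^bsub>A' i\<^esub>"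
    and "\<And>i. i \<in> {1..n} \<Longrightarrow> graded_bimodule_over R (G i Mod N i) (C i) (A i) (A' i) (M i)"
    and "\<And>i. i \<in> {1..n} \<Longrightarrow>
      induces_graded_Morita_equivalence R (G i Mod N i) (C i) (A i) (A' i) (M i)"
  shows
    "graded_bimodule_over R (product_group {1..n} (\<lambda>i. G i Mod N i)) (tensor_acted R {1..n} C)
      (tensor_crossed R {1..n} A) (tensor_crossed R {1..n} A') (tensor_bimod R {1..n} M) \<and>
    induces_graded_Morita_equivalence R (product_group {1..n} (\<lambda>i. G i Mod N i)) (tensor_acted R {1..n} C)
      (tensor_crossed R {1..n} A) (tensor_crossed R {1..n} A') (tensor_bimod R {1..n} M)"
proof -
  have R: "cring R" "finite {1..n}" using assms(1) by simp_all
  show ?thesis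
    by (intro conjI tensor_graded_bimodule_over tensor_induces_graded_Morita_equivalence R assms(13,14))
qed

end
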